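(* The adjoint $S\mapsto S^*$ maps $\mathcal B_T^r(H)$ onto itself and is an order isomorphism of the vector lattice $\mathcal B_T^r(H)$. In particular, for every $S\in\mathcal B_T^r(H)$, $$\bigl(|S|_{\rm ord}\bigr)^*=|S^*|_{\rm ord},\qquad (S^+)^*=(S^* )^+,\qquad (S^-)^*=(S^* )^-.$$ Moreover, since $\mathcal B_T^r(H)$ is Dedekind complete, the adjoint preserves every bounded supremum and infimum: for every nonempty family $(S_\alpha)$ in $\mathcal B_T^r(H)$ which is bounded above, respectively bounded below, in $\mathcal B_T^r(H)$, $$\Bigl(\sup_\alpha S_\alpha\Bigr)^*=\sup_\alpha S_\alpha^*,\qquad\text{respectively}\qquad \Bigl(\inf_\alpha S_\alpha\Bigr)^*=\inf_\alpha S_\alpha^*.$$ In particular, $S_\alpha\uparrow S$ in $\mathcal B_T^r(H)$ implies $S_\alpha^*\uparrow S^*$.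
   Context: Setting. All spaces are real. $E$ is a Dedekind complete Riesz space with weak order unit $e$. $T:E\to E$ is a conditional expectation operator, i.e. a positive order-continuous linear projection whose range is a Dedekind complete Riesz subspace and which maps weak order units to weak order units; it satisfies $Te=e$ and is strictly positive ($x\ge 0$ and $Tx=0$ imply $x=0$). $E^u$ is the universal completion of $E$, with its $f$-algebra multiplication having unit $e$. $L^1(T)\subseteq E^u$ is the natural domain of $T$: the set of differences $f_1-f_2$ with $f_i\in E^u_+$ such that there is a net $(f_\alpha)$ in $E_+$ with $f_\alpha\uparrow f_i$ in $E^u$ and $(Tf_\alpha)$ bounded above in $E^u$; $T$ is extended to $L^1(T)$ by $Tf_i=\sup_\alpha Tf_\alpha$, and the extension, still denoted $T$, is again a strictly positive conditional expectation on $L^1(T)$ with $Te=e$. $A:=R(T)$ is the range of the (extended) $T$; it is a Dedekind complete unital Archimedean $f$-algebra with unit $e$, and $T(az)=aT(z)$ for $a\in A$ whenever the products are defined. $H:=L^2(T)=\{x\in L^1(T):x^2\in L^1(T)\}$ with the inherited order is a Dedekind complete Riesz space and an $A$-module. For $x,y\in H$, $\langle x,y\rangle_T:=T(xy)\in A$ and $\|x\|_{T,2}:=(T(x^2))^{1/2}\in A_+$ (the positive square root in $A$). Definitions. $\mathcal B_T(H)$ is the set of $A$-linear (additive and $A$-homogeneous) maps $S:H\to H$ that are $T$-strongly bounded: there is $k\in A_+$ with $\|Sx\|_{T,2}\le k\|x\|_{T,2}$ for all $x\in H$. For $S\in\mathcal B_T(H)$, the adjoint $S^*$ is the unique operator in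 $\mathcal B_T(H)$ with $\langle Sx,y\rangle_T=\langle x,S^*y\rangle_T$ for all $x,y\in H$ (it always exists). An operator $S$ on $H$ is order positive if $x\ge0$ implies $Sx\ge0$; $R\le Q$ means that $Q-R$ is order positive. $\mathcal B_T(H)_+$ is the set of order-positive operators in $\mathcal B_T(H)$, and $\mathcal B_T^r(H):=\mathcal B_T(H)_+-\mathcal B_T(H)_+$ (the $T$-regular operators), a Dedekind complete vector lattice for this order, whose lattice operations are the Riesz--Kantorovich ones: $|S|_{\rm ord}x=\sup\{|Su|:|u|\le x\}$ for $x\in H_+$, $S^+=\tfrac12(|S|_{\rm ord}+S)$, $S^-=\tfrac12(|S|_{\rm ord}-S)$. *)

theory Defs
  imports "HOL-Analysis.Analysis" "HOL-Library.Lattice_Algebras"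
begin

definition is_lub_on :: "('a \<Rightarrow> 'a \<Rightarrow> bool) \<Rightarrow> 'a set \<Rightarrow> 'a set \<Rightarrow> 'a \<Rightarrow> bool" where
  "is_lub_on le C X s \<longleftrightarrow>
     s \<in> C \<and> (\<forall>x\<in>X. le x s) \<and> (\<forall>u\<in>C. (\<forall>x\<in>X. le x u) \<longrightarrow> le s u)"

definition is_glb_on :: "('a \<Rightarrow> 'a \<Rightarrow> bool) \<Rightarrow> 'a set \<Rightarrow> 'a set \<Rightarrow> 'a \<Rightarrow> bool" where
  "is_glb_on le C X s \<longleftrightarrow>
     s \<in> C \<and> (\<forall>x\<in>X. le s x) \<and> (\<forall>u\<in>C. (\<forall>x\<in>X. le u x) \<longrightarrow> le u s)"

definition directed_by :: "('a \<Rightarrow> 'a \<Rightarrow> bool) \<Rightarrow> 'a set \<Rightarrow> bool" where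
  "directed_by le D \<longleftrightarrow> D \<noteq> {} \<and> (\<forall>x\<in>D. \<forall>y\<in>D. \<exists>z\<in>D. le x z \<and> le y z)"

text \<open>The net \<open>(F i)\<close>, \<open>i \<in> I\<close>, indexed by a set directed by the preorder \<open>r\<close>, increases
  to \<open>s\<close> in the ordered set \<open>C\<close>.\<close>

definition increasing_net_to ::
    "('i \<Rightarrow> 'i \<Rightarrow> bool) \<Rightarrow> 'i set \<Rightarrow> ('a \<Rightarrow> 'a \<Rightarrow> bool) \<Rightarrow> 'a set \<Rightarrow> ('i \<Rightarrow> 'a) \<Rightarrow> 'a \<Rightarrow> bool" where
  "increasing_net_to r I le C F s \<longleftrightarrow>
     directed_by r I \<and> (\<forall>i\<in>I. r i i) \<and>
     (\<forall>i\<in>I. \<forall>j\<in>I. \<forall>k\<in>I. r i j \<longrightarrow> r j k \<longrightarrow> r i k) \<and>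
     F ` I \<subseteq> C \<and> (\<forall>i\<in>I. \<forall>j\<in>I. r i j \<longrightarrow> le (F i) (F j)) \<and>
     is_lub_on le C (F ` I) s"

definition dedekind_complete_on :: "'a::order set \<Rightarrow> bool" where
  "dedekind_complete_on C \<longleftrightarrow>
     (\<forall>X. X \<subseteq> C \<longrightarrow> X \<noteq> {} \<longrightarrow> (\<exists>u\<in>C. \<forall>x\<in>X. x \<le> u) \<longrightarrow> (\<exists>s. is_lub_on (\<le>) C X s))"

text \<open>A universally complete (Dedekind complete and laterally complete) Riesz space with a
  commutative \<open>f\<close>-algebra multiplication (an Archimedean \<open>f\<close>-algebra is always
  commutative). The multiplicative unit is a parameter of the conditional expectation setting
  below, so that the zero space is not excluded.\<close>

class universally_complete_f_algebra =
  lattice_ring + comm_ring + real_algebra + ordered_real_vector + conditionally_complete_lattice +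
  assumes f_algebra: "inf x y = 0 \<Longrightarrow> 0 \<le> z \<Longrightarrow> inf (x * z) y = 0"
    and laterally_complete:
      "(\<And>x. x \<in> D \<Longrightarrow> 0 \<le> x) \<Longrightarrow> (\<And>x y. x \<in> D \<Longrightarrow> y \<in> D \<Longrightarrow> x \<noteq> y \<Longrightarrow> inf x y = 0) \<Longrightarrow>
       bdd_above D"

definition riesz_subspace :: "'u::universally_complete_f_algebra set \<Rightarrow> bool" where
  "riesz_subspace V \<longleftrightarrow> subspace V \<and> (\<forall>x\<in>V. \<forall>y\<in>V. sup x y \<in> V \<and> inf x y \<in> V)"

definition order_dense :: "'u::universally_complete_f_algebra set \<Rightarrow> bool" where
  "order_dense V \<longleftrightarrow> (\<forall>u>0. \<exists>x\<in>V. 0 < x \<and> x \<le> u)"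

definition weak_order_unit :: "'u::universally_complete_f_algebra set \<Rightarrow> 'u \<Rightarrow> bool" where
  "weak_order_unit V w \<longleftrightarrow> w \<in> V \<and> 0 \<le> w \<and> (\<forall>x\<in>V. 0 \<le> x \<longrightarrow> inf x w = 0 \<longrightarrow> x = 0)"

text \<open>The type \<open>'u\<close> is the universal completion of the Dedekind complete Riesz space \<open>E\<close>,
  which is identified with its image in \<open>'u\<close>; the values of \<open>T\<close> outside \<open>E\<close> are irrelevant.
  Here and below, nets of vectors are represented by the directed sets of their members.\<close>

locale riesz_conditional_expectation =
  fixes E :: "'u::universally_complete_f_algebra set" and e :: 'u and T :: "'u \<Rightarrow> 'u"
  assumes E_riesz: "riesz_subspace E"
    and E_complete: "dedekind_complete_on E"
    and E_dense: "order_dense E"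
    and unit: "weak_order_unit E e"
    and mult_unit: "\<And>x. e * x = x"
    and T_maps: "\<And>x. x \<in> E \<Longrightarrow> T x \<in> E"
    and T_add: "\<And>x y. x \<in> E \<Longrightarrow> y \<in> E \<Longrightarrow> T (x + y) = T x + T y"
    and T_scale: "\<And>c x. x \<in> E \<Longrightarrow> T (c *\<^sub>R x) = c *\<^sub>R T x"
    and T_pos: "\<And>x. x \<in> E \<Longrightarrow> 0 \<le> x \<Longrightarrow> 0 \<le> T x"
    and T_proj: "\<And>x. x \<in> E \<Longrightarrow> T (T x) = T x"
    and T_order_continuous:
      "\<And>D. D \<subseteq> E \<Longrightarrow> directed_by (\<lambda>x y. y \<le> x) D \<Longrightarrow> is_glb_on (\<le>) E D 0 \<Longrightarrow>
         is_glb_on (\<le>) E (T ` D) 0"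
    and T_range_riesz: "riesz_subspace (T ` E)"
    and T_range_complete: "dedekind_complete_on (T ` E)"
    and T_weak_units: "\<And>w. weak_order_unit E w \<Longrightarrow> weak_order_unit E (T w)"
    and T_unit: "T e = e"
    and T_strict: "\<And>x. x \<in> E \<Longrightarrow> 0 \<le> x \<Longrightarrow> T x = 0 \<Longrightarrow> x = 0"

definition approximates ::
    "'u::universally_complete_f_algebra set \<Rightarrow> ('u \<Rightarrow> 'u) \<Rightarrow> 'u set \<Rightarrow> 'u \<Rightarrow> bool" where
  "approximates E T D f \<longleftrightarrow>
     D \<subseteq> E \<and> (\<forall>x\<in>D. 0 \<le> x) \<and> directed_by (\<le>) D \<and> is_lub_on (\<le>) UNIV D f \<and> bdd_above (T ` D)"

definition L1_cone ::
    "'u::universally_complete_f_algebra set \<Rightarrow> ('u \<Rightarrow> 'u) \<Rightarrow> 'u set" where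
  "L1_cone E T = {f. \<exists>D. approximates E T D f}"

definition L1 :: "'u::universally_complete_f_algebra set \<Rightarrow> ('u \<Rightarrow> 'u) \<Rightarrow> 'u set" where
  "L1 E T = {f - g | f g. f \<in> L1_cone E T \<and> g \<in> L1_cone E T}"

definition cone_ext ::
    "'u::universally_complete_f_algebra set \<Rightarrow> ('u \<Rightarrow> 'u) \<Rightarrow> 'u \<Rightarrow> 'u" where
  "cone_ext E T f = (THE t. \<exists>D. approximates E T D f \<and> t = Sup (T ` D))"

definition cond_ext ::
    "'u::universally_complete_f_algebra set \<Rightarrow> ('u \<Rightarrow> 'u) \<Rightarrow> 'u \<Rightarrow> 'u" where
  "cond_ext E T h =
     (THE t. \<exists>f\<in>L1_cone E T. \<exists>g\<in>L1_cone E T. h = f - g \<and> t = cone_ext E T f - cone_ext E T g)"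

definition cond_range ::
    "'u::universally_complete_f_algebra set \<Rightarrow> ('u \<Rightarrow> 'u) \<Rightarrow> 'u set" where
  "cond_range E T = cond_ext E T ` L1 E T"

definition L2 :: "'u::universally_complete_f_algebra set \<Rightarrow> ('u \<Rightarrow> 'u) \<Rightarrow> 'u set" where
  "L2 E T = {x \<in> L1 E T. x * x \<in> L1 E T}"

definition T_inner ::
    "'u::universally_complete_f_algebra set \<Rightarrow> ('u \<Rightarrow> 'u) \<Rightarrow> 'u \<Rightarrow> 'u \<Rightarrow> 'u" where
  "T_inner E T x y = cond_ext E T (x * y)"

definition T_norm ::
    "'u::universally_complete_f_algebra set \<Rightarrow> ('u \<Rightarrow> 'u) \<Rightarrow> 'u \<Rightarrow> 'u" where
  "T_norm E T x = (THE r. r \<in> cond_range E T \<and> 0 \<le> r \<and> r * r = cond_ext E T (x * x))"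

text \<open>An operator on \<open>L\<^sup>2(T)\<close> is represented by the function on \<open>'u\<close> that vanishes outside
  \<open>L\<^sup>2(T)\<close>. This makes equality of operators equality of functions, and sums and real
  multiples of operators are computed pointwise.\<close>

definition B_T ::
    "'u::universally_complete_f_algebra set \<Rightarrow> ('u \<Rightarrow> 'u) \<Rightarrow> ('u \<Rightarrow> 'u) set" where
  "B_T E T = {S.
     (\<forall>x. x \<notin> L2 E T \<longrightarrow> S x = 0) \<and>
     (\<forall>x\<in>L2 E T. S x \<in> L2 E T) \<and>
     (\<forall>x\<in>L2 E T. \<forall>y\<in>L2 E T. S (x + y) = S x + S y) \<and>
     (\<forall>a\<in>cond_range E T. \<forall>x\<in>L2 E T. S (a * x) = a * S x) \<and>
     (\<exists>k\<in>cond_range E T. 0 \<le> k \<and> (\<forall>x\<in>L2 E T. T_norm E T (S x) \<le> k * T_norm E T x))}"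

definition adjoint_T ::
    "'u::universally_complete_f_algebra set \<Rightarrow> ('u \<Rightarrow> 'u) \<Rightarrow> ('u \<Rightarrow> 'u) \<Rightarrow> 'u \<Rightarrow> 'u" where
  "adjoint_T E T S =
     (THE R. R \<in> B_T E T \<and>
        (\<forall>x\<in>L2 E T. \<forall>y\<in>L2 E T. T_inner E T (S x) y = T_inner E T x (R y)))"

definition order_positive ::
    "'u::universally_complete_f_algebra set \<Rightarrow> ('u \<Rightarrow> 'u) \<Rightarrow> ('u \<Rightarrow> 'u) \<Rightarrow> bool" where
  "order_positive E T S \<longleftrightarrow> (\<forall>x\<in>L2 E T. 0 \<le> x \<longrightarrow> 0 \<le> S x)"

definition op_le ::
    "'u::universally_complete_f_algebra set \<Rightarrow> ('u \<Rightarrow> 'u) \<Rightarrow> ('u \<Rightarrow> 'u) \<Rightarrow> ('u \<Rightarrow> 'u) \<Rightarrow> bool" where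
  "op_le E T R Q \<longleftrightarrow> order_positive E T (\<lambda>x. Q x - R x)"

definition B_T_pos ::
    "'u::universally_complete_f_algebra set \<Rightarrow> ('u \<Rightarrow> 'u) \<Rightarrow> ('u \<Rightarrow> 'u) set" where
  "B_T_pos E T = {S \<in> B_T E T. order_positive E T S}"

definition B_T_reg ::
    "'u::universally_complete_f_algebra set \<Rightarrow> ('u \<Rightarrow> 'u) \<Rightarrow> ('u \<Rightarrow> 'u) set" where
  "B_T_reg E T = {(\<lambda>x. P x - Q x) | P Q. P \<in> B_T_pos E T \<and> Q \<in> B_T_pos E T}"

definition riesz_kantorovich ::
    "'u::universally_complete_f_algebra set \<Rightarrow> ('u \<Rightarrow> 'u) \<Rightarrow> ('u \<Rightarrow> 'u) \<Rightarrow> 'u \<Rightarrow> 'u" where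
  "riesz_kantorovich E T S x =
     (THE s. is_lub_on (\<le>) (L2 E T) {\<bar>S u\<bar> | u. u \<in> L2 E T \<and> \<bar>u\<bar> \<le> x} s)"

text \<open>The Riesz--Kantorovich formula defines the modulus on positive vectors; it is extended
  linearly by \<open>x = x\<^sup>+ - x\<^sup>-\<close>.\<close>

definition op_abs ::
    "'u::universally_complete_f_algebra set \<Rightarrow> ('u \<Rightarrow> 'u) \<Rightarrow> ('u \<Rightarrow> 'u) \<Rightarrow> 'u \<Rightarrow> 'u" where
  "op_abs E T S x =
     (if x \<in> L2 E T
      then riesz_kantorovich E T S (sup x 0) - riesz_kantorovich E T S (sup (- x) 0)
      else 0)"

definition op_pos_part ::
    "'u::universally_complete_f_algebra set \<Rightarrow> ('u \<Rightarrow> 'u) \<Rightarrow> ('u \<Rightarrow> 'u) \<Rightarrow> 'u \<Rightarrow> 'u" where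
  "op_pos_part E T S x = (1/2) *\<^sub>R (op_abs E T S x + S x)"

definition op_neg_part ::
    "'u::universally_complete_f_algebra set \<Rightarrow> ('u \<Rightarrow> 'u) \<Rightarrow> ('u \<Rightarrow> 'u) \<Rightarrow> 'u \<Rightarrow> 'u" where
  "op_neg_part E T S x = (1/2) *\<^sub>R (op_abs E T S x - S x)"

end

theory Submission
  imports Defs
begin

text \<open>The adjoint is an involution that preserves order positivity: if \<open>P\<close> is order positive and
  \<open>y \<ge> 0\<close>, testing \<open>T(P x \<sqdot> y) = T(x \<sqdot> P\<^sup>*y)\<close> at \<open>x = (P\<^sup>*y)\<^sup>-\<close> gives \<open>(P\<^sup>*y)\<^sup>- = 0\<close>. Hence it is an
  order isomorphism of the regular operators and preserves every supremum and infimum that exists.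
  Existence is the substance. The adjoint of \<open>P\<close> comes from a conditional Radon--Nikodym argument: the
  positive functional \<open>f x = T(P x \<sqdot> y)\<close> is represented by the largest \<open>g \<ge> 0\<close> with
  \<open>T(g x) \<le> f x\<close> for \<open>x \<ge> 0\<close>. This \<open>g\<close> exists because, by lateral completeness, a directed set with bounded
  conditional expectations is order bounded, and the remainder \<open>f - T(g \<sqdot>)\<close> vanishes by a Hahn
  decomposition. Suprema of operators are given by Riesz--Kantorovich sums, and \<open>|S|\<close> is the supremum
  of \<open>S\<close> and \<open>-S\<close>. Function representations of the universal completion are avoided: the averaging
  identity for \<open>T\<close> follows from Jensen's inequality for squares, and components and square roots are
  constructed as suprema.\<close>

text \<open>Elements of the universal completion are unbounded, and elements of the range A of T
  need not be invertible, so neither division nor case distinction at a point is available. Three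
  devices stand in for them. The cutoff \<open>pprt (real n *\<^sub>R e - z)\<close> is a multiplier
  supported where \<open>z\<close> is below \<open>n\<close>: a claim is proved after multiplication
  by it, where \<open>z\<close> behaves like a bounded factor, and \<open>unit_approx\<close>
  removes it again. The truncation \<open>inf (pprt \<psi>) e\<close> replaces the indicator of the
  region where \<open>\<psi>\<close> is positive and stays in A whenever \<open>\<psi>\<close> does.
  A common factor of two products is cancelled by estimating the cube of a positive part. The
  adjoint is obtained from order, not from norm completeness of L2. A largest density can only be
  sought for a positive functional, which is why existence is proved for order positive operators
  and reaches exactly their differences, the regular operators.\<close>

declare neg_inf_eq_sup [simp del] neg_sup_eq_inf [simp del]
  diff_inf_eq_sup [simp del] diff_sup_eq_inf [simp del]

section \<open>Lattice-ordered groups and least upper bounds\<close>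

abbreviation lub :: "'a::order set \<Rightarrow> 'a \<Rightarrow> bool" where
  "lub D s \<equiv> is_lub_on (\<le>) UNIV D s"

lemma lubI: "(\<And>d. d \<in> D \<Longrightarrow> d \<le> s) \<Longrightarrow> (\<And>u. (\<And>d. d \<in> D \<Longrightarrow> d \<le> u) \<Longrightarrow> s \<le> u) \<Longrightarrow> lub D s"
  by (simp add: is_lub_on_def)

lemma lub_upper: "lub D s \<Longrightarrow> d \<in> D \<Longrightarrow> d \<le> s"
  by (simp add: is_lub_on_def)

lemma lub_least: "lub D s \<Longrightarrow> (\<And>d. d \<in> D \<Longrightarrow> d \<le> u) \<Longrightarrow> s \<le> u"
  by (simp add: is_lub_on_def)

lemma lub_unique: "lub D s \<Longrightarrow> lub D t \<Longrightarrow> s = t"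
  by (meson lub_least lub_upper order.antisym)

lemma lub_Sup: "D \<noteq> {} \<Longrightarrow> bdd_above D \<Longrightarrow> lub D (Sup D)"
  for D :: "'a::conditionally_complete_lattice set"
  by (auto intro!: lubI cSup_upper cSup_least)

lemma lub_bdd: "lub D s \<Longrightarrow> bdd_above D"
  by (meson bdd_above.I lub_upper)

lemma lub_Sup_eq: "D \<noteq> {} \<Longrightarrow> lub D s \<Longrightarrow> Sup D = s"
  for D :: "'a::conditionally_complete_lattice set"
  by (meson lub_Sup lub_bdd lub_unique)

lemma lub_singleton: "lub {x} x"
  by (auto intro: lubI)

lemma diff_inf_pprt:
  fixes x y :: "'a::lattice_ab_group_add"
  shows "x - inf x y = pprt (x - y)"
  by (simp add: pprt_def diff_inf_eq_sup add_sup_inf_distribs sup_commute)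

lemma sup_eq_add_pprt:
  fixes x y :: "'a::lattice_ab_group_add"
  shows "sup x y = y + pprt (x - y)"
  by (simp add: pprt_def add_sup_inf_distribs)

lemma pprt_minus:
  fixes x :: "'a::lattice_ab_group_add"
  shows "pprt x - pprt (- x) = x"
  using prts[of x] by (simp add: pprt_neg)

lemma pprt_disjoint:
  fixes x :: "'a::lattice_ab_group_add"
  shows "inf (pprt x) (pprt (- x)) = 0"
proof -
  have "inf (pprt x) (pprt (- x)) = inf (pprt x + 0) (pprt x + (- x))"
    using pprt_minus[of x] by (simp only: add_0_right) (simp add: algebra_simps)
  also have "\<dots> = pprt x + inf 0 (- x)"
    by (simp add: add_inf_distrib_left)
  also have "\<dots> = 0"
    by (simp add: inf_eq_neg_sup pprt_def sup_commute)
  finally show ?thesis .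
qed

lemma pprt_diff_disjoint:
  fixes x y :: "'a::lattice_ab_group_add"
  shows "inf x y = 0 \<Longrightarrow> pprt (x - y) = x"
  using diff_inf_pprt[of x y] by simp

text \<open>The Riesz decomposition property with explicit pieces; the second one is
  \<open>pprt (z - x)\<close>. Additivity of the extended T (\<open>cone_add\<close>) and the
  refinement of Riesz--Kantorovich sums (\<open>rk_split\<close>) rest on it.\<close>

lemma riesz_split:
  fixes x y z :: "'a::lattice_ab_group_add"
  assumes "0 \<le> x" "0 \<le> y" "0 \<le> z" "z \<le> x + y"
  shows "0 \<le> inf x z" "inf x z \<le> x" "0 \<le> z - inf x z" "z - inf x z \<le> y"
proof -
  have "z - inf x z = pprt (z - x)"
    by (simp add: inf_commute[of x z] diff_inf_pprt)
  moreover have "pprt (z - x) \<le> y"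
    using assms by (auto simp: pprt_def algebra_simps)
  ultimately show "z - inf x z \<le> y" by simp
qed (use assms in auto)

lemma abs_pprt: "\<bar>x\<bar> = pprt x + pprt (- x)" for x :: "'a::lattice_ab_group_add_abs"
  by (simp add: abs_prts pprt_neg)

lemma pprt_le_abs: "pprt x \<le> \<bar>x\<bar>" "pprt (- x) \<le> \<bar>x\<bar>" for x :: "'a::lattice_ab_group_add_abs"
  using zero_le_pprt[of x] zero_le_pprt[of "- x"]
  by (simp_all only: abs_pprt le_add_same_cancel1 le_add_same_cancel2)

text \<open>By \<open>x + d = sup x d + inf x d\<close>, a bound \<open>u\<close> of the infima
  bounds every \<open>d\<close> by \<open>u + sup x s - x\<close>, which no longer depends on
  \<open>d\<close>.\<close>

lemma lub_inf:
  fixes s :: "'a::lattice_ab_group_add"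
  assumes "lub D s"
  shows "lub (inf x ` D) (inf x s)"
proof (rule lubI)
  show "d \<le> inf x s" if "d \<in> inf x ` D" for d
    using that lub_upper[OF assms] by (auto intro: le_infI2)
  fix u assume u: "\<And>d. d \<in> inf x ` D \<Longrightarrow> d \<le> u"
  have "s \<le> u + sup x s - x"
  proof (rule lub_least[OF assms])
    fix d assume d: "d \<in> D"
    have "x + d = sup x d + inf x d"
      by (rule add_eq_inf_sup)
    also have "\<dots> \<le> sup x s + u"
      using u d lub_upper[OF assms d] by (intro add_mono) (auto intro: le_supI2)
    finally show "d \<le> u + sup x s - x"
      by (simp add: algebra_simps)
  qed
  then show "inf x s \<le> u"
    using add_eq_inf_sup[of x s] by (simp add: algebra_simps)
qed

section \<open>Universally complete \<open>f\<close>-algebras\<close>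

text \<open>Dedekind completeness gives the multiples a supremum. A multiple plus \<open>x\<close>
  is the next multiple, so subtracting \<open>x\<close> from the supremum still leaves an upper
  bound.\<close>

lemma archimedean:
  fixes x y :: "'u::universally_complete_f_algebra"
  assumes "\<And>n. real (Suc n) *\<^sub>R x \<le> y"
  shows "x \<le> 0"
proof -
  let ?X = "range (\<lambda>n. real (Suc n) *\<^sub>R x)"
  have "lub ?X (Sup ?X)"
    by (rule lub_Sup) (auto intro: assms bdd_aboveI[of _ y] simp del: of_nat_Suc)
  then have "Sup ?X \<le> Sup ?X - x"
  proof (rule lub_least)
    fix d assume "d \<in> ?X"
    then obtain n where "d = real (Suc n) *\<^sub>R x" by auto
    then have "d + x = real (Suc (Suc n)) *\<^sub>R x"
      by (simp add: algebra_simps flip: scaleR_2)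
    also have "\<dots> \<le> Sup ?X"
      using \<open>lub ?X (Sup ?X)\<close> by (blast intro: lub_upper)
    finally show "d \<le> Sup ?X - x"
      by (simp add: algebra_simps)
  qed
  then show ?thesis by simp
qed

lemma archimedean_le:
  fixes x y z :: "'u::universally_complete_f_algebra"
  assumes "\<And>n. x \<le> y + (1 / real (Suc n)) *\<^sub>R z"
  shows "x \<le> y"
proof -
  have "real (Suc n) *\<^sub>R (x - y) \<le> z" for n
  proof -
    have "x - y \<le> (1 / real (Suc n)) *\<^sub>R z"
      using assms[of n] by (simp add: algebra_simps)
    then have "real (Suc n) *\<^sub>R (x - y) \<le> real (Suc n) *\<^sub>R ((1 / real (Suc n)) *\<^sub>R z)"
      by (intro scaleR_left_mono) auto
    then show ?thesis by simp
  qed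
  from archimedean[OF this] show ?thesis by simp
qed

text \<open>Two uses of the f-algebra axiom replace first \<open>x\<close> and then \<open>y\<close>
  by the product, which is therefore disjoint from itself.\<close>

lemma mult_disjoint:
  fixes x y :: "'u::universally_complete_f_algebra"
  assumes "inf x y = 0" shows "x * y = 0"
proof -
  have "0 \<le> x" "0 \<le> y" using assms by (metis inf_le1, metis inf_le2)
  have "inf (x * y) y = 0" using assms \<open>0 \<le> y\<close> by (rule f_algebra)
  then have "inf y (x * y) = 0" by (simp add: inf_commute)
  then have "inf (y * x) (x * y) = 0" using \<open>0 \<le> x\<close> by (rule f_algebra)
  then show ?thesis by (simp add: mult.commute)
qed

lemma pprt_mult_neg:
  fixes x :: "'u::universally_complete_f_algebra"
  shows "pprt x * pprt (- x) = 0"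
  by (rule mult_disjoint) (rule pprt_disjoint)

lemma mult_pprt:
  fixes x :: "'u::universally_complete_f_algebra"
  shows "x * pprt x = pprt x * pprt x"
proof -
  have "x * pprt x = (pprt x - pprt (- x)) * pprt x" by (simp add: pprt_minus)
  also have "\<dots> = pprt x * pprt x - pprt x * pprt (- x)" by (simp add: algebra_simps)
  finally show ?thesis by (simp only: pprt_mult_neg) simp
qed

lemma square_nonneg:
  fixes x :: "'u::universally_complete_f_algebra"
  shows "0 \<le> x * x"
proof -
  have "x * x = (pprt x - pprt (- x)) * (pprt x - pprt (- x))" by (simp add: pprt_minus)
  also have "\<dots> = pprt x * pprt x + pprt (- x) * pprt (- x)"
    using pprt_mult_neg by (simp add: algebra_simps)
  finally show ?thesis by simp
qed

lemma abs_mult_abs: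
  fixes x :: "'u::universally_complete_f_algebra"
  shows "\<bar>x\<bar> * \<bar>x\<bar> = x * x"
proof -
  have "x * x = (pprt x - pprt (- x)) * (pprt x - pprt (- x))" by (simp add: pprt_minus)
  also have "\<dots> = \<bar>x\<bar> * \<bar>x\<bar> - (pprt x * pprt (- x) + pprt x * pprt (- x) + pprt x * pprt (- x) + pprt x * pprt (- x))"
    by (simp add: abs_pprt algebra_simps)
  finally show ?thesis by (simp add: pprt_mult_neg)
qed

text \<open>Disjointness of the two parts of \<open>x\<close> survives multiplication by
  \<open>z\<close>, so \<open>z * pprt x\<close> and \<open>z * pprt (- x)\<close> are the two parts
  of \<open>z * x\<close>.\<close>

lemma pprt_mult:
  fixes x z :: "'u::universally_complete_f_algebra"
  assumes "0 \<le> z" shows "pprt (z * x) = z * pprt x"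
proof -
  have "inf (pprt x * z) (pprt (- x)) = 0" using pprt_disjoint assms by (rule f_algebra)
  then have "inf (pprt (- x)) (pprt x * z) = 0" by (simp add: inf_commute)
  then have "inf (pprt (- x) * z) (pprt x * z) = 0" using assms by (rule f_algebra)
  then have "inf (z * pprt x) (z * pprt (- x)) = 0" by (simp add: inf_commute mult.commute)
  then have "pprt (z * pprt x - z * pprt (- x)) = z * pprt x" by (rule pprt_diff_disjoint)
  then show ?thesis by (metis right_diff_distrib pprt_minus)
qed

lemma inf_mult_left:
  fixes x y z :: "'u::universally_complete_f_algebra"
  assumes "0 \<le> z" shows "z * inf x y = inf (z * x) (z * y)"
proof -
  have "z * (x - inf x y) = z * x - inf (z * x) (z * y)"
    using assms by (simp only: diff_inf_pprt flip: pprt_mult right_diff_distrib)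
  then show ?thesis by (simp add: algebra_simps)
qed

lemma sup_mult_left: fixes x y z :: "'u::universally_complete_f_algebra"
  assumes "0 \<le> z" shows "z * sup x y = sup (z * x) (z * y)"
proof -
  have "z * sup x y = z * (x + y) - z * inf x y"
    by (simp only: add_eq_inf_sup[of x y]) (simp add: algebra_simps)
  also have "\<dots> = sup (z * x) (z * y)"
    by (simp only: distrib_left add_eq_inf_sup[of "z * x" "z * y"] inf_mult_left[OF assms]) simp
  finally show ?thesis .
qed

lemma pprt_scaleR: "0 \<le> c \<Longrightarrow> pprt (c *\<^sub>R x) = c *\<^sub>R pprt x"
  for x :: "'u::universally_complete_f_algebra"
proof (cases "c = 0")
  case False
  assume "0 \<le> c"
  with False have "0 < c" by simp
  show ?thesis
  proof (rule order.antisym)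
    show "pprt (c *\<^sub>R x) \<le> c *\<^sub>R pprt x"
      using \<open>0 \<le> c\<close> unfolding pprt_def by (intro sup_least) (auto intro: scaleR_left_mono scaleR_nonneg_nonneg)
    have "pprt x = pprt ((1/c) *\<^sub>R c *\<^sub>R x)" using \<open>0 < c\<close> by simp
    also have "\<dots> \<le> (1/c) *\<^sub>R pprt (c *\<^sub>R x)"
      using \<open>0 < c\<close> unfolding pprt_def by (intro sup_least) (auto intro!: scaleR_left_mono scaleR_nonneg_nonneg simp del: scaleR_scaleR)
    finally have "c *\<^sub>R pprt x \<le> c *\<^sub>R (1/c) *\<^sub>R pprt (c *\<^sub>R x)"
      using \<open>0 < c\<close> by (intro scaleR_left_mono) auto
    then show "c *\<^sub>R pprt x \<le> pprt (c *\<^sub>R x)" using \<open>0 < c\<close> by simp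
  qed
qed simp

locale unital_f_algebra =
  fixes e :: "'u::universally_complete_f_algebra"
  assumes mult_unit: "e * x = x" and unit_nonneg: "0 \<le> e"
begin

lemma mult_unit_right: "x * e = x"
  using mult_unit[of x] by (simp add: mult.commute)

text \<open>If \<open>x * x = 0\<close>, the square of \<open>(2 * m) *\<^sub>R x - e\<close> is
  linear in \<open>x\<close>, namely \<open>e - (4 * m) *\<^sub>R x\<close>. Its positivity for all
  \<open>m\<close> makes \<open>x\<close> infinitely small.\<close>

lemma square_eq_0:
  fixes x :: 'u
  assumes "x * x = 0" shows "x = 0"
proof -
  have "x \<le> 0" if "x * x = 0" for x :: 'u
  proof -
    have "real (Suc n) *\<^sub>R x \<le> (1/4) *\<^sub>R e" for n
    proof -
    let ?m = "real (Suc n)"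
    have "0 \<le> ((2 * ?m) *\<^sub>R x - e) * ((2 * ?m) *\<^sub>R x - e)" by (rule square_nonneg)
    also have "\<dots> = e - (4 * ?m) *\<^sub>R x"
      using that by (simp add: algebra_simps mult_unit mult_unit_right flip: scaleR_add_left)
    finally have "(4 * ?m) *\<^sub>R x \<le> e" by simp
    then have "(1/4) *\<^sub>R (4 * ?m) *\<^sub>R x \<le> (1/4) *\<^sub>R e"
      by (rule scaleR_left_mono) simp
    then show ?thesis by (simp del: of_nat_Suc)
    qed
    then show ?thesis by (rule archimedean)
  qed
  from this[of x] this[of "-x"] assms show ?thesis by simp
qed

lemma disjoint_if_mult:
  fixes x y :: 'u
  assumes "x * y = 0" "0 \<le> x" "0 \<le> y" shows "inf x y = 0"
proof -
  have "inf x y * inf x y \<le> x * y" using assms by (intro mult_mono) (auto intro: le_infI1)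
  then have "inf x y * inf x y = 0" using assms square_nonneg[of "inf x y"] by simp
  then show ?thesis by (rule square_eq_0)
qed

text \<open>On the support of the n-th cutoff \<open>z\<close> is below \<open>n\<close>. If all
  cutoffs annihilate \<open>w\<close>, then \<open>w\<close> lives where \<open>z\<close> is
  infinite: every multiple of \<open>w\<close> is at most \<open>z * w\<close>, and the Archimedean
  property gives 0.\<close>

lemma unit_approx:
  assumes "0 \<le> w" "\<And>n. pprt (real (Suc n) *\<^sub>R e - z) * w = 0"
  shows "w = 0"
proof -
  have "real (Suc n) *\<^sub>R w \<le> z * w" for n
  proof -
    have "(real (Suc n) *\<^sub>R e - z) * w \<le> pprt (real (Suc n) *\<^sub>R e - z) * w"
      using assms(1) by (intro mult_right_mono) (auto simp: pprt_def)
    then show ?thesis by (simp only: assms(2)) (simp add: left_diff_distrib mult_unit)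
  qed
  from archimedean[OF this] assms(1) show ?thesis by simp
qed

lemma pprt_unit_mult_le: "pprt (c *\<^sub>R e - z) * z \<le> c *\<^sub>R pprt (c *\<^sub>R e - z)"
proof -
  have "0 \<le> (c *\<^sub>R e - z) * pprt (c *\<^sub>R e - z)"
    by (simp add: mult_pprt)
  then show ?thesis by (simp add: algebra_simps mult_unit mult_unit_right)
qed

text \<open>Order continuity of multiplication by an unbounded \<open>z\<close>. For
  \<open>w = z * s - u\<close> one has \<open>w \<le> z * (s - d)\<close>. After multiplication by a
  cutoff \<open>?c\<close>, the product \<open>?c * z\<close> is at most
  \<open>?m *\<^sub>R ?c\<close> and \<open>?c\<close> is at most \<open>?m *\<^sub>R e\<close>, so
  \<open>?c * w\<close> is at most a scalar multiple of \<open>s - d\<close>. Hence \<open>s\<close>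
  could be lowered unless \<open>?c * w \<le> 0\<close>.\<close>

lemma lub_mult:
  fixes s z :: 'u
  assumes "lub D s" "0 \<le> z"
  shows "lub ((*) z ` D) (z * s)"
proof (rule lubI)
  show "d \<le> z * s" if "d \<in> (*) z ` D" for d
    using that assms(2) lub_upper[OF assms(1)] mult_left_mono[of _ s z] by blast
  fix u assume u: "\<And>d. d \<in> (*) z ` D \<Longrightarrow> d \<le> u"
  define w where "w = z * s - u"
  have w: "w \<le> z * (s - d)" if "d \<in> D" for d
    using u that by (auto simp: w_def algebra_simps)
  have "pprt (real (Suc n) *\<^sub>R e - z) * pprt w = 0" for n
  proof -
    let ?m = "real (Suc n)"
    let ?c = "pprt (?m *\<^sub>R e - z)"
    have c: "?c \<le> ?m *\<^sub>R e"
      using assms(2) by (auto simp: pprt_def unit_nonneg scaleR_nonneg_nonneg intro: order_trans[of _ "_ - _"])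
    have mm: "0 < ?m * ?m" by (simp del: of_nat_Suc)
    have le: "(1 / (?m * ?m)) *\<^sub>R (?c * w) \<le> s - d" if "d \<in> D" for d
    proof -
      have sd: "0 \<le> s - d" using assms(1) that by (simp add: lub_upper)
      have "?c * w \<le> ?c * (z * (s - d))" using w[OF that] by (intro mult_left_mono) auto
      also have "\<dots> = (?c * z) * (s - d)" by (simp only: mult.assoc)
      also have "\<dots> \<le> (?m *\<^sub>R ?c) * (s - d)"
        using sd by (intro mult_right_mono pprt_unit_mult_le)
      also have "\<dots> \<le> (?m *\<^sub>R ?m *\<^sub>R e) * (s - d)"
        using sd c by (intro mult_right_mono scaleR_left_mono) auto
      finally have "?c * w \<le> (?m * ?m) *\<^sub>R (s - d)" by (simp add: mult_unit del: of_nat_Suc)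
      then have "(1 / (?m * ?m)) *\<^sub>R (?c * w) \<le> (1 / (?m * ?m)) *\<^sub>R (?m * ?m) *\<^sub>R (s - d)"
        using mm by (intro scaleR_left_mono) auto
      then show ?thesis using mm by (simp only: scaleR_scaleR) simp
    qed
    have "s \<le> s - (1 / (?m * ?m)) *\<^sub>R (?c * w)"
      using le by (intro lub_least[OF assms(1)]) (simp only: le_diff_eq add.commute)
    then have "(1 / (?m * ?m)) *\<^sub>R (?c * w) \<le> 0" by simp
    then have "(?m * ?m) *\<^sub>R (1 / (?m * ?m)) *\<^sub>R (?c * w) \<le> (?m * ?m) *\<^sub>R 0"
      using mm by (intro scaleR_left_mono) auto
    then have "?c * w \<le> 0" using mm by (simp only: scaleR_scaleR) simp
    then have "pprt (?c * w) = 0" by simp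
    then show ?thesis by (simp add: pprt_mult)
  qed
  then have "pprt w = 0" by (rule unit_approx[rotated]) simp
  then have "w \<le> 0" by (simp only: le_zero_iff_zero_pprt)
  then show "z * s \<le> u" by (simp add: w_def)
qed

text \<open>The component of the unit in the band generated by \<open>w\<close>.\<close>

definition component :: "'u \<Rightarrow> 'u" where
  "component w = Sup (range (\<lambda>n. inf (real n *\<^sub>R w) e))"

lemma lub_component: "lub (range (\<lambda>n. inf (real n *\<^sub>R w) e)) (component w)"
  unfolding component_def by (rule lub_Sup) (auto intro!: bdd_aboveI[of _ e])

lemma component_le: "component w \<le> e"
  by (rule lub_least[OF lub_component]) auto

lemma component_ge: "inf (real n *\<^sub>R w) e \<le> component w"
  by (rule lub_upper[OF lub_component]) auto

lemma component_nonneg: "0 \<le> component w"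
  using component_ge[of 0 w] unit_nonneg by (simp add: inf_absorb1)

lemma lub_mult_component: "0 \<le> z \<Longrightarrow> lub (range (\<lambda>n. inf (real n *\<^sub>R (z * w)) z)) (z * component w)"
  using lub_mult[OF lub_component, of z w] by (simp add: image_image inf_mult_left mult_unit_right)

lemma component_mult_disjoint:
  assumes "z * w = 0" "0 \<le> z" shows "z * component w = 0"
proof (rule order.antisym)
  show "z * component w \<le> 0"
    by (rule lub_least[OF lub_mult_component]) (use assms in auto)
qed (simp add: assms component_nonneg)

text \<open>Let \<open>t\<close> be the part of \<open>w\<close> that the component misses. Adding
  \<open>t\<close> to the n-th approximant stays below the next one, so the component minus
  \<open>t\<close> is still an upper bound, which forces \<open>t = 0\<close>.\<close>

lemma component_mult:
  assumes "0 \<le> w" shows "component w * w = w"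
proof -
  let ?p = "component w"
  define t where "t = inf (e - ?p) w"
  have "?p \<le> ?p - t"
  proof (rule lub_least[OF lub_component], clarify)
    fix n
    have "inf (real n *\<^sub>R w) e + t \<le> real n *\<^sub>R w + w"
      by (intro add_mono) (auto simp: t_def)
    moreover have "inf (real n *\<^sub>R w) e + t \<le> ?p + (e - ?p)"
      by (intro add_mono component_ge) (auto simp: t_def)
    ultimately have "inf (real n *\<^sub>R w) e + t \<le> inf (real (Suc n) *\<^sub>R w) e"
      by (simp add: algebra_simps)
    also have "\<dots> \<le> ?p" by (rule component_ge)
    finally show "inf (real n *\<^sub>R w) e \<le> ?p - t" by (simp add: algebra_simps)
  qed
  moreover have "0 \<le> t" using component_le assms by (simp add: t_def)
  ultimately have "t = 0" by simp
  then have "(e - ?p) * w = 0" unfolding t_def by (rule mult_disjoint)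
  then show ?thesis by (simp add: algebra_simps mult_unit)
qed

lemma component_idem:
  assumes "0 \<le> w" shows "component w * component w = component w"
proof -
  have "(e - component w) * component w = 0"
    using component_mult[OF assms] component_le
    by (intro component_mult_disjoint) (auto simp: algebra_simps mult_unit)
  then show ?thesis by (simp add: algebra_simps mult_unit)
qed

text \<open>The component acts as the indicator of the region where \<open>x\<close> is positive: it
  fixes \<open>pprt x\<close> and annihilates \<open>pprt (- x)\<close>.\<close>

lemma component_mult_pprt:
  "component (pprt x) * x = pprt x"
proof -
  have "pprt (- x) * component (pprt x) = 0"
    by (rule component_mult_disjoint) (simp_all add: pprt_mult_neg mult.commute)
  then have "component (pprt x) * (pprt x - pprt (- x)) = pprt x"
    by (simp add: right_diff_distrib component_mult mult.commute[of "component (pprt x)" "pprt (- x)"])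
  then show ?thesis by (simp add: pprt_minus)
qed

end

section \<open>The natural domain and the extended conditional expectation\<close>

abbreviation directed :: "'a::order set \<Rightarrow> bool" where
  "directed D \<equiv> directed_by (\<le>) D"

lemma directed_image:
  assumes "directed D" "\<And>x y. x \<in> D \<Longrightarrow> y \<in> D \<Longrightarrow> x \<le> y \<Longrightarrow> f x \<le> f y"
  shows "directed (f ` D)"
  using assms unfolding directed_by_def by simp meson

lemma directed_range: "mono f \<Longrightarrow> directed (range f)" for f :: "nat \<Rightarrow> 'a::order"
  unfolding directed_by_def by (auto intro: exI[of _ "max _ _"] monoD max.cobounded1 max.cobounded2)

context riesz_conditional_expectation
begin

sublocale unital_f_algebra e
  using mult_unit unit by unfold_locales (auto simp: weak_order_unit_def)

section \<open>E as an order ideal of its universal completion, and order continuity of T along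
  increasing nets\<close>

lemma E_subspace: "subspace E"
  using E_riesz by (simp add: riesz_subspace_def)

lemmas E_add = subspace_add[OF E_subspace]
  and E_diff = subspace_diff[OF E_subspace]
  and E_scale = subspace_scale[OF E_subspace]
  and E_zero = subspace_0[OF E_subspace]

lemma E_inf: "x \<in> E \<Longrightarrow> y \<in> E \<Longrightarrow> inf x y \<in> E"
  and E_sup: "x \<in> E \<Longrightarrow> y \<in> E \<Longrightarrow> sup x y \<in> E"
  using E_riesz by (auto simp: riesz_subspace_def)

lemma unit_in_E: "e \<in> E"
  using unit by (simp add: weak_order_unit_def)

text \<open>The largest set that can approximate \<open>f\<close> from the positive cone of E. Every
  approximating net is compared with it, which makes the extension of T independent of the
  net.\<close>

definition below :: "'u \<Rightarrow> 'u set" where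
  "below f = {x \<in> E. 0 \<le> x \<and> x \<le> f}"

text \<open>If an upper bound \<open>u\<close> failed to dominate \<open>f\<close>, density would
  put some \<open>z > 0\<close> of E into the gap \<open>f - inf u f\<close>. By induction all
  multiples of \<open>z\<close> stay below \<open>f\<close>: a multiple below \<open>f\<close> is
  below \<open>inf u f\<close>, and there is room for one more \<open>z\<close>.\<close>

lemma lub_below:
  assumes "0 \<le> f" shows "lub (below f) f"
proof (rule lubI)
  fix u assume u: "\<And>d. d \<in> below f \<Longrightarrow> d \<le> u"
  show "f \<le> u"
  proof (rule ccontr)
    assume "\<not> f \<le> u"
    then have "inf u f \<noteq> f" by (metis inf_le1)
    then have "inf u f < f" by (metis inf_le2 order.strict_iff_order)
    then have "0 < f - inf u f" by simp
    then obtain z where z: "z \<in> E" "0 < z" "z \<le> f - inf u f"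
      using E_dense unfolding order_dense_def by blast
    have le: "real n *\<^sub>R z \<le> f" for n
    proof (induction n)
      case (Suc n)
      then have "real n *\<^sub>R z \<in> below f"
        using z by (auto simp: below_def intro: E_scale scaleR_nonneg_nonneg)
      with u Suc have "real n *\<^sub>R z \<le> inf u f" by simp
      with z(3) have "real n *\<^sub>R z + z \<le> inf u f + (f - inf u f)" by (intro add_mono)
      then show ?case by (simp add: algebra_simps)
    qed (simp add: assms)
    have "z \<le> 0" by (rule archimedean) (rule le)
    with z(2) show False by simp
  qed
qed (simp add: below_def)

text \<open>A Dedekind complete, order dense Riesz subspace is an ideal. The supremum of
  \<open>below u\<close> taken inside E must be \<open>u\<close> itself, since otherwise density
  places an element of E in the difference and the supremum could be lowered within E.\<close>

lemma E_solid_nonneg: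
  assumes "x \<in> E" "0 \<le> u" "u \<le> x" shows "u \<in> E"
proof -
  have "below u \<subseteq> E" "0 \<in> below u" by (auto simp: below_def assms E_zero)
  moreover have "\<forall>y\<in>below u. y \<le> x" using assms by (auto simp: below_def)
  ultimately obtain s where s: "is_lub_on (\<le>) E (below u) s"
    using E_complete assms(1) unfolding dedekind_complete_on_def by (metis empty_iff)
  have "u \<le> s" by (rule lub_least[OF lub_below[OF assms(2)]]) (use s in \<open>auto simp: is_lub_on_def\<close>)
  have "s = u"
  proof (rule ccontr)
    assume "s \<noteq> u"
    with \<open>u \<le> s\<close> have "u < s" by (metis order.strict_iff_order)
    then have "0 < s - u" by simp
    then obtain z where z: "z \<in> E" "0 < z" "z \<le> s - u"
      using E_dense unfolding order_dense_def by blast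
    have "s - z \<in> E" using s z by (auto simp: is_lub_on_def intro: E_diff)
    moreover have "\<forall>y\<in>below u. y \<le> s - z"
    proof
      fix y assume "y \<in> below u"
      then have "y \<le> u" by (simp add: below_def)
      also have "u \<le> s - z" using z by (simp add: algebra_simps)
      finally show "y \<le> s - z" .
    qed
    ultimately have "s \<le> s - z" using s by (auto simp: is_lub_on_def)
    with z show False by simp
  qed
  with s show ?thesis by (simp add: is_lub_on_def)
qed

lemma E_solid: assumes "x \<in> E" "\<bar>u\<bar> \<le> x" shows "u \<in> E"
proof -
  have "pprt u \<le> \<bar>u\<bar>" "pprt (- u) \<le> \<bar>u\<bar>" by (rule pprt_le_abs)+
  then have "pprt u \<in> E" "pprt (- u) \<in> E"
    using assms E_solid_nonneg[of x "pprt u"] E_solid_nonneg[of x "pprt (- u)"] order_trans[of _ "\<bar>u\<bar>" x]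
    by simp_all
  from E_diff[OF this] show ?thesis by (simp add: pprt_minus)
qed

lemma T_diff: "x \<in> E \<Longrightarrow> y \<in> E \<Longrightarrow> T (x - y) = T x - T y"
  using T_add[of "x - y" y] by (simp add: E_diff)

lemma T_mono: "x \<in> E \<Longrightarrow> y \<in> E \<Longrightarrow> x \<le> y \<Longrightarrow> T x \<le> T y"
  using T_pos[of "y - x"] by (simp add: E_diff T_diff)

lemma T_zero: "T 0 = 0"
  using T_diff[of 0 0] by (simp add: E_zero)

text \<open>Order continuity is applied to the net \<open>s - d\<close> decreasing to 0. The bound
  \<open>u\<close> may lie outside E, so \<open>T s - u\<close> cannot serve as a lower bound in E;
  its positive part can, because solidity puts it into E.\<close>

lemma T_lub:
  assumes "D \<subseteq> E" "directed D" "lub D s" "s \<in> E"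
  shows "lub (T ` D) (T s)"
proof (rule lubI)
  show "d \<le> T s" if "d \<in> T ` D" for d
    using that assms by (auto intro!: T_mono intro: lub_upper)
  fix u assume u: "\<And>d. d \<in> T ` D \<Longrightarrow> d \<le> u"
  let ?D = "(\<lambda>d. s - d) ` D"
  obtain d0 where d0: "d0 \<in> D" using assms(2) by (auto simp: directed_by_def)
  have "directed_by (\<lambda>x y. y \<le> x) ?D"
    using assms(2) unfolding directed_by_def by simp
  moreover have "is_glb_on (\<le>) E ?D 0"
    unfolding is_glb_on_def
  proof (intro conjI ballI impI)
    show "0 \<le> x" if "x \<in> ?D" for x using that assms(3) by (auto intro: lub_upper)
    fix v assume "v \<in> E" "\<forall>x\<in>?D. v \<le> x"
    then have "s \<le> s - v" by (intro lub_least[OF assms(3)]) (auto simp: algebra_simps)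
    then show "v \<le> 0" by simp
  qed (rule E_zero)
  ultimately have glb: "is_glb_on (\<le>) E (T ` ?D) 0"
    using assms by (intro T_order_continuous) (auto intro: E_diff)
  have Ts: "T (s - d) = T s - T d" "0 \<le> T s - T d" if "d \<in> D" for d
    using that assms by (auto simp: T_diff subsetD[OF assms(1)] intro!: T_mono intro: lub_upper)
  have w: "pprt (T s - u) \<le> T s - T d" if "d \<in> D" for d
    using u that Ts(2)[OF that] by (auto simp: pprt_def)
  moreover have "pprt (T s - u) \<in> E"
    using d0 assms by (intro E_solid_nonneg[OF _ _ w[OF d0]]) (auto intro: E_diff T_maps)
  ultimately have "pprt (T s - u) \<le> 0"
    using glb Ts(1) by (auto simp: is_glb_on_def)
  then have "pprt (T s - u) = 0" by (simp add: order.antisym)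
  then have "T s - u \<le> 0" by (simp only: le_zero_iff_zero_pprt)
  then show "T s \<le> u" by simp
qed

text \<open>The members of \<open>D\<close> may lie outside E, but \<open>inf x d\<close> lies in E
  by solidity and increases to \<open>x\<close>, so order continuity applies to these truncations.
  Both the independence of the approximating net and monotone convergence use this.\<close>

lemma T_le_directed:
  assumes "directed D" "\<And>d. d \<in> D \<Longrightarrow> 0 \<le> d" "lub D s" "x \<in> below s"
    and "\<And>d. d \<in> D \<Longrightarrow> T (inf x d) \<le> u"
  shows "T x \<le> u"
proof -
  have x: "x \<in> E" "0 \<le> x" "x \<le> s" using assms(4) by (auto simp: below_def)
  have "inf x ` D \<subseteq> E"
    using assms(2) x E_solid_nonneg[OF x(1)] by auto
  moreover have "directed (inf x ` D)"
    using assms(1) by (rule directed_image) (auto intro: le_infI2)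
  moreover have "lub (inf x ` D) x"
    using lub_inf[OF assms(3), of x] x by (simp add: inf_absorb1)
  ultimately have "lub (T ` inf x ` D) (T x)" using x by (intro T_lub)
  then show ?thesis by (rule lub_least) (auto intro: assms(5))
qed

lemma directed_below: "0 \<le> f \<Longrightarrow> directed (below f)"
  unfolding directed_by_def
proof (intro conjI ballI)
  show "\<exists>z\<in>below f. x \<le> z \<and> y \<le> z" if "x \<in> below f" "y \<in> below f" for x y
    using that by (intro bexI[of _ "sup x y"]) (auto simp: below_def E_sup intro: le_supI1)
qed (auto simp: below_def E_zero)

lemma below_mono: "f \<le> g \<Longrightarrow> below f \<subseteq> below g"
  by (auto simp: below_def)

section \<open>The positive cone of the natural domain\<close>

abbreviation "L1p \<equiv> L1_cone E T"
abbreviation "cexp \<equiv> cone_ext E T"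

lemma approximates_below:
  "0 \<le> f \<Longrightarrow> bdd_above (T ` below f) \<Longrightarrow> approximates E T (below f) f"
  using directed_below lub_below by (auto simp: approximates_def below_def)

text \<open>This makes \<open>cone_ext\<close> well defined: by \<open>T_le_directed\<close> the
  images of an approximating net already dominate T on all of \<open>below f\<close>, so every net
  yields the same supremum.\<close>

lemma approximates_imp:
  assumes "approximates E T D f"
  shows "0 \<le> f" "bdd_above (T ` below f)" "Sup (T ` D) = Sup (T ` below f)"
proof -
  have D: "D \<subseteq> E" "\<And>x. x \<in> D \<Longrightarrow> 0 \<le> x" "directed D" "lub D f" "bdd_above (T ` D)"
    using assms by (auto simp: approximates_def)
  then obtain d where d: "d \<in> D" by (auto simp: directed_by_def)
  then show f: "0 \<le> f" using D by (meson lub_upper order_trans)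
  have S: "lub (T ` D) (Sup (T ` D))" using d D by (intro lub_Sup) auto
  have le: "T x \<le> Sup (T ` D)" if "x \<in> below f" for x
  proof (rule T_le_directed[OF D(3,2,4) that])
    fix d assume d: "d \<in> D"
    have "T (inf x d) \<le> T d"
      using d D that by (intro T_mono E_inf) (auto simp: below_def)
    also have "\<dots> \<le> Sup (T ` D)" using S d by (auto intro: lub_upper)
    finally show "T (inf x d) \<le> Sup (T ` D)" .
  qed
  then show "bdd_above (T ` below f)" by (auto intro!: bdd_aboveI[of _ "Sup (T ` D)"])
  have "D \<subseteq> below f" using D by (auto simp: below_def intro: lub_upper)
  have "lub (T ` below f) (Sup (T ` D))"
  proof (rule lubI)
    show "t \<le> Sup (T ` D)" if "t \<in> T ` below f" for t using that le by auto
    show "Sup (T ` D) \<le> u" if "\<And>t. t \<in> T ` below f \<Longrightarrow> t \<le> u" for u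
      by (rule lub_least[OF S]) (use that \<open>D \<subseteq> below f\<close> in blast)
  qed
  moreover have "T ` below f \<noteq> {}" using d \<open>D \<subseteq> below f\<close> by auto
  ultimately show "Sup (T ` D) = Sup (T ` below f)" by (simp add: lub_Sup_eq)
qed

lemma cone_iff: "f \<in> L1p \<longleftrightarrow> 0 \<le> f \<and> bdd_above (T ` below f)"
proof
  show "0 \<le> f \<and> bdd_above (T ` below f)" if "f \<in> L1p"
    using that approximates_imp(1,2)[of _ f] by (auto simp: L1_cone_def)
  show "f \<in> L1p" if "0 \<le> f \<and> bdd_above (T ` below f)"
    unfolding L1_cone_def using that approximates_below[of f] by blast
qed

lemma cexp_lub: assumes "f \<in> L1p" shows "lub (T ` below f) (cexp f)"
proof -
  have f: "0 \<le> f" "bdd_above (T ` below f)" using assms by (auto simp: cone_iff)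
  have "cexp f = Sup (T ` below f)"
    unfolding cone_ext_def
  proof (rule the_equality)
    show "\<exists>D. approximates E T D f \<and> Sup (T ` below f) = Sup (T ` D)"
      using approximates_below[OF f] by blast
    show "t = Sup (T ` below f)" if "\<exists>D. approximates E T D f \<and> t = Sup (T ` D)" for t
      using that approximates_imp(3) by force
  qed
  then show ?thesis using f directed_below[OF f(1)] by (simp add: lub_Sup directed_by_def)
qed

lemma cone_solid: assumes "f \<in> L1p" "0 \<le> g" "g \<le> f" shows "g \<in> L1p" "cexp g \<le> cexp f"
proof -
  have "T ` below g \<subseteq> T ` below f" using below_mono[OF assms(3)] by auto
  then show g: "g \<in> L1p" using assms by (auto simp: cone_iff intro: bdd_above_mono)
  show "cexp g \<le> cexp f"
    using \<open>T ` below g \<subseteq> T ` below f\<close>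
    by (intro lub_least[OF cexp_lub[OF g]]) (blast intro: lub_upper[OF cexp_lub[OF assms(1)]])
qed

lemma cone_E: assumes "x \<in> E" "0 \<le> x" shows "x \<in> L1p" "cexp x = T x"
proof -
  have "lub (T ` below x) (T x)"
    using assms by (intro lubI) (auto simp: below_def intro: T_mono)
  then show "x \<in> L1p" using assms by (auto simp: cone_iff intro: lub_bdd)
  from lub_unique[OF cexp_lub[OF this]] \<open>lub (T ` below x) (T x)\<close> show "cexp x = T x" .
qed

text \<open>Riesz decomposition splits an element of E below \<open>f + g\<close> into one below
  \<open>f\<close> and one below \<open>g\<close>; conversely such elements add up, and the two
  suprema are taken one after the other.\<close>

lemma cone_add: assumes "f \<in> L1p" "g \<in> L1p"
  shows "f + g \<in> L1p" "cexp (f + g) = cexp f + cexp g"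
proof -
  have f: "0 \<le> f" and g: "0 \<le> g" using assms by (auto simp: cone_iff)
  have "lub (T ` below (f + g)) (cexp f + cexp g)"
  proof (rule lubI)
    fix t assume "t \<in> T ` below (f + g)"
    then obtain x where x: "t = T x" "x \<in> E" "0 \<le> x" "x \<le> f + g" by (auto simp: below_def)
    note split = riesz_split[OF f g x(3,4)]
    have in_E: "inf f x \<in> E" "x - inf f x \<in> E"
      using x f E_solid_nonneg[OF x(2), of "inf f x"] by (auto intro: E_diff)
    then have "T x = T (inf f x) + T (x - inf f x)" by (simp add: T_diff x)
    also have "\<dots> \<le> cexp f + cexp g"
      using split in_E by (intro add_mono lub_upper[OF cexp_lub] assms imageI) (auto simp: below_def)
    finally show "t \<le> cexp f + cexp g" by (simp add: x)
  next
    fix u assume u: "\<And>t. t \<in> T ` below (f + g) \<Longrightarrow> t \<le> u"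
    have le: "T x + T y \<le> u" if "x \<in> below f" "y \<in> below g" for x y
    proof -
      have "x + y \<in> below (f + g)" using that by (auto simp: below_def E_add intro: add_mono)
      then have "T (x + y) \<le> u" using u by blast
      then show ?thesis using that by (simp add: T_add below_def)
    qed
    have "cexp f \<le> u - T y" if "y \<in> below g" for y
      using le that by (intro lub_least[OF cexp_lub] assms) (auto simp: algebra_simps)
    then have "cexp g \<le> u - cexp f"
      by (intro lub_least[OF cexp_lub] assms) (auto simp: algebra_simps)
    then show "cexp f + cexp g \<le> u" by (simp add: algebra_simps)
  qed
  then show "f + g \<in> L1p" using f g by (auto simp: cone_iff intro: lub_bdd)
  from lub_unique[OF cexp_lub[OF this]] \<open>lub (T ` below (f + g)) (cexp f + cexp g)\<close>
  show "cexp (f + g) = cexp f + cexp g" .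
qed

lemma cone_scale: assumes "f \<in> L1p" "0 \<le> c"
  shows "c *\<^sub>R f \<in> L1p" "cexp (c *\<^sub>R f) = c *\<^sub>R cexp f"
proof -
  have f: "0 \<le> f" using assms by (auto simp: cone_iff)
  have "lub (T ` below (c *\<^sub>R f)) (c *\<^sub>R cexp f)"
  proof (cases "c = 0")
    case True
    have "below 0 = {0}" by (auto simp: below_def E_zero)
    then show ?thesis by (simp add: True T_zero lub_singleton)
  next
    case False
    with assms have c: "0 < c" by simp
    show ?thesis
    proof (rule lubI)
      fix t assume "t \<in> T ` below (c *\<^sub>R f)"
      then obtain x where x: "t = T x" "x \<in> E" "0 \<le> x" "x \<le> c *\<^sub>R f" by (auto simp: below_def)
      have "(1/c) *\<^sub>R x \<le> (1/c) *\<^sub>R c *\<^sub>R f" using x c by (intro scaleR_left_mono) auto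
      then have "(1/c) *\<^sub>R x \<in> below f"
        using x c by (auto simp: below_def E_scale scaleR_nonneg_nonneg)
      then have "T ((1/c) *\<^sub>R x) \<le> cexp f" by (intro lub_upper[OF cexp_lub] assms imageI)
      then have "c *\<^sub>R T ((1/c) *\<^sub>R x) \<le> c *\<^sub>R cexp f" using c by (intro scaleR_left_mono) auto
      then show "t \<le> c *\<^sub>R cexp f" using c x by (simp add: T_scale)
    next
      fix u assume u: "\<And>t. t \<in> T ` below (c *\<^sub>R f) \<Longrightarrow> t \<le> u"
      have "cexp f \<le> (1/c) *\<^sub>R u"
      proof (rule lub_least[OF cexp_lub[OF assms(1)]])
        fix t assume "t \<in> T ` below f"
        then obtain x where x: "t = T x" "x \<in> E" "0 \<le> x" "x \<le> f" by (auto simp: below_def)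
        then have "c *\<^sub>R x \<in> below (c *\<^sub>R f)"
          using c by (auto simp: below_def E_scale intro: scaleR_nonneg_nonneg scaleR_left_mono)
        then have "T (c *\<^sub>R x) \<le> u" using u by blast
        then have "(1/c) *\<^sub>R T (c *\<^sub>R x) \<le> (1/c) *\<^sub>R u" using c by (intro scaleR_left_mono) auto
        then show "t \<le> (1/c) *\<^sub>R u" using c x by (simp add: T_scale)
      qed
      then have "c *\<^sub>R cexp f \<le> c *\<^sub>R (1/c) *\<^sub>R u" using c by (intro scaleR_left_mono) auto
      then show "c *\<^sub>R cexp f \<le> u" using c by simp
    qed
  qed
  then show "c *\<^sub>R f \<in> L1p" using f assms by (auto simp: cone_iff scaleR_nonneg_nonneg intro: lub_bdd)
  from lub_unique[OF cexp_lub[OF this]] \<open>lub (T ` below (c *\<^sub>R f)) (c *\<^sub>R cexp f)\<close>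
  show "cexp (c *\<^sub>R f) = c *\<^sub>R cexp f" .
qed

section \<open>The extension to the natural domain: linearity, strict positivity and monotone
  convergence\<close>

abbreviation "L \<equiv> L1 E T"
abbreviation "\<tau> \<equiv> cond_ext E T"

lemma exp_diff_cone: assumes "f \<in> L1p" "g \<in> L1p" shows "\<tau> (f - g) = cexp f - cexp g"
proof -
  have "cexp f - cexp g = cexp f' - cexp g'" if "f' \<in> L1p" "g' \<in> L1p" "f - g = f' - g'" for f' g'
  proof -
    have "f + g' = f' + g" using that by (simp add: algebra_simps)
    then have "cexp f + cexp g' = cexp f' + cexp g" by (metis assms that(1,2) cone_add(2))
    then show ?thesis by (simp add: algebra_simps)
  qed
  note eq = this
  show ?thesis
    unfolding cond_ext_def
  proof (rule the_equality)
    show "\<exists>f'\<in>L1p. \<exists>g'\<in>L1p. f - g = f' - g' \<and> cexp f - cexp g = cexp f' - cexp g'"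
      using assms by blast
    show "t = cexp f - cexp g" if "\<exists>f'\<in>L1p. \<exists>g'\<in>L1p. f - g = f' - g' \<and> t = cexp f' - cexp g'" for t
      using that eq by force
  qed
qed

lemma cone_zero: "0 \<in> L1p" "cexp 0 = 0"
  using cone_E[of 0] by (simp_all add: E_zero T_zero)

lemma L_iff: "h \<in> L \<longleftrightarrow> (\<exists>f\<in> L1p. \<exists>g\<in> L1p. h = f - g)"
  by (auto simp: L1_def)

lemma L_nonneg_iff: "0 \<le> h \<Longrightarrow> h \<in> L \<longleftrightarrow> h \<in> L1p"
proof
  assume "0 \<le> h" "h \<in> L"
  then obtain f g where "f \<in> L1p" "g \<in> L1p" "h = f - g" by (auto simp: L_iff)
  then show "h \<in> L1p"
    using cone_solid(1)[of f h] \<open>0 \<le> h\<close> by (simp add: cone_iff)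
next
  assume "h \<in> L1p"
  then show "h \<in> L" using cone_zero by (metis L_iff diff_zero)
qed

lemma exp_cone: "h \<in> L1p \<Longrightarrow> \<tau> h = cexp h"
  using exp_diff_cone[of h 0] cone_zero by simp

lemma L_add: assumes "x \<in> L" "y \<in> L" shows "x + y \<in> L" "\<tau> (x + y) = \<tau> x + \<tau> y"
proof -
  obtain f g f' g' where *: "f \<in> L1p" "g \<in> L1p" "x = f - g" "f' \<in> L1p" "g' \<in> L1p" "y = f' - g'"
    using assms by (auto simp: L_iff)
  have xy: "x + y = (f + f') - (g + g')" by (simp add: * algebra_simps)
  then show "x + y \<in> L" using * cone_add(1) unfolding L_iff by blast
  show "\<tau> (x + y) = \<tau> x + \<tau> y"
    unfolding xy using * by (simp add: exp_diff_cone cone_add)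
qed

lemma L_minus: assumes "x \<in> L" shows "- x \<in> L" "\<tau> (- x) = - \<tau> x"
proof -
  obtain f g where *: "f \<in> L1p" "g \<in> L1p" "x = f - g"
    using assms by (auto simp: L_iff)
  then have "- x = g - f" by simp
  then show "- x \<in> L" using * by (auto simp: L_iff)
  show "\<tau> (- x) = - \<tau> x"
    using * \<open>- x = g - f\<close> by (simp add: exp_diff_cone)
qed

lemma L_diff: assumes "x \<in> L" "y \<in> L" shows "x - y \<in> L" "\<tau> (x - y) = \<tau> x - \<tau> y"
  using L_add[OF assms(1) L_minus(1)[OF assms(2)]] L_minus(2)[OF assms(2)] by simp_all

lemma L_scale: assumes "x \<in> L" shows "c *\<^sub>R x \<in> L" "\<tau> (c *\<^sub>R x) = c *\<^sub>R \<tau> x"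
proof -
  have *: "c *\<^sub>R x \<in> L \<and> \<tau> (c *\<^sub>R x) = c *\<^sub>R \<tau> x" if "0 \<le> c" for c
  proof -
    obtain f g where *: "f \<in> L1p" "g \<in> L1p" "x = f - g"
      using assms by (auto simp: L_iff)
    have x: "c *\<^sub>R x = c *\<^sub>R f - c *\<^sub>R g" by (simp add: * algebra_simps)
    then have "c *\<^sub>R x \<in> L" using * cone_scale that by (auto simp: L_iff)
    moreover have "\<tau> (c *\<^sub>R x) = c *\<^sub>R \<tau> x"
      unfolding x using * that by (simp add: exp_diff_cone cone_scale scaleR_right_diff_distrib)
    ultimately show ?thesis by simp
  qed
  have "c *\<^sub>R x \<in> L \<and> \<tau> (c *\<^sub>R x) = c *\<^sub>R \<tau> x"
  proof (cases "0 \<le> c")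
    case False
    then have "(- c) *\<^sub>R x \<in> L \<and> \<tau> ((- c) *\<^sub>R x) = (- c) *\<^sub>R \<tau> x" by (intro *) simp
    then show ?thesis using L_minus[of "(- c) *\<^sub>R x"] by simp
  qed (rule *)
  then show "c *\<^sub>R x \<in> L" "\<tau> (c *\<^sub>R x) = c *\<^sub>R \<tau> x" by auto
qed

lemma exp_nonneg: "x \<in> L \<Longrightarrow> 0 \<le> x \<Longrightarrow> 0 \<le> \<tau> x"
  using cone_solid(2)[of x 0] cone_zero by (simp add: exp_cone L_nonneg_iff)

lemma exp_mono: "x \<in> L \<Longrightarrow> y \<in> L \<Longrightarrow> x \<le> y \<Longrightarrow> \<tau> x \<le> \<tau> y"
  using exp_nonneg[of "y - x"] by (simp add: L_diff)

lemma L_zero: "0 \<in> L" "\<tau> 0 = 0"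
  using cone_zero by (simp_all add: exp_cone L_nonneg_iff)

lemma L_solid: assumes "y \<in> L" "\<bar>x\<bar> \<le> y" shows "x \<in> L"
proof -
  have "0 \<le> y" using assms(2) by (meson abs_ge_zero order_trans)
  have "pprt x \<le> \<bar>x\<bar>" "pprt (- x) \<le> \<bar>x\<bar>" by (rule pprt_le_abs)+
  then have "pprt x \<in> L" "pprt (- x) \<in> L"
    using assms \<open>0 \<le> y\<close> cone_solid(1)[of y "pprt x"] cone_solid(1)[of y "pprt (- x)"]
      order_trans[of _ "\<bar>x\<bar>" y] by (simp_all add: L_nonneg_iff)
  from L_diff(1)[OF this] show ?thesis by (simp add: pprt_minus)
qed

lemma L_abs: assumes "x \<in> L" shows "\<bar>x\<bar> \<in> L"
proof -
  obtain f g where *: "f \<in> L1p" "g \<in> L1p" "x = f - g"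
    using assms by (auto simp: L_iff)
  then have "f \<in> L" "g \<in> L" "0 \<le> f" "0 \<le> g" by (auto simp: L_nonneg_iff cone_iff)
  then show ?thesis
    using * abs_triangle_ineq4[of f g] L_solid[OF L_add(1), of f g "\<bar>x\<bar>"] by simp
qed

lemma L_solid_abs: "y \<in> L \<Longrightarrow> \<bar>x\<bar> \<le> \<bar>y\<bar> \<Longrightarrow> x \<in> L"
  using L_abs L_solid by blast

lemma L_pprt: "x \<in> L \<Longrightarrow> pprt x \<in> L"
  by (rule L_solid_abs[of x]) (simp_all only: abs_of_nonneg[OF zero_le_pprt] pprt_le_abs)

lemma exp_strict: assumes "x \<in> L" "0 \<le> x" "\<tau> x = 0" shows "x = 0"
proof -
  have x: "x \<in> L1p" "cexp x = 0" using assms by (auto simp: L_nonneg_iff exp_cone)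
  have *: "y = 0" if "y \<in> below x" for y
  proof -
    have "T y \<le> 0" using lub_upper[OF cexp_lub[OF x(1)]] that x(2) by auto
    moreover have y: "y \<in> E" "0 \<le> y" using that by (auto simp: below_def)
    ultimately show ?thesis using T_pos[OF y] T_strict[OF y] by simp
  qed
  have "x \<le> 0"
    by (rule lub_least[OF lub_below[OF assms(2)]]) (use * in auto)
  with assms show ?thesis by simp
qed

lemma E_subset_L: assumes "x \<in> E" shows "x \<in> L" "\<tau> x = T x"
proof -
  have "\<bar>x\<bar> \<in> E" using assms E_sup[of x "- x"] E_scale[of x "-1"] by (simp add: abs_lattice)
  then have p: "pprt x \<in> E" "pprt (- x) \<in> E"
    using E_solid_nonneg[of "\<bar>x\<bar>" "pprt x"] E_solid_nonneg[of "\<bar>x\<bar>" "pprt (- x)"]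
    by (simp_all add: pprt_le_abs)
  show "x \<in> L"
    using L_diff(1)[of "pprt x" "pprt (- x)"] p by (simp add: pprt_minus L_nonneg_iff cone_E)
  have "\<tau> (pprt x - pprt (- x)) = T (pprt x - pprt (- x))"
    using p by (simp add: exp_diff_cone cone_E T_diff)
  then show "\<tau> x = T x" by (simp add: pprt_minus)
qed

lemma monotone_convergence:
  assumes "directed D" "D \<subseteq> L" "\<And>d. d \<in> D \<Longrightarrow> 0 \<le> d" "lub D s" "bdd_above (\<tau> ` D)"
  shows "s \<in> L" "lub (\<tau> ` D) (\<tau> s)"
proof -
  obtain d where d: "d \<in> D" using assms(1) by (auto simp: directed_by_def)
  then have s: "0 \<le> s" using assms by (meson lub_upper order_trans)
  have le: "T x \<le> u" if "x \<in> below s" "\<And>d. d \<in> D \<Longrightarrow> \<tau> d \<le> u" for x u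
  proof (rule T_le_directed[OF assms(1,3,4) that(1)])
    fix d assume d: "d \<in> D"
    have i: "inf x d \<in> E"
      using that(1) assms(3)[OF d] E_solid_nonneg[of x "inf x d"] by (auto simp: below_def)
    then have "T (inf x d) = \<tau> (inf x d)" by (simp add: E_subset_L)
    also have "\<dots> \<le> \<tau> d" using d assms(2) E_subset_L(1)[OF i] by (intro exp_mono) auto
    also have "\<dots> \<le> u" by (rule that(2)[OF d])
    finally show "T (inf x d) \<le> u" .
  qed
  obtain b where "\<And>d. d \<in> D \<Longrightarrow> \<tau> d \<le> b" using assms(5) by (auto simp: bdd_above_def)
  with le have "bdd_above (T ` below s)" by (auto intro!: bdd_aboveI[of _ b])
  with s have "s \<in> L1p" by (simp add: cone_iff)
  then show "s \<in> L" using s by (simp add: L_nonneg_iff)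
  show "lub (\<tau> ` D) (\<tau> s)"
  proof (rule lubI)
    show "t \<le> \<tau> s" if "t \<in> \<tau> ` D" for t
      using that assms(2,4) \<open>s \<in> L\<close> by (auto intro!: exp_mono intro: lub_upper)
    show "\<tau> s \<le> u" if "\<And>t. t \<in> \<tau> ` D \<Longrightarrow> t \<le> u" for u
      unfolding exp_cone[OF \<open>s \<in> L1p\<close>]
      by (rule lub_least[OF cexp_lub[OF \<open>s \<in> L1p\<close>]]) (use le that in blast)
  qed
qed

end

text \<open>From here on \<open>real (Suc n)\<close> stays an opaque positive scalar, convenient to
  divide by.\<close>

declare of_nat_Suc [simp del]

section \<open>Averaging and the range of the conditional expectation\<close>

context unital_f_algebra
begin

text \<open>With \<open>p = pprt (r - s)\<close> one has \<open>(r - s) * p = p * p\<close> and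
  \<open>p \<le> r + s\<close>, so the cube of \<open>p\<close> is at most
  \<open>p * (r * r - s * s)\<close>, hence at most 0. Absence of nilpotents gives
  \<open>p = 0\<close>.\<close>

lemma square_le_imp_le:
  fixes r s :: 'u
  assumes "0 \<le> r" "0 \<le> s" "r * r \<le> s * s" shows "r \<le> s"
proof -
  define p where "p = pprt (r - s)"
  have p: "0 \<le> p" "p \<le> r + s"
    using assms by (auto simp: p_def pprt_def algebra_simps intro: add_nonneg_nonneg)
  have "p * p * p \<le> p * p * (r + s)"
    using p by (intro mult_left_mono) auto
  also have "\<dots> = ((r - s) * p) * (r + s)"
    by (simp add: p_def mult_pprt)
  also have "\<dots> = p * (r * r - s * s)"
    by (simp add: algebra_simps)
  also have "\<dots> \<le> 0"
    using assms p by (simp add: mult_nonneg_nonpos)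
  finally have "p * p * p = 0"
    using p by (intro order.antisym) auto
  then have "(p * p) * (p * p) = 0"
    by (simp add: mult.assoc)
  then have "p = 0" using square_eq_0 by blast
  then have "r - s \<le> 0" unfolding p_def le_zero_iff_zero_pprt .
  then show ?thesis by simp
qed

text \<open>A Chebyshev estimate: the part \<open>p\<close> of \<open>x\<close> above
  \<open>real (Suc n) *\<^sub>R e\<close> satisfies
  \<open>real (Suc n) *\<^sub>R p = x * p - p * p\<close>, which is at most \<open>x * x\<close>.
  What truncation cuts off is thus infinitely small in the limit.\<close>

lemma lub_trunc:
  assumes "0 \<le> x" shows "lub (range (\<lambda>n. inf x (real n *\<^sub>R e))) x"
proof (rule lubI)
  fix u assume u: "\<And>d. d \<in> range (\<lambda>n. inf x (real n *\<^sub>R e)) \<Longrightarrow> d \<le> u"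
  have "real (Suc n) *\<^sub>R (x - u) \<le> x * x" for n
  proof -
    define p where "p = pprt (x - real (Suc n) *\<^sub>R e)"
    have p: "0 \<le> p" "p \<le> x"
      using assms by (auto simp: p_def pprt_def unit_nonneg scaleR_nonneg_nonneg intro: order_trans[of _ "_ - _"])
    have "x - u \<le> p"
      using u[OF rangeI, of "Suc n"] by (simp only: p_def flip: diff_inf_pprt) simp
    then have "real (Suc n) *\<^sub>R (x - u) \<le> real (Suc n) *\<^sub>R p"
      by (intro scaleR_left_mono) auto
    also have "\<dots> = x * p - p * p"
      using mult_pprt[of "x - real (Suc n) *\<^sub>R e"]
      by (simp add: left_diff_distrib mult_unit algebra_simps flip: p_def)
    also have "\<dots> \<le> x * x"
      using p assms by (simp add: add_increasing2 mult_left_mono diff_le_eq)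
    finally show ?thesis .
  qed
  then have "x - u \<le> 0" by (rule archimedean)
  then show "x \<le> u" by simp
qed auto

lemma directed_trunc: "directed (range (\<lambda>n. inf x (real n *\<^sub>R e)))"
proof (rule directed_range, rule monoI)
  fix m n :: nat assume "m \<le> n"
  then show "inf x (real m *\<^sub>R e) \<le> inf x (real n *\<^sub>R e)"
    by (intro inf_mono scaleR_right_mono unit_nonneg) auto
qed

text \<open>A substitute for choosing the grid value nearest to \<open>a\<close> at each point: an
  element below the distances to all grid values is at most the mesh, except where \<open>a\<close>
  exceeds the last value. In the induction step \<open>v - r - \<epsilon> *\<^sub>R e\<close> lies
  below both \<open>pprt t\<close> and \<open>pprt (- t)\<close>, whose infimum is 0.\<close>

lemma grid_bound:
  assumes "0 \<le> a" "0 \<le> \<epsilon>" "\<And>i. i \<le> n \<Longrightarrow> v \<le> \<bar>a - (real i * \<epsilon>) *\<^sub>R e\<bar>"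
  shows "v \<le> \<epsilon> *\<^sub>R e + pprt (a - (real n * \<epsilon>) *\<^sub>R e)"
  using assms(3)
proof (induction n)
  case 0
  have "v \<le> a" using 0[of 0] assms(1) by simp
  also have "\<dots> \<le> \<epsilon> *\<^sub>R e + a" using assms(2) by (simp add: scaleR_nonneg_nonneg unit_nonneg)
  finally show ?case using assms(1) by simp
next
  case (Suc n)
  define t where "t = a - (real n * \<epsilon>) *\<^sub>R e"
  have t: "a - (real (Suc n) * \<epsilon>) *\<^sub>R e = t - \<epsilon> *\<^sub>R e"
    by (simp add: t_def of_nat_Suc distrib_right scaleR_add_left)
  define r where "r = pprt (t - \<epsilon> *\<^sub>R e)"
  have \<epsilon>: "0 \<le> \<epsilon> *\<^sub>R e" using assms(2) by (simp add: scaleR_nonneg_nonneg unit_nonneg)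
  have 1: "v \<le> \<epsilon> *\<^sub>R e + pprt t" using Suc by (simp add: t_def)
  have "v \<le> \<bar>t - \<epsilon> *\<^sub>R e\<bar>" using Suc.prems[of "Suc n"] by (simp only: t order_refl)
  also have "\<dots> = r + pprt (\<epsilon> *\<^sub>R e - t)" by (simp add: abs_pprt r_def)
  also have "pprt (\<epsilon> *\<^sub>R e - t) \<le> \<epsilon> *\<^sub>R e + pprt (- t)"
    unfolding pprt_def[of "\<epsilon> *\<^sub>R e - t"]
  proof (rule sup_least)
    show "\<epsilon> *\<^sub>R e - t \<le> \<epsilon> *\<^sub>R e + pprt (- t)"
      unfolding diff_conv_add_uminus by (intro add_left_mono) (simp only: pprt_def sup_ge1)
    show "0 \<le> \<epsilon> *\<^sub>R e + pprt (- t)" by (intro add_nonneg_nonneg \<epsilon> zero_le_pprt)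
  qed
  finally have 2: "v - r - \<epsilon> *\<^sub>R e \<le> pprt (- t)" by (simp add: algebra_simps)
  have "0 \<le> r" by (simp add: r_def)
  then have "v - r - \<epsilon> *\<^sub>R e \<le> pprt t" using 1 add_mono[OF 1 \<open>0 \<le> r\<close>] by (simp add: algebra_simps)
  with 2 have "v - r - \<epsilon> *\<^sub>R e \<le> inf (pprt t) (pprt (- t))" by simp
  then have "v \<le> \<epsilon> *\<^sub>R e + r" by (simp add: pprt_disjoint algebra_simps)
  then show ?case by (simp only: t r_def)
qed

text \<open>This plays the role of substituting the value of \<open>a\<close> for the scalar
  \<open>\<kappa>\<close>. The grid has mesh \<open>c / real (Suc n)\<close> and ends at
  \<open>c\<close>; since \<open>a \<le> c *\<^sub>R e\<close>, the overflow term of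
  \<open>grid_bound\<close> vanishes.\<close>

lemma nonpos_if_le_distances:
  assumes "0 \<le> a" "a \<le> c *\<^sub>R e" "0 < c" "\<And>\<kappa>. 0 \<le> \<kappa> \<Longrightarrow> \<kappa> \<le> c \<Longrightarrow> v \<le> c *\<^sub>R \<bar>a - \<kappa> *\<^sub>R e\<bar>"
  shows "v \<le> 0"
proof (rule archimedean)
  fix n
  let ?\<epsilon> = "c / real (Suc n)"
  have "(1 / c) *\<^sub>R v \<le> ?\<epsilon> *\<^sub>R e + pprt (a - (real (Suc n) * ?\<epsilon>) *\<^sub>R e)"
  proof (rule grid_bound[OF assms(1)])
    fix i assume "i \<le> Suc n"
    then have "c * real i \<le> c * real (Suc n)" using assms(3) by (intro mult_left_mono) auto
    then have "real i * ?\<epsilon> \<le> c" by (simp add: field_simps)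
    then have "(1 / c) *\<^sub>R v \<le> (1 / c) *\<^sub>R c *\<^sub>R \<bar>a - (real i * ?\<epsilon>) *\<^sub>R e\<bar>"
      using assms(3) by (intro scaleR_left_mono assms(4)) auto
    then show "(1 / c) *\<^sub>R v \<le> \<bar>a - (real i * ?\<epsilon>) *\<^sub>R e\<bar>" using assms(3) by simp
  qed (use assms(3) in simp)
  also have "a - (real (Suc n) * ?\<epsilon>) *\<^sub>R e = a - c *\<^sub>R e" by simp
  also have "pprt (a - c *\<^sub>R e) = 0" using assms(2) by simp
  finally have "(c * real (Suc n)) *\<^sub>R (1 / c) *\<^sub>R v \<le> (c * real (Suc n)) *\<^sub>R (?\<epsilon> *\<^sub>R e + 0)"
    using assms(3) by (intro scaleR_left_mono) auto
  then show "real (Suc n) *\<^sub>R v \<le> (c * c) *\<^sub>R e"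
    using assms(3) by (simp del: of_nat_Suc)
qed

text \<open>The ideal generated by the unit. It is closed under products and contained in E, so
  identities for products are proved here first and reach the natural domain by truncation.\<close>

definition ubdd :: "'u \<Rightarrow> bool" where
  "ubdd x \<longleftrightarrow> (\<exists>c. \<bar>x\<bar> \<le> c *\<^sub>R e)"

lemma ubdd_pos: assumes "ubdd x" obtains c where "0 < c" "\<bar>x\<bar> \<le> c *\<^sub>R e"
proof -
  obtain c where c: "\<bar>x\<bar> \<le> c *\<^sub>R e" using assms by (auto simp: ubdd_def)
  also have "c *\<^sub>R e \<le> (\<bar>c\<bar> + 1) *\<^sub>R e" by (intro scaleR_right_mono unit_nonneg) auto
  finally show ?thesis by (rule that[rotated]) simp
qed

lemma ubdd_add: assumes "ubdd x" "ubdd y" shows "ubdd (x + y)"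
proof -
  obtain c d where "\<bar>x\<bar> \<le> c *\<^sub>R e" "\<bar>y\<bar> \<le> d *\<^sub>R e" using assms by (auto simp: ubdd_def)
  then have "\<bar>x + y\<bar> \<le> (c + d) *\<^sub>R e"
    unfolding scaleR_add_left by (meson abs_triangle_ineq add_mono order_trans)
  then show ?thesis by (auto simp: ubdd_def)
qed

lemma abs_scaleR_le: "\<bar>k *\<^sub>R x\<bar> \<le> \<bar>k\<bar> *\<^sub>R \<bar>x\<bar>" for x :: 'u
proof (rule abs_leI)
  have *: "k *\<^sub>R x \<le> \<bar>k\<bar> *\<^sub>R \<bar>x\<bar>" for k
  proof (cases "0 \<le> k")
    case True
    then have "k *\<^sub>R x \<le> k *\<^sub>R \<bar>x\<bar>" by (intro scaleR_left_mono abs_ge_self) auto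
    with True show ?thesis by simp
  next
    case False
    then have "(- k) *\<^sub>R (- x) \<le> (- k) *\<^sub>R \<bar>x\<bar>" by (intro scaleR_left_mono) (auto simp: abs_ge_minus_self)
    with False show ?thesis by simp
  qed
  show "k *\<^sub>R x \<le> \<bar>k\<bar> *\<^sub>R \<bar>x\<bar>" by (rule *)
  show "- (k *\<^sub>R x) \<le> \<bar>k\<bar> *\<^sub>R \<bar>x\<bar>" using *[of "- k"] by simp
qed

lemma ubdd_scale: assumes "ubdd x" shows "ubdd (k *\<^sub>R x)"
proof -
  obtain c where c: "\<bar>x\<bar> \<le> c *\<^sub>R e" using assms by (auto simp: ubdd_def)
  have "\<bar>k *\<^sub>R x\<bar> \<le> \<bar>k\<bar> *\<^sub>R \<bar>x\<bar>" by (rule abs_scaleR_le)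
  also have "\<dots> \<le> \<bar>k\<bar> *\<^sub>R c *\<^sub>R e" using c by (intro scaleR_left_mono) auto
  finally have "\<bar>k *\<^sub>R x\<bar> \<le> (\<bar>k\<bar> * c) *\<^sub>R e" by simp
  then show ?thesis unfolding ubdd_def by blast
qed

lemma ubdd_mult: assumes "ubdd x" "ubdd y" shows "ubdd (x * y)"
proof -
  obtain c d where c: "0 < c" "\<bar>x\<bar> \<le> c *\<^sub>R e" and d: "0 < d" "\<bar>y\<bar> \<le> d *\<^sub>R e"
    using assms by (meson ubdd_pos)
  have "\<bar>x * y\<bar> \<le> \<bar>x\<bar> * \<bar>y\<bar>" by (rule abs_le_mult)
  also have "\<dots> \<le> (c *\<^sub>R e) * (d *\<^sub>R e)"
    using c d by (intro mult_mono) (auto simp: scaleR_nonneg_nonneg unit_nonneg)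
  finally have "\<bar>x * y\<bar> \<le> (c * d) *\<^sub>R e" by (simp add: mult_unit mult.commute)
  then show ?thesis unfolding ubdd_def by blast
qed

lemma ubdd_nonneg: assumes "0 \<le> x" "x \<le> c *\<^sub>R e" shows "ubdd x"
  using assms unfolding ubdd_def by auto

lemma ubdd_trunc: "0 \<le> x \<Longrightarrow> ubdd (inf x (real n *\<^sub>R e))"
  by (rule ubdd_nonneg[of _ "real n"]) (auto simp: unit_nonneg scaleR_nonneg_nonneg)

end

context riesz_conditional_expectation
begin

lemma ubdd_E: assumes "ubdd x" shows "x \<in> E"
  using assms E_solid E_scale[OF unit_in_E] unfolding ubdd_def by blast

text \<open>Positivity of T at the square of \<open>y - \<kappa> *\<^sub>R e\<close> bounds
  \<open>T y * T y - T (y * y)\<close> by the square of \<open>T y - \<kappa> *\<^sub>R e\<close>.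
  One would like to put \<open>\<kappa> = T y\<close>, but \<open>\<kappa>\<close> is a scalar; as
  one factor of that square is at most \<open>c *\<^sub>R e\<close>, the lemma on distances achieves
  the same.\<close>

lemma jensen_nonneg:
  assumes "0 \<le> y" "y \<le> c *\<^sub>R e" "0 < c"
  shows "T y * T y \<le> T (y * y)"
proof -
  have b: "ubdd y" using assms(1,2) by (rule ubdd_nonneg)
  note E = ubdd_E[OF b] ubdd_E[OF ubdd_mult[OF b b]]
  have Ty: "0 \<le> T y" "T y \<le> c *\<^sub>R e"
    using T_pos[OF E(1) assms(1)] T_mono[OF E(1) _ assms(2)] E_scale[OF unit_in_E]
    by (simp_all add: T_scale unit_in_E T_unit)
  have "T y * T y - T (y * y) \<le> 0"
  proof (rule nonpos_if_le_distances[OF Ty assms(3)])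
    fix \<kappa> :: real assume \<kappa>: "0 \<le> \<kappa>" "\<kappa> \<le> c"
    have "0 \<le> (y - \<kappa> *\<^sub>R e) * (y - \<kappa> *\<^sub>R e)" by (rule square_nonneg)
    also have "\<dots> = y * y - (2 * \<kappa>) *\<^sub>R y + (\<kappa> * \<kappa>) *\<^sub>R e"
      by (simp add: algebra_simps mult_unit mult_unit_right flip: scaleR_2)
    finally have "0 \<le> T (y * y - (2 * \<kappa>) *\<^sub>R y + (\<kappa> * \<kappa>) *\<^sub>R e)"
      using E by (intro T_pos E_add E_diff E_scale unit_in_E)
    also have "\<dots> = T (y * y) - (2 * \<kappa>) *\<^sub>R T y + (\<kappa> * \<kappa>) *\<^sub>R e"
      using E by (simp add: T_add T_diff T_scale T_unit E_diff E_scale unit_in_E)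
    finally have "T y * T y - T (y * y) \<le> T y * T y - (2 * \<kappa>) *\<^sub>R T y + (\<kappa> * \<kappa>) *\<^sub>R e"
      by (simp add: algebra_simps)
    also have "\<dots> = \<bar>T y - \<kappa> *\<^sub>R e\<bar> * \<bar>T y - \<kappa> *\<^sub>R e\<bar>"
      unfolding abs_mult_abs by (simp add: algebra_simps mult_unit mult_unit_right flip: scaleR_2)
    also have "\<dots> \<le> (c *\<^sub>R e) * \<bar>T y - \<kappa> *\<^sub>R e\<bar>"
    proof (intro mult_right_mono abs_leI)
      have "\<kappa> *\<^sub>R e \<le> c *\<^sub>R e" "0 \<le> \<kappa> *\<^sub>R e"
        using \<kappa> by (auto intro: scaleR_right_mono unit_nonneg scaleR_nonneg_nonneg)
      with Ty show "T y - \<kappa> *\<^sub>R e \<le> c *\<^sub>R e" "- (T y - \<kappa> *\<^sub>R e) \<le> c *\<^sub>R e"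
        by (auto simp: algebra_simps intro: add_increasing add_increasing2 order_trans)
    qed simp
    finally show "T y * T y - T (y * y) \<le> c *\<^sub>R \<bar>T y - \<kappa> *\<^sub>R e\<bar>"
      by (simp add: mult_unit)
  qed
  then show ?thesis by simp
qed

text \<open>Replacing \<open>y\<close> by \<open>y + c *\<^sub>R e\<close> adds the same terms to
  both sides, so \<open>y\<close> may be shifted into the positive cone.\<close>

lemma jensen:
  assumes "ubdd y" shows "T y * T y \<le> T (y * y)"
proof -
  obtain c where c: "0 < c" "\<bar>y\<bar> \<le> c *\<^sub>R e" using ubdd_pos[OF assms] .
  define z where "z = y + c *\<^sub>R e"
  have y: "- y \<le> c *\<^sub>R e" "y \<le> c *\<^sub>R e" using c by (auto simp: abs_le_iff)
  have z2: "y + c *\<^sub>R e \<le> c *\<^sub>R e + c *\<^sub>R e" using y(2) by (rule add_right_mono)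
  have "- y + y \<le> c *\<^sub>R e + y" using y(1) by (rule add_right_mono)
  then have z: "0 \<le> z" by (simp add: z_def add.commute)
  have "(2 * c) *\<^sub>R e = c *\<^sub>R e + c *\<^sub>R e" by (simp only: mult_2 scaleR_add_left)
  with z2 have z': "z \<le> (2 * c) *\<^sub>R e" by (simp only: z_def)
  note E = ubdd_E[OF assms] ubdd_E[OF ubdd_mult[OF assms assms]]
  have sq: "(x + c *\<^sub>R e) * (x + c *\<^sub>R e) = x * x + (2 * c) *\<^sub>R x + (c * c) *\<^sub>R e" for x
    by (simp add: algebra_simps mult_unit mult_unit_right flip: scaleR_2)
  have "T z * T z \<le> T (z * z)" using z z' c by (intro jensen_nonneg[of z "2 * c"]) auto
  moreover have "T z = T y + c *\<^sub>R e"
    using E by (simp add: z_def T_add T_scale T_unit E_scale unit_in_E)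
  moreover have "T (z * z) = T (y * y) + (2 * c) *\<^sub>R T y + (c * c) *\<^sub>R e"
    using E by (simp add: z_def sq T_add T_scale T_unit E_scale E_add unit_in_E)
  ultimately have "T y * T y + (2 * c) *\<^sub>R T y + (c * c) *\<^sub>R e
      \<le> T (y * y) + (2 * c) *\<^sub>R T y + (c * c) *\<^sub>R e"
    by (simp only: sq)
  then show ?thesis by simp
qed

text \<open>Jensen makes \<open>T (b * b) - b * b\<close> positive, and idempotence makes T vanish
  on it; strict positivity finishes.\<close>

lemma T_fixed_square:
  assumes "ubdd b" "T b = b" shows "T (b * b) = b * b"
proof -
  have E: "b * b \<in> E" using assms by (intro ubdd_E ubdd_mult)
  have "0 \<le> T (b * b) - b * b" using jensen[OF assms(1)] by (simp add: assms(2))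
  moreover have "T (T (b * b) - b * b) = 0" using E by (simp add: T_diff T_maps T_proj)
  ultimately have "T (b * b) - b * b = 0" using T_strict[OF E_diff[OF T_maps[OF E] E]] by simp
  then show ?thesis by simp
qed

text \<open>Jensen's inequality for \<open>b + s x\<close> is an equality to order zero in \<open>s\<close>, so its first-order
  term vanishes.\<close>

lemma averaging_ubdd:
  assumes "ubdd b" "T b = b" "ubdd x" shows "T (b * x) = b * T x"
proof -
  note E = ubdd_E[OF assms(1)] ubdd_E[OF assms(3)] ubdd_E[OF ubdd_mult[OF assms(1) assms(3)]]
    ubdd_E[OF ubdd_mult[OF assms(1) assms(1)]] ubdd_E[OF ubdd_mult[OF assms(3) assms(3)]]
  define d where "d = b * T x - T (b * x)"
  define K where "K = T (x * x) - T x * T x"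
  have ineq: "(2 * s) *\<^sub>R d \<le> (s * s) *\<^sub>R K" for s
  proof -
    have "T (b + s *\<^sub>R x) * T (b + s *\<^sub>R x) \<le> T ((b + s *\<^sub>R x) * (b + s *\<^sub>R x))"
      using assms by (intro jensen ubdd_add ubdd_scale)
    moreover have "(b + s *\<^sub>R x) * (b + s *\<^sub>R x) = b * b + (2 * s) *\<^sub>R (b * x) + (s * s) *\<^sub>R (x * x)"
      by (simp add: algebra_simps flip: scaleR_2)
    then have "T ((b + s *\<^sub>R x) * (b + s *\<^sub>R x)) = b * b + (2 * s) *\<^sub>R T (b * x) + (s * s) *\<^sub>R T (x * x)"
      using E T_fixed_square[OF assms(1,2)] by (simp add: T_add T_scale E_add E_scale)
    moreover have "T (b + s *\<^sub>R x) = b + s *\<^sub>R T x"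
      using E by (simp add: T_add T_scale E_scale assms(2))
    ultimately have "(b + s *\<^sub>R T x) * (b + s *\<^sub>R T x) \<le> b * b + (2 * s) *\<^sub>R T (b * x) + (s * s) *\<^sub>R T (x * x)"
      by simp
    moreover have "(b + s *\<^sub>R T x) * (b + s *\<^sub>R T x) = b * b + (2 * s) *\<^sub>R (b * T x) + (s * s) *\<^sub>R (T x * T x)"
      by (simp add: algebra_simps flip: scaleR_2)
    ultimately show ?thesis by (simp add: d_def K_def scaleR_right_diff_distrib diff_le_eq le_diff_eq add_diff_eq diff_add_eq add_ac)
  qed
  \<comment> \<open>With \<open>s = \<sigma> / ?m\<close>, multiplication by
    \<open>?m * ?m / 2\<close> leaves \<open>?m\<close> times \<open>\<sigma> *\<^sub>R d\<close> on
    the left but only half of \<open>K\<close> on the right. The signs 1 and -1 together give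
    \<open>d = 0\<close>.\<close>
  have le: "\<sigma> *\<^sub>R d \<le> 0" if "\<sigma> * \<sigma> = 1" for \<sigma>
  proof (rule archimedean)
    fix n
    let ?m = "real (Suc n)"
    have m: "0 < ?m" by simp
    have "(?m * ?m / 2) *\<^sub>R (2 * (\<sigma> / ?m)) *\<^sub>R d \<le> (?m * ?m / 2) *\<^sub>R ((\<sigma> / ?m) * (\<sigma> / ?m)) *\<^sub>R K"
      by (intro scaleR_left_mono ineq) simp
    moreover have "(?m * ?m / 2) * (2 * (\<sigma> / ?m)) = ?m * \<sigma>" using m by (simp add: field_simps del: of_nat_0_less_iff)
    moreover have "(?m * ?m / 2) * ((\<sigma> / ?m) * (\<sigma> / ?m)) = 1 / 2"
      using m that by (simp add: field_simps del: of_nat_Suc)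
    ultimately show "?m *\<^sub>R \<sigma> *\<^sub>R d \<le> (1 / 2) *\<^sub>R K" by (simp only: scaleR_scaleR)
  qed
  from le[of 1] le[of "-1"] have "d = 0" by simp
  then show ?thesis by (simp add: d_def)
qed

section \<open>The range A: fixed points, lattice operations, averaging, square roots\<close>

abbreviation "A \<equiv> cond_range E T"

lemma exp_idem: assumes "x \<in> L" shows "\<tau> x \<in> L" "\<tau> (\<tau> x) = \<tau> x"
proof -
  have *: "\<tau> x \<in> L \<and> \<tau> (\<tau> x) = \<tau> x" if "x \<in> L" "0 \<le> x" for x
  proof -
    let ?D = "T ` below x"
    have x: "x \<in> L1p" using that by (simp add: L_nonneg_iff)
    have lub: "lub ?D (\<tau> x)" using cexp_lub[OF x] by (simp add: exp_cone x)
    have TD: "\<tau> ` ?D = ?D"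
      using T_proj by (auto simp: below_def E_subset_L T_maps image_iff) 
    have dir: "directed ?D"
      by (rule directed_image[OF directed_below[OF that(2)]]) (auto simp: below_def intro: T_mono)
    have sub: "?D \<subseteq> L" by (auto simp: below_def intro: E_subset_L T_maps)
    have nn: "0 \<le> d" if "d \<in> ?D" for d
      using that by (auto simp: below_def intro: T_pos E_subset_L T_maps)
    have "\<tau> x \<in> L" "lub (\<tau> ` ?D) (\<tau> (\<tau> x))"
      using monotone_convergence[OF dir sub nn lub] TD lub_bdd[OF lub] by auto
    with lub show ?thesis unfolding TD by (auto intro: lub_unique)
  qed
  have p: "pprt x \<in> L" "pprt (- x) \<in> L" using L_pprt assms L_minus(1) by auto
  have eq: "\<tau> x = \<tau> (pprt x) - \<tau> (pprt (- x))" using L_diff(2)[OF p] by (simp add: pprt_minus)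
  show "\<tau> x \<in> L" "\<tau> (\<tau> x) = \<tau> x"
    unfolding eq using *[OF p(1)] *[OF p(2)] by (simp_all add: L_diff)
qed

lemma A_iff: "a \<in> A \<longleftrightarrow> a \<in> L \<and> \<tau> a = a"
  unfolding cond_range_def using exp_idem by (auto intro: rev_image_eqI)

lemma exp_in_A: "x \<in> L \<Longrightarrow> \<tau> x \<in> A"
  by (simp add: A_iff exp_idem)

lemma A_in_L: "a \<in> A \<Longrightarrow> a \<in> L" and A_fixed: "a \<in> A \<Longrightarrow> \<tau> a = a"
  by (simp_all add: A_iff)

lemma A_add: "a \<in> A \<Longrightarrow> b \<in> A \<Longrightarrow> a + b \<in> A"
  and A_diff: "a \<in> A \<Longrightarrow> b \<in> A \<Longrightarrow> a - b \<in> A"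
  and A_scale: "a \<in> A \<Longrightarrow> c *\<^sub>R a \<in> A"
  and A_zero: "0 \<in> A"
  by (simp_all add: A_iff L_add L_diff L_scale L_zero)

lemma unit_in_A: "e \<in> A"
  by (simp add: A_iff E_subset_L unit_in_E T_unit)

text \<open>Positivity gives \<open>\<bar>a\<bar> \<le> \<tau> \<bar>a\<bar>\<close>, and the
  difference has expectation 0, so strict positivity turns this into equality.\<close>

lemma A_abs: assumes "a \<in> A" shows "\<bar>a\<bar> \<in> A"
proof -
  have a: "a \<in> L" "\<tau> a = a" "\<bar>a\<bar> \<in> L" using assms L_abs by (auto simp: A_iff)
  have "a \<le> \<tau> \<bar>a\<bar>" using exp_mono[OF a(1,3) abs_ge_self] a(2) by simp
  moreover have "- a \<le> \<tau> \<bar>a\<bar>"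
    using exp_mono[OF L_minus(1)[OF a(1)] a(3)] a(2) by (simp add: L_minus a abs_ge_minus_self)
  ultimately have "0 \<le> \<tau> \<bar>a\<bar> - \<bar>a\<bar>" by (simp add: abs_le_iff)
  moreover have "\<tau> (\<tau> \<bar>a\<bar> - \<bar>a\<bar>) = 0" using a by (simp add: L_diff exp_idem)
  ultimately have "\<tau> \<bar>a\<bar> - \<bar>a\<bar> = 0" 
    using exp_strict[OF L_diff(1)[OF exp_idem(1)[OF a(3)] a(3)]] by simp
  then show ?thesis using a by (simp add: A_iff)
qed

lemma A_pprt: assumes "a \<in> A" shows "pprt a \<in> A"
proof -
  have "pprt a + pprt a = a + \<bar>a\<bar>"
    using pprt_minus[of a] abs_pprt[of a] by (simp add: algebra_simps)
  then have "(1/2) *\<^sub>R 2 *\<^sub>R pprt a = (1/2) *\<^sub>R (a + \<bar>a\<bar>)" by (simp only: scaleR_2)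
  then have "pprt a = (1/2) *\<^sub>R (a + \<bar>a\<bar>)" by simp
  then show ?thesis using assms by (simp add: A_add A_scale A_abs)
qed

lemma A_inf: "a \<in> A \<Longrightarrow> b \<in> A \<Longrightarrow> inf a b \<in> A"
proof -
  assume "a \<in> A" "b \<in> A"
  then have "a - pprt (a - b) \<in> A" by (intro A_diff A_pprt)
  then show ?thesis by (simp flip: diff_inf_pprt)
qed

lemma A_sup: "a \<in> A \<Longrightarrow> b \<in> A \<Longrightarrow> sup a b \<in> A"
  by (simp add: sup_eq_add_pprt A_add A_pprt A_diff)

lemma A_lub:
  assumes "directed D" "D \<subseteq> A" "\<And>d. d \<in> D \<Longrightarrow> 0 \<le> d" "lub D s"
  shows "s \<in> A"
proof -
  have D: "\<tau> ` D = D" using assms(2) by (force simp: A_iff)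
  have "D \<subseteq> L" using assms(2) by (auto simp: A_iff)
  moreover have "bdd_above (\<tau> ` D)" unfolding D using assms(4) by (rule lub_bdd)
  ultimately have "s \<in> L" "lub (\<tau> ` D) (\<tau> s)"
    using monotone_convergence[OF assms(1) _ assms(3,4)] by auto
  then show ?thesis using assms(4) unfolding D by (auto simp: A_iff intro: lub_unique)
qed

lemma ubdd_L: "ubdd x \<Longrightarrow> x \<in> L"
  by (simp add: ubdd_E E_subset_L)

lemma exp_trunc_lub:
  assumes "x \<in> L" "0 \<le> x"
  shows "lub (range (\<lambda>n. \<tau> (inf x (real n *\<^sub>R e)))) (\<tau> x)"
proof -
  let ?D = "range (\<lambda>n. inf x (real n *\<^sub>R e))"
  have D: "?D \<subseteq> L" using assms by (auto intro: ubdd_L ubdd_trunc)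
  have "\<tau> d \<le> \<tau> x" if "d \<in> ?D" for d using that D assms by (intro exp_mono) auto
  then have "bdd_above (\<tau> ` ?D)" by (intro bdd_aboveI[of _ "\<tau> x"]) blast
  then have "lub (\<tau> ` ?D) (\<tau> x)"
    using D assms by (intro monotone_convergence(2) directed_trunc lub_trunc)
      (auto simp: unit_nonneg scaleR_nonneg_nonneg)
  then show ?thesis by (simp add: image_image)
qed

text \<open>Removes the truncation of one factor: monotone convergence on the side of
  \<open>\<tau>\<close>, order continuity of multiplication on the other. It is used once for the
  argument and once for the multiplier.\<close>

lemma averaging_step:
  assumes "0 \<le> y" "0 \<le> z" "y \<in> L" "\<And>n. y * inf z (real n *\<^sub>R e) \<in> L"
    and "\<And>n. \<tau> (y * inf z (real n *\<^sub>R e)) = c * b n" "0 \<le> c" "lub (range b) b'"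
  shows "y * z \<in> L" "\<tau> (y * z) = c * b'"
proof -
  let ?f = "\<lambda>n. y * inf z (real n *\<^sub>R e)"
  have lub: "lub (range ?f) (y * z)"
    using lub_mult[OF lub_trunc[OF assms(2)] assms(1)] by (simp add: image_image)
  have cb: "lub (range (\<lambda>n. c * b n)) (c * b')"
    using lub_mult[OF assms(7,6)] by (simp add: image_image)
  have dir: "directed (range ?f)"
    using directed_image[OF directed_trunc[of z], of "(*) y"] assms(1)
    by (simp add: image_image mult_left_mono)
  have nn: "0 \<le> d" if "d \<in> range ?f" for d
    using that assms(1,2) by (auto intro!: mult_nonneg_nonneg simp: unit_nonneg scaleR_nonneg_nonneg)
  have \<tau>: "\<tau> ` range ?f = range (\<lambda>n. c * b n)" by (simp add: image_image assms(5))
  have "range ?f \<subseteq> L" using assms(4) by auto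
  note mc = monotone_convergence[OF dir this nn lub, unfolded \<tau>, OF _ lub_bdd[OF cb]]
  show "y * z \<in> L" using mc(1) by simp
  show "\<tau> (y * z) = c * b'" using mc(2) cb by (auto intro: lub_unique)
qed

text \<open>The restrictions of \<open>averaging_ubdd\<close> are lifted one at a time:
  \<open>x\<close> is truncated in fact 1 and \<open>a\<close> in fact 2; then \<open>x\<close>
  (fact 3) and finally \<open>a\<close> are split into positive and negative parts.\<close>

lemma averaging: assumes "a \<in> A" "x \<in> L" shows "a * x \<in> L" "\<tau> (a * x) = a * \<tau> x"
proof -
  have 1: "a * x \<in> L \<and> \<tau> (a * x) = a * \<tau> x"
    if "a \<in> A" "0 \<le> a" "ubdd a" "x \<in> L" "0 \<le> x" for a x
  proof -
    have a: "T a = a" using that E_subset_L[OF ubdd_E[OF that(3)]] by (simp add: A_iff)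
    have tr: "ubdd (inf x (real n *\<^sub>R e))" for n using that by (intro ubdd_trunc)
    have L: "a * inf x (real n *\<^sub>R e) \<in> L" for n using tr that by (intro ubdd_L ubdd_mult)
    moreover have "\<tau> (a * inf x (real n *\<^sub>R e)) = a * \<tau> (inf x (real n *\<^sub>R e))" for n
      using averaging_ubdd[OF that(3) a tr] that tr by (simp add: E_subset_L ubdd_E ubdd_mult)
    ultimately show ?thesis
      using averaging_step[OF that(2,5) _ _ _ that(2) exp_trunc_lub[OF that(4,5)]] that(1)
      by (simp add: A_in_L)
  qed
  have 2: "a * x \<in> L \<and> \<tau> (a * x) = a * \<tau> x"
    if "a \<in> A" "0 \<le> a" "x \<in> L" "0 \<le> x" for a x
  proof -
    have "inf a (real n *\<^sub>R e) \<in> A" for n using that by (intro A_inf A_scale unit_in_A)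
    then have tr: "inf a (real n *\<^sub>R e) * x \<in> L \<and>
        \<tau> (inf a (real n *\<^sub>R e) * x) = inf a (real n *\<^sub>R e) * \<tau> x" for n
      using that by (intro 1) (auto simp: ubdd_trunc unit_nonneg scaleR_nonneg_nonneg)
    show ?thesis
      using averaging_step[of x a "\<tau> x" "\<lambda>n. inf a (real n *\<^sub>R e)" a] tr that lub_trunc[OF that(2)] exp_nonneg[OF that(3,4)]
      by (simp add: mult.commute)
  qed
  have 3: "a * x \<in> L \<and> \<tau> (a * x) = a * \<tau> x" if "a \<in> A" "0 \<le> a" "x \<in> L" for a x
  proof -
    have p: "pprt x \<in> L" "pprt (- x) \<in> L" using L_pprt that L_minus(1) by auto
    have "a * (pprt x - pprt (- x)) \<in> L \<and> \<tau> (a * (pprt x - pprt (- x))) = a * \<tau> (pprt x - pprt (- x))"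
      using 2[OF that(1,2) p(1)] 2[OF that(1,2) p(2)] p by (simp add: right_diff_distrib L_diff)
    then show ?thesis by (simp add: pprt_minus)
  qed
  have p: "pprt a \<in> A" "pprt (- a) \<in> A" using assms A_pprt A_scale[of a "-1"] by auto
  have "(pprt a - pprt (- a)) * x \<in> L \<and> \<tau> ((pprt a - pprt (- a)) * x) = (pprt a - pprt (- a)) * \<tau> x"
    using 3[OF p(1) _ assms(2)] 3[OF p(2) _ assms(2)] by (simp add: left_diff_distrib L_diff)
  then show "a * x \<in> L" "\<tau> (a * x) = a * \<tau> x" by (simp_all add: pprt_minus)
qed

lemma A_mult: assumes "a \<in> A" "b \<in> A" shows "a * b \<in> A"
  using averaging[OF assms(1) A_in_L[OF assms(2)]] A_fixed[OF assms(2)] by (simp add: A_iff)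

lemma two_mult_le: "2 *\<^sub>R (x * y) \<le> x * x + y * y" for x y :: 'u
proof -
  have "0 \<le> (x - y) * (x - y)" by (rule square_nonneg)
  then show ?thesis by (simp add: algebra_simps scaleR_2)
qed

lemma mult_le_if_squares_le:
  fixes x y a :: 'u
  assumes "x * x \<le> a" "y * y \<le> a" shows "x * y \<le> a"
proof -
  have "2 *\<^sub>R (x * y) \<le> 2 *\<^sub>R a"
    using two_mult_le[of x y] add_mono[OF assms] by (simp add: scaleR_2)
  then have "(1/2) *\<^sub>R 2 *\<^sub>R (x * y) \<le> (1/2) *\<^sub>R 2 *\<^sub>R a" by (rule scaleR_left_mono) simp
  then show ?thesis by simp
qed

text \<open>The root is the supremum of all \<open>r \<ge> 0\<close> in A with
  \<open>r * r \<le> a\<close>, a directed set because \<open>x * y \<le> a\<close> follows from the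
  bounds on the two squares. If the defect \<open>w\<close> were nonzero, a small positive element
  of A could be added to the supremum on a region where it is bounded.\<close>

lemma A_sqrt:
  assumes "a \<in> A" "0 \<le> a" shows "\<exists>r\<in>A. 0 \<le> r \<and> r * r = a"
proof -
  define D where "D = {r \<in> A. 0 \<le> r \<and> r * r \<le> a}"
  have "0 \<in> D" using assms by (simp add: D_def A_zero)
  have bd: "r \<le> a + e" if "r \<in> D" for r
  proof -
    have "r \<le> 2 *\<^sub>R (r * e)" using that by (simp add: mult_unit_right scaleR_2 D_def)
    also have "\<dots> \<le> r * r + e * e" by (rule two_mult_le)
    also have "\<dots> \<le> a + e" using that by (simp add: mult_unit D_def)
    finally show ?thesis .
  qed
  define s where "s = Sup D"
  have lub: "lub D s"
    unfolding s_def using \<open>0 \<in> D\<close> bd by (intro lub_Sup bdd_aboveI) auto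
  have "directed D"
    unfolding directed_by_def
  proof (intro conjI ballI)
    fix x y assume xy: "x \<in> D" "y \<in> D"
    have "sup x y * sup x y \<le> a"
    proof -
      have "0 \<le> sup x y" using xy by (auto simp: D_def intro: le_supI1)
      then have "sup x y * sup x y = sup (x * sup x y) (y * sup x y)"
        by (simp add: sup_mult_left mult.commute)
      also have "\<dots> \<le> a"
        using xy by (auto simp: D_def sup_mult_left intro: mult_le_if_squares_le)
      finally show ?thesis .
    qed
    then show "\<exists>z\<in>D. x \<le> z \<and> y \<le> z"
      using xy by (intro bexI[of _ "sup x y"]) (auto simp: D_def A_sup intro: le_supI1)
  qed (use \<open>0 \<in> D\<close> in auto)
  then have "s \<in> A" by (rule A_lub[OF _ _ _ lub]) (auto simp: D_def)
  have s: "0 \<le> s" using lub \<open>0 \<in> D\<close> by (rule lub_upper)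
  have "d * s \<le> a" if "d \<in> D" for d
    by (rule lub_least[OF lub_mult[OF lub]])
      (use that in \<open>auto simp: D_def intro: mult_le_if_squares_le\<close>)
  then have "s * s \<le> a"
    by (intro lub_least[OF lub_mult[OF lub s]]) (auto simp: mult.commute)
  define w where "w = a - s * s"
  have w: "0 \<le> w" "w \<in> A"
    using \<open>s * s \<le> a\<close> assms \<open>s \<in> A\<close> by (auto simp: w_def A_diff A_mult)
  have "pprt (real (Suc n) *\<^sub>R e - s) * inf w e = 0" for n
  proof -
    let ?m = "real (Suc n)"
    define q where "q = pprt (?m *\<^sub>R e - s)"
    \<comment> \<open>On the support of \<open>q\<close> the root candidate \<open>s\<close> is at
      most \<open>?m\<close>, and \<open>\<delta> \<le> e\<close>; hence adding
      \<open>\<delta>\<close> raises the square by at most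
      \<open>(2 * ?m + 1) *\<^sub>R \<delta>\<close>. The factor is chosen so that this is at most
      \<open>w\<close>.\<close>
    define \<delta> where "\<delta> = (1 / (2 * ?m + 1)) *\<^sub>R inf w (inf e q)"
    have c: "0 < 2 * ?m + 1" "1 / (2 * ?m + 1) \<le> 1" by simp_all
    have i: "0 \<le> inf w (inf e q)" using w by (simp add: q_def unit_nonneg)
    then have \<delta>: "0 \<le> \<delta>" unfolding \<delta>_def using c by (intro scaleR_nonneg_nonneg) auto
    have \<delta>i: "\<delta> \<le> inf w (inf e q)"
      unfolding \<delta>_def using scaleR_right_mono[OF c(2) i] by simp
    then have \<delta>_le: "\<delta> \<le> e" "\<delta> \<le> q" by simp_all
    have "\<delta> \<in> A"
      unfolding \<delta>_def q_def using w \<open>s \<in> A\<close> by (intro A_scale A_inf A_pprt A_diff unit_in_A)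
    have "\<delta> * pprt (s - ?m *\<^sub>R e) \<le> q * pprt (s - ?m *\<^sub>R e)"
      using \<delta>_le by (intro mult_right_mono) auto
    also have "\<dots> = 0" using pprt_mult_neg[of "?m *\<^sub>R e - s"] by (simp add: q_def)
    finally have 0: "\<delta> * pprt (s - ?m *\<^sub>R e) \<le> 0" .
    have "s - ?m *\<^sub>R e \<le> pprt (s - ?m *\<^sub>R e)" by (simp add: pprt_def)
    then have "\<delta> * (s - ?m *\<^sub>R e) \<le> \<delta> * pprt (s - ?m *\<^sub>R e)" using \<delta> by (rule mult_left_mono)
    also note 0
    finally have s\<delta>: "\<delta> * s \<le> ?m *\<^sub>R \<delta>" by (simp add: right_diff_distrib mult_unit_right)
    have \<delta>\<delta>: "\<delta> * \<delta> \<le> \<delta>" using mult_right_mono[OF \<delta>_le(1) \<delta>] by (simp add: mult_unit)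
    have "(s + \<delta>) * (s + \<delta>) = s * s + 2 *\<^sub>R (\<delta> * s) + \<delta> * \<delta>"
      by (simp add: algebra_simps flip: scaleR_2)
    also have "\<dots> \<le> s * s + 2 *\<^sub>R ?m *\<^sub>R \<delta> + \<delta>"
      by (intro add_mono scaleR_left_mono s\<delta> \<delta>\<delta>) auto
    also have "\<dots> = s * s + (2 * ?m + 1) *\<^sub>R \<delta>"
      by (simp only: scaleR_add_left scaleR_scaleR scaleR_one add.assoc)
    also have "(2 * ?m + 1) *\<^sub>R \<delta> = inf w (inf e q)"
      unfolding \<delta>_def scaleR_scaleR using c by simp
    also have "\<dots> \<le> w" by simp
    finally have "(s + \<delta>) * (s + \<delta>) \<le> a" by (simp add: w_def)
    then have "s + \<delta> \<in> D" using \<delta> s \<open>\<delta> \<in> A\<close> \<open>s \<in> A\<close> by (simp add: D_def A_add)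
    then have "s + \<delta> \<le> s" by (rule lub_upper[OF lub])
    with \<delta> have "\<delta> = 0" by simp
    then have "inf w (inf e q) = 0" using c by (simp add: \<delta>_def)
    then have "inf q (inf w e) = 0" by (simp add: inf_aci)
    then show ?thesis unfolding q_def by (rule mult_disjoint)
  qed
  then have "inf w e = 0"
    using w unit_nonneg by (intro unit_approx[of "inf w e" s, OF le_infI])
  then have "w * e = 0" by (rule mult_disjoint)
  then have "s * s = a" by (simp add: mult_unit_right w_def)
  with s \<open>s \<in> A\<close> show ?thesis by blast
qed

end

section \<open>Suprema of families with bounded conditional expectations\<close>

context unital_f_algebra
begin

lemma component_mono: assumes "w \<le> w'" shows "component w \<le> component w'"
proof (rule lub_least[OF lub_component], clarify)
  fix n
  have "inf (real n *\<^sub>R w) e \<le> inf (real n *\<^sub>R w') e"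
    using assms by (intro inf_mono scaleR_left_mono) auto
  also have "\<dots> \<le> component w'" by (rule component_ge)
  finally show "inf (real n *\<^sub>R w) e \<le> component w'" .
qed

text \<open>The components \<open>p n\<close> of the unit on \<open>{u n < n}\<close> increase to \<open>e\<close>, and all \<open>u m\<close> with
  \<open>m \<ge> n\<close> coincide there; so the \<open>u n\<close> are dominated by gluing them along the disjoint
  differences of the \<open>p n\<close>.\<close>

lemma bdd_above_if_truncations:
  assumes nonneg: "\<And>n. 0 \<le> u n"
    and trunc: "\<And>m n. n \<le> m \<Longrightarrow> u n = inf (real n *\<^sub>R e) (u m)"
    and small: "\<And>w. (\<And>n. real (Suc n) *\<^sub>R w \<le> u (Suc n)) \<Longrightarrow> w \<le> 0"
  shows "bdd_above (range u)"
proof -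
  define p where "p n = component (real n *\<^sub>R e - u n)" for n
  \<comment> \<open>The gap does not depend on which later \<open>u m\<close> it is computed from,
    so \<open>p n\<close> is the component where all later \<open>u m\<close> stay below
    \<open>n\<close>.\<close>
  have gap: "real n *\<^sub>R e - u n = pprt (real n *\<^sub>R e - u m)" if "n \<le> m" for n m
    by (subst trunc[OF that]) (rule diff_inf_pprt)
  have gap0: "0 \<le> real n *\<^sub>R e - u n" for n by (subst gap[OF order_refl]) (rule zero_le_pprt)
  have p0: "0 \<le> p n" "p n \<le> e" "p n * p n = p n" for n
    using gap0 by (auto simp: p_def component_nonneg component_le component_idem)
  have pp: "p i * p j = p i" if "i \<le> j" for i j
  proof (rule order.antisym)
    have "real i *\<^sub>R e - u i = pprt (real i *\<^sub>R e - u j)" by (rule gap[OF that])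
    also have "\<dots> \<le> pprt (real j *\<^sub>R e - u j)"
      using that by (intro pprt_mono diff_right_mono scaleR_right_mono unit_nonneg) auto
    also have "\<dots> = real j *\<^sub>R e - u j" by (rule gap[OF order_refl, symmetric])
    finally have "p i \<le> p j" unfolding p_def by (rule component_mono)
    then have "p i * p i \<le> p i * p j" using p0 by (intro mult_left_mono)
    then show "p i \<le> p i * p j" by (simp only: p0)
    show "p i * p j \<le> p i" using mult_left_mono[OF p0(2)[of j] p0(1)[of i]] by (simp add: mult_unit_right)
  qed
  have pu: "p n * u m = p n * u n" if "n \<le> m" for n m
  proof -
    have "u m - u n = pprt (u m - real n *\<^sub>R e)"
      by (subst trunc[OF that]) (simp only: inf_commute[of "real n *\<^sub>R e"] diff_inf_pprt)
    then have "(u m - u n) * (real n *\<^sub>R e - u n) = 0"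
      using pprt_mult_neg[of "u m - real n *\<^sub>R e"] by (simp only: gap[OF that] minus_diff_eq)
    moreover have "0 \<le> u m - u n" by (subst trunc[OF that]) simp
    ultimately have "(u m - u n) * p n = 0" unfolding p_def by (rule component_mult_disjoint)
    then show ?thesis by (simp add: algebra_simps)
  qed
  \<comment> \<open>Off \<open>p ?m\<close> the element \<open>u ?m\<close> equals
    \<open>?m\<close>, so \<open>?m\<close> times \<open>e - p ?m\<close> is at most
    \<open>u ?m\<close>. An upper bound \<open>v\<close> of the \<open>p n\<close> then puts all
    multiples of \<open>e - v\<close> in the situation excluded by \<open>small\<close>.\<close>
  have lub_p: "lub (range p) e"
  proof (rule lubI)
    show "d \<le> e" if "d \<in> range p" for d using that p0 by auto
    fix v assume v: "\<And>d. d \<in> range p \<Longrightarrow> d \<le> v"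
    have "e - v \<le> 0"
    proof (rule small)
      fix n
      let ?m = "Suc n"
      have "p ?m * (real ?m *\<^sub>R e - u ?m) = real ?m *\<^sub>R e - u ?m"
        unfolding p_def using gap0 by (rule component_mult)
      then have "real ?m *\<^sub>R (e - p ?m) = (e - p ?m) * u ?m"
        by (simp add: algebra_simps mult_unit mult_unit_right)
      also have "\<dots> \<le> e * u ?m" using p0 nonneg by (intro mult_right_mono) auto
      finally have "real ?m *\<^sub>R (e - p ?m) \<le> u ?m" by (simp add: mult_unit)
      moreover have "real ?m *\<^sub>R (e - v) \<le> real ?m *\<^sub>R (e - p ?m)"
        using v by (intro scaleR_left_mono diff_left_mono) auto
      ultimately show "real ?m *\<^sub>R (e - v) \<le> u ?m" by (rule order_trans[rotated])
    qed
    then show "e \<le> v" by simp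
  qed
  \<comment> \<open>\<open>q n\<close> is what \<open>p n\<close> adds to its predecessor. Starting
    with \<open>p 0\<close> makes the partial sums telescope to \<open>p n\<close>.\<close>
  define q where "q n = (case n of 0 \<Rightarrow> p 0 | Suc k \<Rightarrow> p (Suc k) - p k)" for n
  have qp: "q n * p n = q n" for n
    using p0 pp[of "n - 1" n] by (cases n) (auto simp: q_def left_diff_distrib)
  have q0: "0 \<le> q n" for n
  proof (cases n)
    case (Suc k)
    have "p k * p n \<le> e * p n" using p0 by (intro mult_right_mono)
    then show ?thesis using pp[of k n] by (simp add: q_def Suc mult_unit)
  qed (simp add: q_def p0)
  have q_before: "q j * p i = 0" if "i < j" for i j
    using that pp[of i j] pp[of i "j - 1"] by (cases j) (auto simp: q_def mult.commute[of _ "p i"] right_diff_distrib)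
  have q_disj: "q i * q j = 0" if "i \<noteq> j" for i j
  proof -
    have *: "q i * q j = 0" if "i < j" for i j
    proof -
      have "q i * q j = (q i * p i) * q j" by (simp only: qp)
      also have "\<dots> = q i * (q j * p i)" by (simp add: mult_ac)
      finally show ?thesis using q_before[OF that] by simp
    qed
    show ?thesis using that *[of i j] *[of j i] by (cases "i < j") (auto simp: mult.commute)
  qed
  have qq: "q n * q n = q n" for n
  proof (cases n)
    case (Suc k)
    then have "q n * q n = q n * p n - q n * p k" by (simp add: q_def algebra_simps)
    then show ?thesis using q_before[of k n] Suc by (simp add: qp)
  qed (simp add: q_def p0)
  let ?V = "range (\<lambda>n. q n * u n)"
  \<comment> \<open>The sole use of lateral completeness. It bounds the disjoint pieces
    \<open>q n * u n\<close> by one \<open>v\<close>; on \<open>q n\<close> every later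
    \<open>u m\<close> agrees with \<open>u n\<close> and every earlier one is below it, so
    \<open>v\<close> bounds all of them there.\<close>
  have "bdd_above ?V"
  proof (rule laterally_complete)
    show "0 \<le> x" if "x \<in> ?V" for x using that q0 nonneg by auto
    fix x y assume "x \<in> ?V" "y \<in> ?V" "x \<noteq> y"
    then obtain i j where ij: "x = q i * u i" "y = q j * u j" "i \<noteq> j" by auto
    have "x * y = (q i * q j) * (u i * u j)" by (simp add: ij mult_ac)
    then show "inf x y = 0" using ij q0 nonneg by (intro disjoint_if_mult) (auto simp: q_disj)
  qed
  then obtain v where v: "\<And>n. q n * u n \<le> v" by (auto simp: bdd_above_def)
  have "0 \<le> v" using v[of 0] q0 nonneg by (meson mult_nonneg_nonneg order_trans)
  have qu: "q n * u m \<le> q n * v" for n m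
  proof -
    have "q n * u m \<le> q n * u n"
    proof (cases "n \<le> m")
      case True
      have "q n * u m = (q n * p n) * u m" by (simp only: qp)
      also have "\<dots> = q n * (p n * u n)" by (simp only: mult.assoc pu[OF True])
      also have "\<dots> = q n * u n" by (simp only: qp flip: mult.assoc)
      finally show ?thesis by simp
    next
      case False
      then have "u m \<le> u n" by (subst trunc[of m n]) auto
      then show ?thesis using q0 by (intro mult_left_mono)
    qed
    also have "\<dots> = q n * (q n * u n)" by (simp only: qq flip: mult.assoc)
    also have "\<dots> \<le> q n * v" using q0 v by (intro mult_left_mono)
    finally show ?thesis .
  qed
  have pu': "p n * u m \<le> p n * v" for n m
  proof (induction n)
    case 0 show ?case using qu[of 0 m] by (simp add: q_def)
  next
    case (Suc n)
    have "p (Suc n) = p n + q (Suc n)" by (simp add: q_def)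
    then show ?case using add_mono[OF Suc qu[of "Suc n" m]] by (simp add: distrib_right)
  qed
  have "u m \<le> v" for m
  proof -
    have "u m * e \<le> v"
    proof (rule lub_least[OF lub_mult[OF lub_p nonneg]])
      fix d assume "d \<in> (*) (u m) ` range p"
      then obtain n where "d = p n * u m" by (auto simp: mult.commute)
      also have "p n * u m \<le> p n * v" by (rule pu')
      also have "\<dots> \<le> e * v" using p0 \<open>0 \<le> v\<close> by (intro mult_right_mono)
      finally show "d \<le> v" by (simp add: mult_unit)
    qed
    then show ?thesis by (simp add: mult_unit_right)
  qed
  then show ?thesis by (intro bdd_aboveI[of _ v]) auto
qed

end

context riesz_conditional_expectation
begin

text \<open>Cut at level \<open>n\<close>, the set has a supremum \<open>u n\<close> with
  expectation at most \<open>b\<close>. If all multiples of \<open>w\<close> stay below the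
  corresponding \<open>u n\<close>, the multiples of \<open>\<tau> (pprt w)\<close> stay below
  \<open>b\<close>, so \<open>pprt w = 0\<close> by strict positivity. This is the hypothesis needed
  for gluing the \<open>u n\<close>.\<close>

lemma bdd_above_if_exp_bdd:
  assumes dir: "directed D" and D: "D \<subseteq> L" and nn: "\<And>d. d \<in> D \<Longrightarrow> 0 \<le> d"
    and bdd: "\<And>d. d \<in> D \<Longrightarrow> \<tau> d \<le> b"
  shows "bdd_above D"
proof -
  obtain d0 where "d0 \<in> D" using dir by (auto simp: directed_by_def)
  define C where "C n = inf (real n *\<^sub>R e) ` D" for n :: nat
  define u where "u n = Sup (C n)" for n
  have ne: "0 \<le> real n *\<^sub>R e" for n by (simp add: unit_nonneg scaleR_nonneg_nonneg)
  have lub: "lub (C n) (u n)" for n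
    unfolding u_def using \<open>d0 \<in> D\<close>
    by (intro lub_Sup bdd_aboveI[of _ "real n *\<^sub>R e"]) (auto simp: C_def)
  have u0: "0 \<le> u n" for n
    using nn[OF \<open>d0 \<in> D\<close>] \<open>d0 \<in> D\<close> ne by (intro order_trans[OF _ lub_upper[OF lub, of "inf (real n *\<^sub>R e) d0"]]) (auto simp: C_def)
  have trunc: "u n = inf (real n *\<^sub>R e) (u m)" if "n \<le> m" for n m
  proof -
    have "real n *\<^sub>R e \<le> real m *\<^sub>R e" using that by (intro scaleR_right_mono unit_nonneg) auto
    then have "inf (real n *\<^sub>R e) (inf (real m *\<^sub>R e) d) = inf (real n *\<^sub>R e) d" for d
      by (metis inf.assoc inf.absorb1)
    then have "inf (real n *\<^sub>R e) ` C m = C n" by (simp add: C_def image_image)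
    then show ?thesis using lub_inf[OF lub[of m], of "real n *\<^sub>R e"] lub[of n] by (auto intro: lub_unique)
  qed
  have CL: "C n \<subseteq> L" for n
    using nn ne by (auto simp: C_def inf_commute intro!: ubdd_L ubdd_trunc)
  have \<tau>u: "u n \<in> L \<and> \<tau> (u n) \<le> b" for n
  proof -
    have "\<tau> c \<le> b" if c: "c \<in> C n" for c
    proof -
      obtain d where d: "d \<in> D" "c = inf (real n *\<^sub>R e) d" using c unfolding C_def by blast
      then have "\<tau> c \<le> \<tau> d" using c CL D by (intro exp_mono) auto
      also have "\<dots> \<le> b" by (rule bdd[OF d(1)])
      finally show ?thesis .
    qed
    note le = this
    then have "bdd_above (\<tau> ` C n)" by (intro bdd_aboveI[of _ b]) auto
    moreover have "directed (C n)"
      unfolding C_def by (rule directed_image[OF dir]) (auto intro: le_infI2)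
    moreover have "0 \<le> c" if "c \<in> C n" for c using that nn ne by (auto simp: C_def)
    ultimately have "u n \<in> L" "lub (\<tau> ` C n) (\<tau> (u n))"
      using monotone_convergence[OF _ CL _ lub] by auto
    then show ?thesis using le lub_least[of "\<tau> ` C n" "\<tau> (u n)" b] by auto
  qed
  have "bdd_above (range u)"
  proof (rule bdd_above_if_truncations[OF u0 trunc])
    fix w assume w: "\<And>n. real (Suc n) *\<^sub>R w \<le> u (Suc n)"
    have pw: "real (Suc n) *\<^sub>R pprt w \<le> u (Suc n)" for n
    proof -
      have "real (Suc n) *\<^sub>R pprt w = pprt (real (Suc n) *\<^sub>R w)" by (rule pprt_scaleR[symmetric]) simp
      also have "\<dots> \<le> u (Suc n)" unfolding pprt_def using w u0 by (rule sup_least)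
      finally show ?thesis .
    qed
    have "pprt w \<in> L"
      using pw[of 0] \<tau>u[of 1] L_solid[of "u 1" "pprt w"] by (simp add: of_nat_Suc)
    have "\<tau> (pprt w) \<le> 0"
    proof (rule archimedean)
      fix n
      have "\<tau> (real (Suc n) *\<^sub>R pprt w) \<le> \<tau> (u (Suc n))"
        using pw \<tau>u \<open>pprt w \<in> L\<close> by (intro exp_mono L_scale) auto
      also have "\<dots> \<le> b" using \<tau>u by simp
      finally show "real (Suc n) *\<^sub>R \<tau> (pprt w) \<le> b" using \<open>pprt w \<in> L\<close> by (simp add: L_scale)
    qed
    then have "\<tau> (pprt w) = 0" using exp_nonneg[OF \<open>pprt w \<in> L\<close>] by simp
    then have "pprt w = 0" using exp_strict[OF \<open>pprt w \<in> L\<close>] by simp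
    then show "w \<le> 0" by (simp only: le_zero_iff_zero_pprt)
  qed
  then obtain v where v: "\<And>n. u n \<le> v" by (auto simp: bdd_above_def)
  have "d \<le> v" if "d \<in> D" for d
  proof (rule lub_least[OF lub_trunc[OF nn[OF that]]])
    note dD = that
    fix t assume "t \<in> range (\<lambda>n. inf d (real n *\<^sub>R e))"
    then obtain n where "t = inf (real n *\<^sub>R e) d" by (auto simp: inf_commute)
    then have "t \<in> C n" using dD unfolding C_def by (rule image_eqI)
    then have "t \<le> u n" by (rule lub_upper[OF lub])
    then show "t \<le> v" using v by (rule order_trans)
  qed
  then show ?thesis by (intro bdd_aboveI[of _ v])
qed

section \<open>The space \<open>L\<^sup>2(T)\<close>\<close>

abbreviation "H \<equiv> L2 E T"

lemma H_in_L: "x \<in> H \<Longrightarrow> x \<in> L" and H_square: "x \<in> H \<Longrightarrow> x * x \<in> L"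
  by (simp_all add: L2_def)

lemma abs_two_mult_le: "\<bar>2 *\<^sub>R (x * y)\<bar> \<le> x * x + y * y" for x y :: 'u
  using two_mult_le[of x y] two_mult_le[of "- x" y] by (intro abs_leI) simp_all

lemma H_mult_in_L: assumes "x \<in> H" "y \<in> H" shows "x * y \<in> L"
proof -
  have "2 *\<^sub>R (x * y) \<in> L"
    using L_solid[OF L_add(1) abs_two_mult_le] assms by (simp add: H_square)
  from L_scale(1)[OF this, of "1/2"] show ?thesis by simp
qed

lemma H_add: assumes "x \<in> H" "y \<in> H" shows "x + y \<in> H"
proof -
  have "(x + y) * (x + y) = x * x + x * y + x * y + y * y" by (simp add: algebra_simps)
  then show ?thesis using assms H_mult_in_L[OF assms] by (simp add: L2_def L_add)
qed

lemma H_scale: assumes "x \<in> H" shows "c *\<^sub>R x \<in> H"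
  using assms by (simp add: L2_def L_scale)

lemma H_minus: "x \<in> H \<Longrightarrow> - x \<in> H"
  using H_scale[of x "-1"] by simp

lemma H_diff: "x \<in> H \<Longrightarrow> y \<in> H \<Longrightarrow> x - y \<in> H"
  using H_add[of x "- y"] H_minus by simp

lemma H_zero: "0 \<in> H"
  by (simp add: L2_def L_zero)

lemma H_solid: assumes "y \<in> H" "\<bar>x\<bar> \<le> \<bar>y\<bar>" shows "x \<in> H"
proof -
  have "\<bar>x\<bar> * \<bar>x\<bar> \<le> \<bar>y\<bar> * \<bar>y\<bar>" using assms(2) by (intro mult_mono) auto
  then have "\<bar>x * x\<bar> \<le> y * y" by (simp only: abs_mult_abs abs_of_nonneg[OF square_nonneg])
  then show ?thesis
    using assms L_solid_abs[of y x] L_solid[of "y * y" "x * x"] by (simp add: L2_def)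
qed

lemma H_solid_nonneg: "y \<in> H \<Longrightarrow> 0 \<le> x \<Longrightarrow> x \<le> y \<Longrightarrow> x \<in> H"
  by (rule H_solid[of y]) auto

lemma H_abs: "x \<in> H \<Longrightarrow> \<bar>x\<bar> \<in> H"
  by (rule H_solid[of x]) auto

lemma H_pprt: "x \<in> H \<Longrightarrow> pprt x \<in> H"
  by (rule H_solid[of x]) (simp_all only: abs_of_nonneg[OF zero_le_pprt] pprt_le_abs)

lemma H_A_mult: assumes "a \<in> A" "x \<in> H" shows "a * x \<in> H"
proof -
  have "(a * x) * (a * x) = (a * a) * (x * x)" by (simp add: mult_ac)
  then show ?thesis using assms averaging(1)[of a x] averaging(1)[OF A_mult, of a a "x * x"] by (simp add: L2_def)
qed

lemma A_in_H: "a \<in> A \<Longrightarrow> a \<in> H"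
  using A_mult[of a a] by (simp add: L2_def A_in_L)

lemma ubdd_mult_H: assumes "ubdd b" "x \<in> H" shows "b * x \<in> H"
proof -
  obtain c where c: "0 < c" "\<bar>b\<bar> \<le> c *\<^sub>R e" using ubdd_pos[OF assms(1)] .
  have "\<bar>b * x\<bar> \<le> \<bar>b\<bar> * \<bar>x\<bar>" by (rule abs_le_mult)
  also have "\<dots> \<le> (c *\<^sub>R e) * \<bar>x\<bar>" using c by (intro mult_right_mono) auto
  also have "\<dots> = \<bar>c *\<^sub>R \<bar>x\<bar>\<bar>" using c by (simp add: mult_unit scaleR_nonneg_nonneg)
  finally show ?thesis by (rule H_solid[OF H_scale[OF H_abs[OF assms(2)]]])
qed

lemma sq_in_A: "x \<in> H \<Longrightarrow> \<tau> (x * x) \<in> A" and sq_nonneg: "x \<in> H \<Longrightarrow> 0 \<le> \<tau> (x * x)"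
  by (simp_all add: exp_in_A exp_nonneg H_square square_nonneg)

text \<open>The square of \<open>Z * x - X * y\<close> only yields positivity of
  \<open>X * (X * Y - Z * Z)\<close>, and \<open>X\<close> cannot be cancelled where it vanishes.
  But on the support of \<open>N\<close>, where the claim would fail, \<open>X\<close> does vanish;
  strict positivity gives \<open>N * x = 0\<close>, hence \<open>N * Z = 0\<close> and
  \<open>N * N = 0\<close>.\<close>

lemma cauchy_schwarz:
  assumes "x \<in> H" "y \<in> H"
  shows "\<tau> (x * y) * \<tau> (x * y) \<le> \<tau> (x * x) * \<tau> (y * y)"
proof -
  define X Y Z where "X = \<tau> (x * x)" and "Y = \<tau> (y * y)" and "Z = \<tau> (x * y)"
  have A: "X \<in> A" "Y \<in> A" "Z \<in> A"
    using assms by (simp_all add: X_def Y_def Z_def exp_in_A H_square H_mult_in_L)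
  note L = H_square[OF assms(1)] H_square[OF assms(2)] H_mult_in_L[OF assms]
  have X0: "0 \<le> X" using assms by (simp add: X_def sq_nonneg)
  have "0 \<le> \<tau> ((Z * x - X * y) * (Z * x - X * y))"
    using assms A by (intro sq_nonneg H_diff H_A_mult)
  also have "(Z * x - X * y) * (Z * x - X * y) =
      (Z * Z) * (x * x) - (Z * X) * (x * y) - (Z * X) * (x * y) + (X * X) * (y * y)"
    by (simp add: algebra_simps)
  also have "\<tau> \<dots> = (Z * Z) * X - (Z * X) * Z - (Z * X) * Z + (X * X) * Y"
    using A L by (simp add: L_add L_diff averaging A_mult X_def Y_def Z_def)
  also have "\<dots> = X * (X * Y - Z * Z)" by (simp add: algebra_simps)
  finally have 1: "0 \<le> X * (X * Y - Z * Z)" .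
  define N where "N = pprt (Z * Z - X * Y)"
  have N: "0 \<le> N" "N \<in> A" using A by (simp_all add: N_def A_pprt A_diff A_mult)
  have NN: "N * (Z * Z - X * Y) = N * N"
    unfolding N_def by (metis mult_pprt mult.commute)
  have "X * (N * N) = - ((X * (X * Y - Z * Z)) * N)"
    unfolding NN[symmetric] by (simp add: algebra_simps)
  also have "\<dots> \<le> 0" using 1 N by simp
  finally have "X * (N * N) = 0" using X0 N by (intro order.antisym) auto
  then have NX: "(N * N) * X = 0" by (simp add: mult_ac)
  have "\<tau> ((N * x) * (N * x)) = (N * N) * X"
    using averaging(2)[OF A_mult[OF N(2) N(2)] L(1)] by (simp add: X_def mult_ac)
  then have "(N * x) * (N * x) = 0"
    using NX exp_strict[OF H_square[OF H_A_mult[OF N(2) assms(1)]] square_nonneg] by simp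
  then have "N * x = 0" by (rule square_eq_0)
  then have "N * (x * y) = 0" by (simp flip: mult.assoc)
  then have NZ: "N * Z = 0" using averaging(2)[OF N(2) L(3)] by (simp add: Z_def L_zero)
  have "(N * X) * (N * X) = X * ((N * N) * X)" by (simp add: mult_ac)
  also have "\<dots> = 0" by (simp only: NX mult_zero_right)
  finally have "N * X = 0" by (rule square_eq_0)
  then have "N * N = 0" unfolding NN[symmetric] using NZ by (simp add: right_diff_distrib flip: mult.assoc)
  then have "N = 0" by (rule square_eq_0)
  then have "Z * Z - X * Y \<le> 0" by (simp only: N_def le_zero_iff_zero_pprt)
  then show ?thesis by (simp add: X_def Y_def Z_def)
qed

lemma T_norm_eq:
  assumes "r \<in> A" "0 \<le> r" "r * r = \<tau> (x * x)" shows "T_norm E T x = r"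
  unfolding T_norm_def
proof (rule the_equality)
  fix s assume s: "s \<in> A \<and> 0 \<le> s \<and> s * s = \<tau> (x * x)"
  then show "s = r" using assms square_le_imp_le[of s r] square_le_imp_le[of r s] by (intro order.antisym) auto
qed (use assms in auto)

lemma T_norm:
  assumes "x \<in> H"
  shows "T_norm E T x \<in> A" "0 \<le> T_norm E T x" "T_norm E T x * T_norm E T x = \<tau> (x * x)"
  using A_sqrt[OF sq_in_A[OF assms] sq_nonneg[OF assms]] T_norm_eq[of _ x] by auto

text \<open>Lets all boundedness estimates be carried out with squares, without computing
  roots.\<close>

lemma T_norm_le_iff:
  assumes "x \<in> H" "y \<in> H" "0 \<le> k"
  shows "T_norm E T y \<le> k * T_norm E T x \<longleftrightarrow> \<tau> (y * y) \<le> (k * k) * \<tau> (x * x)"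
proof -
  note x = T_norm[OF assms(1)] and y = T_norm[OF assms(2)]
  have eq: "(k * T_norm E T x) * (k * T_norm E T x) = (k * k) * \<tau> (x * x)"
    unfolding x(3)[symmetric] by (simp add: mult_ac)
  show ?thesis
  proof
    assume "T_norm E T y \<le> k * T_norm E T x"
    then have "T_norm E T y * T_norm E T y \<le> (k * T_norm E T x) * (k * T_norm E T x)"
      using x y assms(3) by (intro mult_mono) auto
    then show "\<tau> (y * y) \<le> (k * k) * \<tau> (x * x)" by (simp only: eq y(3))
  next
    assume "\<tau> (y * y) \<le> (k * k) * \<tau> (x * x)"
    then have "T_norm E T y * T_norm E T y \<le> (k * T_norm E T x) * (k * T_norm E T x)"
      by (simp only: eq y(3))
    then show "T_norm E T y \<le> k * T_norm E T x"
      by (rule square_le_imp_le[OF y(2) mult_nonneg_nonneg[OF assms(3) x(2)]])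
  qed
qed

text \<open>Cancels \<open>r\<close> without inverting it, by the cube of
  \<open>pprt (r - K)\<close>. It bounds the squares of the densities and the norm of the
  adjoint.\<close>

lemma le_if_square_le_mult:
  fixes r K :: 'u
  assumes "0 \<le> r" "0 \<le> K" "r * r \<le> K * r" shows "r \<le> K"
proof -
  define p where "p = pprt (r - K)"
  have p: "0 \<le> p" "p \<le> r"
    using assms by (auto simp: p_def pprt_def)
  have "p * p * p \<le> p * p * r" using p by (intro mult_left_mono) auto
  also have "\<dots> = ((r - K) * p) * r" by (simp add: p_def mult_pprt)
  also have "\<dots> = p * (r * r - K * r)" by (simp add: algebra_simps)
  also have "\<dots> \<le> 0" using assms p by (simp add: mult_nonneg_nonpos)
  finally have "p * p * p = 0" using p by (intro order.antisym) auto
  then have "(p * p) * (p * p) = 0" by (simp add: mult.assoc)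
  then have "p = 0" using square_eq_0 by blast
  then have "r - K \<le> 0" unfolding p_def le_zero_iff_zero_pprt .
  then show ?thesis by simp
qed

end

section \<open>Representation of positive functionals\<close>

context unital_f_algebra
begin

text \<open>\<open>a\<close> is a bounded multiplier supported where \<open>\<psi>\<close> is
  positive. Built from lattice operations alone, it belongs to A whenever \<open>\<psi>\<close> does
  and so may be pulled out of A-homogeneous maps.\<close>

lemma trunc_pprt:
  fixes \<psi> :: 'u
  defines "a \<equiv> inf (pprt \<psi>) e"
  shows "0 \<le> a" "a \<le> e" "a * a \<le> a * \<psi>" "a = 0 \<Longrightarrow> \<psi> \<le> 0"
proof -
  show a: "0 \<le> a" "a \<le> e" by (simp_all add: a_def unit_nonneg)
  have "a * pprt (- \<psi>) \<le> pprt \<psi> * pprt (- \<psi>)"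
    by (intro mult_right_mono) (simp_all add: a_def)
  then have "a * pprt (- \<psi>) = 0" using a by (intro order.antisym) (auto simp: pprt_mult_neg)
  then have "a * \<psi> = a * pprt \<psi>"
    by (metis pprt_minus right_diff_distrib diff_zero)
  moreover have "a * a \<le> a * pprt \<psi>" using a by (intro mult_left_mono) (auto simp: a_def)
  ultimately show "a * a \<le> a * \<psi>" by simp
  show "\<psi> \<le> 0" if "a = 0"
  proof -
    have "pprt \<psi> * e = 0" using that unfolding a_def by (rule mult_disjoint)
    then show ?thesis by (simp only: mult_unit_right le_zero_iff_zero_pprt)
  qed
qed

end

text \<open>Everything is required on the positive cone only, and the bound is squared, so
  \<open>K\<close> acts as the square of a norm. Any A-homogeneous additive functional between 0 and
  \<open>f\<close> with values in A satisfies the same bound; the proof of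
  \<open>representation\<close> uses this for a remainder.\<close>

locale positive_functional = riesz_conditional_expectation E e T
  for E :: "'u::universally_complete_f_algebra set" and e T +
  fixes f :: "'u \<Rightarrow> 'u" and K :: 'u
  assumes f_add: "\<And>x y. x \<in> H \<Longrightarrow> y \<in> H \<Longrightarrow> 0 \<le> x \<Longrightarrow> 0 \<le> y \<Longrightarrow> f (x + y) = f x + f y"
    and f_A: "\<And>a x. a \<in> A \<Longrightarrow> 0 \<le> a \<Longrightarrow> x \<in> H \<Longrightarrow> 0 \<le> x \<Longrightarrow> f (a * x) = a * f x"
    and f_in_A: "\<And>x. x \<in> H \<Longrightarrow> 0 \<le> x \<Longrightarrow> f x \<in> A"
    and f_nonneg: "\<And>x. x \<in> H \<Longrightarrow> 0 \<le> x \<Longrightarrow> 0 \<le> f x"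
    and f_bound: "\<And>x. x \<in> H \<Longrightarrow> 0 \<le> x \<Longrightarrow> f x * f x \<le> K * \<tau> (x * x)"
    and K_nonneg: "0 \<le> K"
begin

lemma f_zero: "f 0 = 0"
  using f_add[of 0 0] by (simp add: H_zero)

lemma f_diff: assumes "x \<in> H" "y \<in> H" "0 \<le> y" "y \<le> x" shows "f (x - y) = f x - f y"
  using f_add[of "x - y" y] assms by (simp add: H_diff)

lemma f_mono: assumes "x \<in> H" "y \<in> H" "0 \<le> y" "y \<le> x" shows "f y \<le> f x"
  using f_diff[OF assms] f_nonneg[of "x - y"] assms by (simp add: H_diff)

lemma f_scale: assumes "0 \<le> c" "x \<in> H" "0 \<le> x" shows "f (c *\<^sub>R x) = c *\<^sub>R f x"
  using f_A[of "c *\<^sub>R e" x] assms by (simp add: A_scale unit_in_A mult_unit scaleR_nonneg_nonneg unit_nonneg)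

text \<open>The norm bound makes \<open>f\<close> order continuous. With
  \<open>w = pprt (f x - u)\<close>, the square of \<open>w\<close> is at most that of
  \<open>f (x - d)\<close>, hence at most \<open>K * \<tau> (x * (x - d))\<close>, which decreases
  to 0 by monotone convergence.\<close>

lemma f_lub:
  assumes dir: "directed D" and D: "D \<subseteq> H" and nn: "\<And>d. d \<in> D \<Longrightarrow> 0 \<le> d"
    and lub: "lub D x" and x: "x \<in> H" and u: "\<And>d. d \<in> D \<Longrightarrow> f d \<le> u"
  shows "f x \<le> u"
proof -
  obtain d0 where "d0 \<in> D" using dir by (auto simp: directed_by_def)
  then have x0: "0 \<le> x" using nn lub_upper[OF lub] by (meson order_trans)
  define w where "w = pprt (f x - u)"
  have w_le: "w * w \<le> K * (\<tau> (x * x) - \<tau> (x * d))" if d: "d \<in> D" for d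
  proof -
    have dx: "d \<in> H" "0 \<le> d" "d \<le> x" using that D nn lub_upper[OF lub] by auto
    have "w \<le> f (x - d)"
      unfolding w_def pprt_def f_diff[OF x dx]
      using u[OF that] f_mono[OF x dx] by simp
    then have "w * w \<le> f (x - d) * f (x - d)" by (intro mult_mono) (auto simp: w_def intro: order_trans[OF zero_le_pprt])
    also have "\<dots> \<le> K * \<tau> ((x - d) * (x - d))" using dx x by (intro f_bound) (auto simp: H_diff)
    also have "\<dots> \<le> K * \<tau> (x * (x - d))"
      using dx x x0 by (intro mult_left_mono K_nonneg exp_mono H_mult_in_L H_diff mult_right_mono) auto
    also have "\<tau> (x * (x - d)) = \<tau> (x * x) - \<tau> (x * d)"
      using x dx by (simp add: right_diff_distrib L_diff H_mult_in_L)
    finally show ?thesis .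
  qed
  have "(*) x ` D \<subseteq> L" using x D by (auto intro: H_mult_in_L)
  moreover have "directed ((*) x ` D)" using x0 by (intro directed_image[OF dir] mult_left_mono)
  moreover have "lub ((*) x ` D) (x * x)" using lub x0 by (rule lub_mult)
  moreover have "bdd_above (\<tau> ` (*) x ` D)"
    using x D x0 lub_upper[OF lub]
    by (intro bdd_aboveI[of _ "\<tau> (x * x)"]) (auto intro!: exp_mono H_mult_in_L mult_left_mono)
  moreover have "0 \<le> d" if "d \<in> (*) x ` D" for d using that nn x0 by auto
  ultimately have lub\<tau>: "lub (\<tau> ` (*) x ` D) (\<tau> (x * x))" by (intro monotone_convergence(2))
  have "K * \<tau> (x * x) \<le> K * \<tau> (x * x) - w * w"
    by (rule lub_least[OF lub_mult[OF lub\<tau> K_nonneg]]) (use w_le in \<open>auto simp: algebra_simps\<close>)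
  then have "w * w = 0" using square_nonneg[of w] by simp
  then have "w = 0" by (rule square_eq_0)
  then have "f x - u \<le> 0" unfolding w_def le_zero_iff_zero_pprt .
  then show ?thesis by simp
qed

text \<open>A Hahn decomposition argument: for small \<open>r\<close> the functional \<open>f - r \<tau>\<close> is positive on
  the complement \<open>x2\<close> in \<open>x1\<close> of a maximal \<open>z0\<close> on which it is negative.\<close>

lemma dominates_density:
  assumes "f e \<noteq> 0"
  shows "\<exists>w\<in>H. 0 \<le> w \<and> w \<noteq> 0 \<and> (\<forall>x\<in>H. 0 \<le> x \<longrightarrow> \<tau> (w * x) \<le> f x)"
proof -
  have e: "e \<in> H" by (rule A_in_H[OF unit_in_A])
  have "\<exists>n. \<not> f e - (1 / real (Suc n)) *\<^sub>R e \<le> 0"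
  proof (rule ccontr)
    assume "\<nexists>n. \<not> f e - (1 / real (Suc n)) *\<^sub>R e \<le> 0"
    then have "f e \<le> 0 + (1 / real (Suc n)) *\<^sub>R e" for n by simp
    then have "f e \<le> 0" by (rule archimedean_le)
    with assms f_nonneg[OF e unit_nonneg] show False by simp
  qed
  then obtain n where n: "\<not> f e - (1 / real (Suc n)) *\<^sub>R e \<le> 0" by blast
  define r where "r = 1 / real (Suc n)"
  have r: "0 < r" by (simp add: r_def)
  \<comment> \<open>A multiplier in A supported where \<open>f e\<close> exceeds \<open>r\<close>;
    it is nonzero by the choice of \<open>r\<close>. If \<open>z0\<close> exhausted it,
    \<open>f x1 \<le> r *\<^sub>R x1\<close> would contradict
    \<open>x1 * x1 \<le> x1 * (f e - r *\<^sub>R e)\<close>.\<close>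
  define x1 where "x1 = inf (pprt (f e - r *\<^sub>R e)) e"
  have x1: "0 \<le> x1" "x1 \<le> e" "x1 * x1 \<le> x1 * (f e - r *\<^sub>R e)" "x1 \<noteq> 0"
    unfolding x1_def using trunc_pprt[of "f e - r *\<^sub>R e"] n by (auto simp: r_def)
  have "x1 \<in> A"
    unfolding x1_def by (intro A_inf A_pprt A_diff A_scale f_in_A e unit_nonneg unit_in_A)
  then have "x1 \<in> H" by (rule A_in_H)
  define Z where "Z = {z \<in> H. 0 \<le> z \<and> z \<le> x1 \<and> f z \<le> r *\<^sub>R \<tau> z}"
  have "\<exists>m\<in>Z. \<forall>z\<in>Z. m \<le> z \<longrightarrow> z = m"
  proof (rule predicate_Zorn)
    show "partial_order_on Z (relation_of (\<le>) Z)"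
      by (rule partial_order_on_relation_ofI) auto
    fix C assume "C \<in> Chains (relation_of (\<le>) Z)"
    then have C: "C \<subseteq> Z" "\<And>a b. a \<in> C \<Longrightarrow> b \<in> C \<Longrightarrow> a \<le> b \<or> b \<le> a"
      unfolding Chains_def relation_of_def by auto
    show "\<exists>u\<in>Z. \<forall>a\<in>C. a \<le> u"
    proof (cases "C = {}")
      case True
      have "0 \<in> Z" using x1 by (simp add: Z_def H_zero f_zero L_zero)
      with True show ?thesis by auto
    next
      case False
      have lub: "lub C (Sup C)"
        using False C(1) by (intro lub_Sup bdd_aboveI[of _ x1]) (auto simp: Z_def)
      have "directed C"
        unfolding directed_by_def using C(2) False by (meson order_refl)
      obtain c where "c \<in> C" using False by auto
      then have "0 \<le> Sup C" using C(1) lub_upper[OF lub] by (force simp: Z_def intro: order_trans)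
      moreover have "Sup C \<le> x1" using C(1) by (intro lub_least[OF lub]) (auto simp: Z_def)
      ultimately have "Sup C \<in> H" by (rule H_solid_nonneg[OF \<open>x1 \<in> H\<close>])
      have "f (Sup C) \<le> r *\<^sub>R \<tau> (Sup C)"
      proof (rule f_lub[OF \<open>directed C\<close> _ _ lub \<open>Sup C \<in> H\<close>])
        fix d assume "d \<in> C"
        then have d: "d \<in> H" "f d \<le> r *\<^sub>R \<tau> d" using C(1) by (auto simp: Z_def)
        note d(2)
        also have "r *\<^sub>R \<tau> d \<le> r *\<^sub>R \<tau> (Sup C)"
          using r d \<open>Sup C \<in> H\<close> lub_upper[OF lub \<open>d \<in> C\<close>]
          by (intro scaleR_left_mono exp_mono H_in_L) auto
        finally show "f d \<le> r *\<^sub>R \<tau> (Sup C)" .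
      qed (use C(1) in \<open>auto simp: Z_def\<close>)
      then have "Sup C \<in> Z"
        using \<open>0 \<le> Sup C\<close> \<open>Sup C \<le> x1\<close> \<open>Sup C \<in> H\<close> by (simp add: Z_def)
      then show ?thesis using lub_upper[OF lub] by blast
    qed
  qed
  then obtain z0 where z0: "z0 \<in> Z" and max: "\<And>z. z \<in> Z \<Longrightarrow> z0 \<le> z \<Longrightarrow> z = z0" by blast
  define x2 where "x2 = x1 - z0"
  have z0H: "z0 \<in> H" "0 \<le> z0" "z0 \<le> x1" "f z0 \<le> r *\<^sub>R \<tau> z0" using z0 by (auto simp: Z_def)
  have x2: "x2 \<in> H" "0 \<le> x2" "x2 \<le> x1"
    using z0H \<open>x1 \<in> H\<close> by (auto simp: x2_def H_diff)
  have "x2 \<le> e" using x2(3) x1(2) by (rule order_trans)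
  have pos: "r *\<^sub>R \<tau> z \<le> f z" if z: "z \<in> H" "0 \<le> z" "z \<le> x2" for z
  proof -
    \<comment> \<open>The multiplier \<open>a\<close> restricts \<open>z\<close> to the region where
      the claimed inequality fails. The restricted vector could be added to \<open>z0\<close>, so
      maximality makes it 0.\<close>
    define \<psi> where "\<psi> = r *\<^sub>R \<tau> z - f z"
    define a where "a = inf (pprt \<psi>) e"
    have a: "0 \<le> a" "a \<le> e" "a * a \<le> a * \<psi>" "a = 0 \<Longrightarrow> \<psi> \<le> 0"
      unfolding a_def by (rule trunc_pprt)+ simp
    have "a \<in> A"
      unfolding a_def \<psi>_def using z
      by (intro A_inf A_pprt A_diff A_scale f_in_A exp_in_A H_in_L unit_in_A)
    have az: "a * z \<in> H" "0 \<le> a * z" "a * z \<le> z"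
      using a z \<open>a \<in> A\<close> mult_right_mono[OF a(2) z(2)] by (auto simp: H_A_mult mult_unit)
    have diff: "r *\<^sub>R \<tau> (a * z) - f (a * z) = a * \<psi>"
      using averaging(2)[OF \<open>a \<in> A\<close> H_in_L[OF z(1)]] f_A[OF \<open>a \<in> A\<close> a(1) z(1,2)]
      by (simp add: \<psi>_def right_diff_distrib)
    have "0 \<le> a * \<psi>" using a(3) square_nonneg order_trans by blast
    then have "f (a * z) \<le> r *\<^sub>R \<tau> (a * z)" by (simp flip: diff)
    then have "f (z0 + a * z) \<le> r *\<^sub>R \<tau> (z0 + a * z)"
      using add_mono[OF z0H(4)] z0H az by (simp add: f_add L_add H_in_L scaleR_right_distrib)
    moreover have "z0 + a * z \<le> z0 + x2" using az(3) z(3) by (intro add_left_mono) (rule order_trans)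
    ultimately have "z0 + a * z \<in> Z"
      using z0H az by (simp add: Z_def H_add x2_def)
    then have "a * z = 0" using max[of "z0 + a * z"] az(2) by simp
    then have "a * \<psi> = 0" using diff by (simp add: f_zero L_zero)
    then have "a * a = 0" using a(3) square_nonneg[of a] by simp
    then have "a = 0" by (rule square_eq_0)
    from a(4)[OF this] show ?thesis by (simp add: \<psi>_def)
  qed
  have "x2 \<noteq> 0"
  proof
    assume "x2 = 0"
    then have "f x1 \<le> r *\<^sub>R \<tau> x1" using z0H(4) by (simp add: x2_def)
    moreover have "f x1 = x1 * f e"
      using f_A[OF \<open>x1 \<in> A\<close> x1(1) e unit_nonneg] by (simp add: mult_unit_right)
    ultimately have "x1 * (f e - r *\<^sub>R e) \<le> 0"
      using A_fixed[OF \<open>x1 \<in> A\<close>] by (simp add: right_diff_distrib mult_unit_right)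
    with x1(3) have "x1 * x1 \<le> 0" by (rule order_trans)
    then have "x1 * x1 = 0" using square_nonneg[of x1] by simp
    with x1(4) square_eq_0 show False by blast
  qed
  have "\<tau> ((r *\<^sub>R x2) * x) \<le> f x" if x: "x \<in> H" "0 \<le> x" for x
  proof -
    let ?y = "\<lambda>n. inf x (real n *\<^sub>R e)"
    let ?D = "range (\<lambda>n. x2 * ?y n)"
    have y: "?y n \<in> H" "0 \<le> ?y n" for n
      using x by (auto simp: unit_nonneg scaleR_nonneg_nonneg intro: H_solid_nonneg[of x])
    have x2y: "x2 * ?y n \<in> H" "0 \<le> x2 * ?y n" "x2 * ?y n \<le> x" for n
    proof -
      have "ubdd x2" by (rule ubdd_nonneg[of _ 1]) (simp_all add: x2 \<open>x2 \<le> e\<close>)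
      then show "x2 * ?y n \<in> H" using y by (intro ubdd_mult_H)
      show "0 \<le> x2 * ?y n" using x2 y by (intro mult_nonneg_nonneg)
      have "x2 * ?y n \<le> e * x" using x2 y \<open>x2 \<le> e\<close> x by (intro mult_mono) (auto simp: unit_nonneg)
      then show "x2 * ?y n \<le> x" by (simp add: mult_unit)
    qed
    have le: "r *\<^sub>R \<tau> (x2 * ?y n) \<le> f x" for n
    proof -
      \<comment> \<open>\<open>pos\<close> applies only below \<open>x2\<close>. As
        \<open>?y n\<close> is at most \<open>?m\<close> times the unit, dividing
        \<open>x2 * ?y n\<close> by \<open>?m\<close> brings it below \<open>x2\<close>;
        \<open>Suc n\<close> keeps the divisor nonzero for \<open>n = 0\<close>.\<close>
      let ?m = "real (Suc n)"
      have "?y n \<le> ?m *\<^sub>R e"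
        by (intro le_infI2 scaleR_right_mono unit_nonneg) simp
      then have "x2 * ?y n \<le> x2 * (?m *\<^sub>R e)" using x2 by (intro mult_left_mono)
      then have "(1 / ?m) *\<^sub>R (x2 * ?y n) \<le> (1 / ?m) *\<^sub>R (x2 * (?m *\<^sub>R e))"
        by (intro scaleR_left_mono) auto
      then have "(1 / ?m) *\<^sub>R (x2 * ?y n) \<le> x2" by (simp add: mult_unit_right)
      then have "r *\<^sub>R \<tau> ((1 / ?m) *\<^sub>R (x2 * ?y n)) \<le> f ((1 / ?m) *\<^sub>R (x2 * ?y n))"
        using x2y by (intro pos H_scale scaleR_nonneg_nonneg) auto
      then have "?m *\<^sub>R r *\<^sub>R \<tau> ((1 / ?m) *\<^sub>R (x2 * ?y n)) \<le> ?m *\<^sub>R f ((1 / ?m) *\<^sub>R (x2 * ?y n))"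
        by (intro scaleR_left_mono) auto
      then have "r *\<^sub>R \<tau> (x2 * ?y n) \<le> f (x2 * ?y n)"
        using x2y[of n] by (simp add: f_scale L_scale H_in_L)
      also have "\<dots> \<le> f x" using x2y x by (intro f_mono)
      finally show ?thesis .
    qed
    have "directed ?D"
      using directed_image[OF directed_trunc[of x], of "(*) x2"] x2 by (simp add: image_image mult_left_mono)
    moreover have "?D \<subseteq> L" using x2y by (auto intro: H_in_L)
    moreover have "0 \<le> d" if "d \<in> ?D" for d using that x2y by auto
    moreover have "lub ?D (x2 * x)"
      using lub_mult[OF lub_trunc[OF x(2)] x2(2)] by (simp add: image_image)
    moreover have le': "\<tau> d \<le> (1 / r) *\<^sub>R f x" if "d \<in> ?D" for d
    proof -
      obtain n where "d = x2 * ?y n" using \<open>d \<in> ?D\<close> by auto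
      then have "(1 / r) *\<^sub>R r *\<^sub>R \<tau> d \<le> (1 / r) *\<^sub>R f x" using le[of n] r by (intro scaleR_left_mono) auto
      then show ?thesis using r by simp
    qed
    moreover from this have "bdd_above (\<tau> ` ?D)" by (intro bdd_aboveI[of _ "(1 / r) *\<^sub>R f x"]) blast
    ultimately have "x2 * x \<in> L" "lub (\<tau> ` ?D) (\<tau> (x2 * x))"
      using monotone_convergence[of ?D "x2 * x"] by blast+
    from this(2) have "\<tau> (x2 * x) \<le> (1 / r) *\<^sub>R f x"
      by (rule lub_least) (use le' in blast)
    then have "r *\<^sub>R \<tau> (x2 * x) \<le> r *\<^sub>R (1 / r) *\<^sub>R f x" using r by (intro scaleR_left_mono) auto
    then show ?thesis using r \<open>x2 * x \<in> L\<close> by (simp add: L_scale)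
  qed
  moreover have "r *\<^sub>R x2 \<in> H" "0 \<le> r *\<^sub>R x2" "r *\<^sub>R x2 \<noteq> 0"
    using x2 r \<open>x2 \<noteq> 0\<close> by (auto simp: H_scale scaleR_nonneg_nonneg)
  ultimately show ?thesis by blast
qed

definition minorants :: "'u set" where
  "minorants = {g \<in> H. 0 \<le> g \<and> (\<forall>x\<in>H. 0 \<le> x \<longrightarrow> \<tau> (g * x) \<le> f x)}"

text \<open>\<open>p\<close> is the component of the unit where \<open>g\<close> exceeds
  \<open>h\<close>. There \<open>sup g h\<close> is \<open>g\<close>, elsewhere \<open>h\<close>, so
  each minorant is tested on one of the two pieces \<open>p * x\<close> and
  \<open>(e - p) * x\<close>.\<close>

lemma minorants_sup:
  assumes "g \<in> minorants" "h \<in> minorants" shows "sup g h \<in> minorants"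
proof -
  have g: "g \<in> H" "0 \<le> g" and h: "h \<in> H" "0 \<le> h" using assms by (auto simp: minorants_def)
  define p where "p = component (pprt (g - h))"
  have p: "0 \<le> p" "p \<le> e" by (simp_all add: p_def component_nonneg component_le)
  have pb: "ubdd p" "ubdd (e - p)" using p by (auto intro: ubdd_nonneg[of _ 1])
  have eq: "sup g h * x = g * (p * x) + h * ((e - p) * x)" for x
  proof -
    have "sup g h * x = (h + p * (g - h)) * x"
      by (simp only: sup_eq_add_pprt p_def component_mult_pprt)
    also have "\<dots> = g * (p * x) + h * ((e - p) * x)"
      by (simp add: algebra_simps mult_unit)
    finally show ?thesis .
  qed
  have "\<tau> (sup g h * x) \<le> f x" if x: "x \<in> H" "0 \<le> x" for x
  proof -
    have px: "p * x \<in> H" "0 \<le> p * x" "(e - p) * x \<in> H" "0 \<le> (e - p) * x"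
      using ubdd_mult_H[OF pb(1) x(1)] ubdd_mult_H[OF pb(2) x(1)] p x by (auto intro: mult_nonneg_nonneg)
    have "\<tau> (sup g h * x) = \<tau> (g * (p * x)) + \<tau> (h * ((e - p) * x))"
      unfolding eq using px g h by (intro L_add H_mult_in_L)
    also have "\<dots> \<le> f (p * x) + f ((e - p) * x)"
      using assms px by (intro add_mono) (auto simp: minorants_def)
    also have "\<dots> = f (p * x + (e - p) * x)" using px by (simp add: f_add)
    also have "p * x + (e - p) * x = x" by (simp add: algebra_simps mult_unit)
    finally show ?thesis .
  qed
  moreover have "sup g h \<in> H"
  proof (rule H_solid_nonneg[OF H_add[OF g(1) h(1)]])
    show "0 \<le> sup g h" "sup g h \<le> g + h"
      using g h by (auto intro: le_supI1 add_increasing add_increasing2)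
  qed
  ultimately show ?thesis using g by (auto simp: minorants_def intro: le_supI1)
qed

text \<open>Testing a minorant at \<open>e\<close> gives \<open>\<tau> g \<le> f e\<close>, which is
  what makes the set order bounded. The delicate point is that the supremum is again square
  integrable.\<close>

lemma minorants_lub: "\<exists>s\<in>minorants. lub minorants s"
proof -
  let ?G = minorants
  have "0 \<in> ?G" by (auto simp: minorants_def H_zero L_zero f_nonneg)
  have GH: "?G \<subseteq> H" and GL: "?G \<subseteq> L" and G0: "\<And>g. g \<in> ?G \<Longrightarrow> 0 \<le> g"
    by (auto simp: minorants_def H_in_L)
  have G: "\<tau> (g * x) \<le> f x" if "g \<in> ?G" "x \<in> H" "0 \<le> x" for g x
    using that by (auto simp: minorants_def)
  have dir: "directed ?G"
    unfolding directed_by_def using \<open>0 \<in> ?G\<close> minorants_sup by (metis empty_iff sup_ge1 sup_ge2)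
  have bd: "\<tau> g \<le> f e" if "g \<in> ?G" for g
    using G[OF that A_in_H[OF unit_in_A] unit_nonneg] by (simp add: mult_unit_right)
  have "bdd_above ?G" using dir GL G0 bd by (rule bdd_above_if_exp_bdd)
  then have lub: "lub ?G (Sup ?G)" using \<open>0 \<in> ?G\<close> by (intro lub_Sup) auto
  define s where "s = Sup ?G"
  note lub = lub[folded s_def]
  have s0: "0 \<le> s" using lub \<open>0 \<in> ?G\<close> by (rule lub_upper)
  have "bdd_above (\<tau> ` ?G)" using bd by (intro bdd_aboveI[of _ "f e"]) auto
  then have "s \<in> L" using monotone_convergence(1)[OF dir GL G0 lub] by simp
  let ?S = "(\<lambda>g. g * g) ` ?G"
  have "s * s \<in> L"
  proof (rule monotone_convergence(1)[of ?S])
    show "directed ?S" using G0 by (intro directed_image[OF dir] mult_mono) auto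
    show "?S \<subseteq> L" using GH by (auto intro: H_square)
    show "0 \<le> d" if "d \<in> ?S" for d using that by (auto intro: square_nonneg)
    show "lub ?S (s * s)"
    proof (rule lubI)
      show "d \<le> s * s" if "d \<in> ?S" for d
        using that lub_upper[OF lub] G0 s0 by (auto intro!: mult_mono)
      fix u assume u: "\<And>d. d \<in> ?S \<Longrightarrow> d \<le> u"
      \<comment> \<open>Mixed products are dominated by the square of \<open>sup g g'\<close>, again
        a minorant; afterwards the supremum may be taken in each factor separately.\<close>
      have "g * g' \<le> u" if "g \<in> ?G" "g' \<in> ?G" for g g'
      proof -
        have "g * g' \<le> sup g g' * sup g g'" using that G0 by (intro mult_mono) (auto intro: le_supI1)
        also have "\<dots> \<le> u" using u minorants_sup[OF that] by blast
        finally show ?thesis .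
      qed
      then have gs: "g * s \<le> u" if "g \<in> ?G" for g
        using that by (intro lub_least[OF lub_mult[OF lub G0]]) auto
      show "s * s \<le> u"
        by (rule lub_least[OF lub_mult[OF lub s0]]) (use gs in \<open>auto simp: mult.commute\<close>)
    qed
    \<comment> \<open>A minorant is tested on itself: \<open>\<tau> (g * g) \<le> f g\<close>, while
      the square of \<open>f g\<close> is at most \<open>K * \<tau> (g * g)\<close>. One factor
      cancels.\<close>
    have "\<tau> (g * g) \<le> K" if "g \<in> ?G" for g
    proof (rule le_if_square_le_mult[OF sq_nonneg K_nonneg])
      show gH: "g \<in> H" using that GH by auto
      have "\<tau> (g * g) \<le> f g" using that gH G0 by (intro G)
      then have "\<tau> (g * g) * \<tau> (g * g) \<le> f g * f g"
        using sq_nonneg[OF gH] by (intro mult_mono) (auto intro: order_trans)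
      also have "\<dots> \<le> K * \<tau> (g * g)" using gH that G0 by (intro f_bound)
      finally show "\<tau> (g * g) * \<tau> (g * g) \<le> K * \<tau> (g * g)" .
    qed
    then show "bdd_above (\<tau> ` ?S)" by (intro bdd_aboveI[of _ K]) auto
  qed
  with \<open>s \<in> L\<close> have "s \<in> H" by (simp add: L2_def)
  have "\<tau> (s * x) \<le> f x" if x: "x \<in> H" "0 \<le> x" for x
  proof -
    let ?D = "(*) x ` ?G"
    have d: "directed ?D" using x by (intro directed_image[OF dir] mult_left_mono)
    have "?D \<subseteq> L" using x GH by (auto intro: H_mult_in_L)
    moreover have "0 \<le> d" if "d \<in> ?D" for d using that x G0 by auto
    moreover have le: "t \<le> f x" if "t \<in> \<tau> ` ?D" for t using that G x by (auto simp: mult.commute)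
    moreover from le have "bdd_above (\<tau> ` ?D)" by (rule bdd_aboveI)
    ultimately have "lub (\<tau> ` ?D) (\<tau> (x * s))"
      using monotone_convergence(2)[OF d _ _ lub_mult[OF lub x(2)]] by auto
    then show ?thesis using le by (simp add: mult.commute lub_least)
  qed
  with \<open>s \<in> H\<close> s0 lub show ?thesis by (auto simp: minorants_def)
qed

lemma representation: "\<exists>g\<in>H. 0 \<le> g \<and> (\<forall>x\<in>H. 0 \<le> x \<longrightarrow> f x = \<tau> (g * x))"
proof -
  obtain s where s: "s \<in> minorants" "lub minorants s" using minorants_lub by blast
  have sH: "s \<in> H" "0 \<le> s" and s_le: "\<And>x. x \<in> H \<Longrightarrow> 0 \<le> x \<Longrightarrow> \<tau> (s * x) \<le> f x"
    using s(1) by (auto simp: minorants_def)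
  define h where "h x = f x - \<tau> (s * x)" for x
  have h0: "0 \<le> h x" if "x \<in> H" "0 \<le> x" for x using s_le that by (simp add: h_def)
  have h_le: "h x \<le> f x" if "x \<in> H" "0 \<le> x" for x
    using that sH by (simp add: h_def exp_nonneg H_mult_in_L)
  \<comment> \<open>Since \<open>h\<close> lies between 0 and \<open>f\<close>, the same
    \<open>K\<close> bounds it. If \<open>h e\<close> were nonzero, \<open>dominates_density\<close>
    for \<open>h\<close> would give a density to add to the largest minorant
    \<open>s\<close>.\<close>
  interpret h: positive_functional E e T h K
  proof unfold_locales
    fix x y assume xy: "x \<in> H" "y \<in> H" "0 \<le> x" "0 \<le> y"
    then show "h (x + y) = h x + h y"
      using sH by (simp add: h_def f_add distrib_left L_add H_mult_in_L)
  next
    fix a x assume a: "a \<in> A" "0 \<le> a" "x \<in> H" "0 \<le> x"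
    have "\<tau> (s * (a * x)) = a * \<tau> (s * x)"
      using averaging(2)[OF a(1) H_mult_in_L[OF sH(1) a(3)]] by (simp add: mult_ac)
    with a show "h (a * x) = a * h x" by (simp add: h_def f_A right_diff_distrib)
  next
    fix x assume x: "x \<in> H" "0 \<le> x"
    then show "h x \<in> A" using sH by (simp add: h_def A_diff f_in_A exp_in_A H_mult_in_L)
    show "0 \<le> h x" using x by (rule h0)
    have "h x * h x \<le> f x * f x" using h0[OF x] h_le[OF x] by (intro mult_mono) (auto intro: order_trans)
    also have "\<dots> \<le> K * \<tau> (x * x)" using x by (rule f_bound)
    finally show "h x * h x \<le> K * \<tau> (x * x)" .
  qed (rule K_nonneg)
  have "h e = 0"
  proof (rule ccontr)
    assume "h e \<noteq> 0"
    then obtain w where w: "w \<in> H" "0 \<le> w" "w \<noteq> 0" "\<And>x. x \<in> H \<Longrightarrow> 0 \<le> x \<Longrightarrow> \<tau> (w * x) \<le> h x"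
      using h.dominates_density by blast
    have "\<tau> ((s + w) * x) \<le> f x" if x: "x \<in> H" "0 \<le> x" for x
      using w(4)[OF x] sH w(1) x by (simp add: h_def distrib_right L_add H_mult_in_L algebra_simps)
    then have "s + w \<in> minorants" using sH w by (simp add: minorants_def H_add)
    then have "s + w \<le> s" by (rule lub_upper[OF s(2)])
    with w show False by simp
  qed
  \<comment> \<open>From \<open>h e = 0\<close>, \<open>h\<close> vanishes below every multiple of
    \<open>e\<close>, in particular on the truncations of \<open>x\<close>, and order continuity
    passes to \<open>x\<close>.\<close>
  have "h x = 0" if x: "x \<in> H" "0 \<le> x" for x
  proof (rule order.antisym)
    let ?D = "range (\<lambda>n. inf x (real n *\<^sub>R e))"
    have ne: "real n *\<^sub>R e \<in> H" "0 \<le> real n *\<^sub>R e" for n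
      by (auto intro: H_scale A_in_H unit_in_A scaleR_nonneg_nonneg unit_nonneg)
    have DH: "?D \<subseteq> H" using x ne by (auto intro: H_solid_nonneg[of x])
    show "h x \<le> 0"
    proof (rule h.f_lub[OF directed_trunc DH _ lub_trunc[OF x(2)] x(1)])
      fix d assume d: "d \<in> ?D"
      then obtain n where n: "d = inf x (real n *\<^sub>R e)" by auto
      show "0 \<le> d" using x ne by (simp add: n)
      have "h d \<le> h (real n *\<^sub>R e)" using d DH x ne by (intro h.f_mono) (auto simp: n)
      also have "\<dots> = 0" using \<open>h e = 0\<close> by (simp add: h.f_scale A_in_H unit_in_A unit_nonneg)
      finally show "h d \<le> 0" .
    qed
  qed (use h0 x in auto)
  with sH show ?thesis by (auto simp: h_def)
qed

end

section \<open>\<open>T\<close>-strongly bounded operators and their adjoints\<close>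

context riesz_conditional_expectation
begin

abbreviation "B \<equiv> B_T E T"
abbreviation "Bpos \<equiv> B_T_pos E T"
abbreviation "Breg \<equiv> B_T_reg E T"
abbreviation "adj \<equiv> adjoint_T E T"
abbreviation ople (infix "\<sqsubseteq>" 50) where "ople \<equiv> op_le E T"

section \<open>Strongly bounded and regular operators as ordered vector spaces\<close>

lemma BI:
  assumes "\<And>x. x \<notin> H \<Longrightarrow> S x = 0" "\<And>x. x \<in> H \<Longrightarrow> S x \<in> H"
    and "\<And>x y. x \<in> H \<Longrightarrow> y \<in> H \<Longrightarrow> S (x + y) = S x + S y"
    and "\<And>a x. a \<in> A \<Longrightarrow> x \<in> H \<Longrightarrow> S (a * x) = a * S x"
    and "k \<in> A" "0 \<le> k" "\<And>x. x \<in> H \<Longrightarrow> \<tau> (S x * S x) \<le> (k * k) * \<tau> (x * x)"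
  shows "S \<in> B"
  using assms unfolding B_T_def by (auto simp: T_norm_le_iff intro!: bexI[of _ k])

lemma
  assumes "S \<in> B"
  shows B_outside: "x \<notin> H \<Longrightarrow> S x = 0"
    and B_in_H: "x \<in> H \<Longrightarrow> S x \<in> H"
    and B_add: "x \<in> H \<Longrightarrow> y \<in> H \<Longrightarrow> S (x + y) = S x + S y"
    and B_A: "a \<in> A \<Longrightarrow> x \<in> H \<Longrightarrow> S (a * x) = a * S x"
  using assms unfolding B_T_def by auto

lemma B_bound:
  assumes "S \<in> B"
  obtains k where "k \<in> A" "0 \<le> k" "\<And>x. x \<in> H \<Longrightarrow> \<tau> (S x * S x) \<le> (k * k) * \<tau> (x * x)"
proof -
  obtain k where k: "k \<in> A" "0 \<le> k" "\<And>x. x \<in> H \<Longrightarrow> T_norm E T (S x) \<le> k * T_norm E T x"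
    using assms unfolding B_T_def by auto
  show ?thesis
    by (rule that[OF k(1,2)]) (use k B_in_H[OF assms] in \<open>simp flip: T_norm_le_iff\<close>)
qed

lemma B_scale: assumes "S \<in> B" "x \<in> H" shows "S (c *\<^sub>R x) = c *\<^sub>R S x"
  using B_A[OF assms(1) A_scale[OF unit_in_A] assms(2), of c] by (simp add: mult_unit)

lemma B_minus: assumes "S \<in> B" "x \<in> H" shows "S (- x) = - S x"
  using B_scale[OF assms, of "-1"] by simp

lemma B_diff: assumes "S \<in> B" "x \<in> H" "y \<in> H" shows "S (x - y) = S x - S y"
  using B_add[OF assms(1,2) H_minus[OF assms(3)]] B_minus[OF assms(1,3)] by simp

lemma B_zero: assumes "S \<in> B" shows "S 0 = 0"
  using B_diff[OF assms H_zero H_zero] by simp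

lemma B_pprt: assumes "S \<in> B" "x \<in> H" shows "S x = S (pprt x) - S (pprt (- x))"
  using B_diff[OF assms(1) H_pprt[OF assms(2)] H_pprt[OF H_minus[OF assms(2)]]]
  by (simp add: pprt_minus)

lemma B_eqI:
  assumes "S \<in> B" "R \<in> B" "\<And>x. x \<in> H \<Longrightarrow> 0 \<le> x \<Longrightarrow> S x = R x" shows "S = R"
proof
  fix x show "S x = R x"
  proof (cases "x \<in> H")
    case True
    then have "pprt x \<in> H" "pprt (- x) \<in> H" by (auto intro: H_pprt H_minus)
    then have "S (pprt x) = R (pprt x)" "S (pprt (- x)) = R (pprt (- x))" by (auto intro: assms(3))
    then show ?thesis using B_pprt[OF assms(1) True] B_pprt[OF assms(2) True] by simp
  next
    case False
    then show ?thesis using B_outside[OF assms(1)] B_outside[OF assms(2)] by simp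
  qed
qed

lemma exp_square_add_le:
  assumes "u \<in> H" "v \<in> H" shows "\<tau> ((u + v) * (u + v)) \<le> 2 *\<^sub>R (\<tau> (u * u) + \<tau> (v * v))"
proof -
  note L = H_square[OF assms(1)] H_square[OF assms(2)] H_square[OF H_add[OF assms]]
  have "(u + v) * (u + v) = u * u + v * v + 2 *\<^sub>R (u * v)" by (simp add: algebra_simps scaleR_2)
  also have "\<dots> \<le> (u * u + v * v) + (u * u + v * v)" by (intro add_left_mono two_mult_le)
  finally have "(u + v) * (u + v) \<le> 2 *\<^sub>R (u * u + v * v)" by (simp add: scaleR_2)
  then have "\<tau> ((u + v) * (u + v)) \<le> \<tau> (2 *\<^sub>R (u * u + v * v))"
    using L by (intro exp_mono L_scale L_add)
  then show ?thesis using L by (simp add: L_scale L_add)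
qed

lemma B_plus: assumes "S \<in> B" "R \<in> B" shows "(\<lambda>x. S x + R x) \<in> B"
proof -
  obtain k where k: "k \<in> A" "0 \<le> k" "\<And>x. x \<in> H \<Longrightarrow> \<tau> (S x * S x) \<le> (k * k) * \<tau> (x * x)"
    using assms(1) by (rule B_bound) blast
  obtain l where l: "l \<in> A" "0 \<le> l" "\<And>x. x \<in> H \<Longrightarrow> \<tau> (R x * R x) \<le> (l * l) * \<tau> (x * x)"
    using assms(2) by (rule B_bound) blast
  show ?thesis
  \<comment> \<open>The square estimate produces the factor
    \<open>2 *\<^sub>R (k * k + l * l)\<close>; the bound is any convenient element of A whose
    square dominates it.\<close>
  proof (rule BI[where k = "2 *\<^sub>R (k + l)"])
    fix x assume x: "x \<in> H"
    have "\<tau> ((S x + R x) * (S x + R x)) \<le> 2 *\<^sub>R (\<tau> (S x * S x) + \<tau> (R x * R x))"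
      using B_in_H[OF assms(1) x] B_in_H[OF assms(2) x] by (rule exp_square_add_le)
    also have "\<dots> \<le> 2 *\<^sub>R ((k * k) * \<tau> (x * x) + (l * l) * \<tau> (x * x))"
      using k l x by (intro scaleR_left_mono add_mono) auto
    also have "\<dots> = (2 *\<^sub>R (k * k + l * l)) * \<tau> (x * x)"
      by (simp add: algebra_simps)
    also have "\<dots> \<le> ((2 *\<^sub>R (k + l)) * (2 *\<^sub>R (k + l))) * \<tau> (x * x)"
    proof (rule mult_right_mono[OF _ sq_nonneg[OF x]])
      have "k * k + l * l \<le> (k + l) * (k + l)"
        using mult_nonneg_nonneg[OF k(2) l(2)] by (simp add: algebra_simps)
      then have "2 *\<^sub>R (k * k + l * l) \<le> 2 *\<^sub>R ((k + l) * (k + l))"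
        by (intro scaleR_left_mono) auto
      also have "\<dots> \<le> 4 *\<^sub>R ((k + l) * (k + l))"
        by (intro scaleR_right_mono square_nonneg) auto
      finally show "2 *\<^sub>R (k * k + l * l) \<le> (2 *\<^sub>R (k + l)) * (2 *\<^sub>R (k + l))" by simp
    qed
    finally show "\<tau> ((S x + R x) * (S x + R x)) \<le> ((2 *\<^sub>R (k + l)) * (2 *\<^sub>R (k + l))) * \<tau> (x * x)" .
  qed (use k l assms in \<open>auto simp: B_outside B_in_H B_add B_A H_add A_add A_scale distrib_left
      scaleR_nonneg_nonneg add_ac\<close>)
qed

lemma B_scaleR: assumes "S \<in> B" shows "(\<lambda>x. c *\<^sub>R S x) \<in> B"
proof -
  obtain k where k: "k \<in> A" "0 \<le> k" "\<And>x. x \<in> H \<Longrightarrow> \<tau> (S x * S x) \<le> (k * k) * \<tau> (x * x)"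
    using assms(1) by (rule B_bound) blast
  show ?thesis
  proof (rule BI[where k = "\<bar>c\<bar> *\<^sub>R k"])
    fix x assume x: "x \<in> H"
    have "\<tau> ((c *\<^sub>R S x) * (c *\<^sub>R S x)) = (c * c) *\<^sub>R \<tau> (S x * S x)"
      using H_square[OF B_in_H[OF assms x]] by (simp add: L_scale)
    also have "\<dots> \<le> (c * c) *\<^sub>R ((k * k) * \<tau> (x * x))"
      using k x by (intro scaleR_left_mono) auto
    finally show "\<tau> ((c *\<^sub>R S x) * (c *\<^sub>R S x)) \<le> ((\<bar>c\<bar> *\<^sub>R k) * (\<bar>c\<bar> *\<^sub>R k)) * \<tau> (x * x)"
      by simp
  qed (use k assms in \<open>auto simp: B_outside B_in_H B_add B_A H_scale A_scale scaleR_right_distrib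
      scaleR_nonneg_nonneg\<close>)
qed

lemma B_uminus: "S \<in> B \<Longrightarrow> (\<lambda>x. - S x) \<in> B"
  using B_scaleR[of S "-1"] by simp

lemma B_minus_closed: "S \<in> B \<Longrightarrow> R \<in> B \<Longrightarrow> (\<lambda>x. S x - R x) \<in> B"
  using B_plus[of S "\<lambda>x. - R x"] B_uminus[of R] by simp

lemma Bpos_iff: "S \<in> Bpos \<longleftrightarrow> S \<in> B \<and> (\<forall>x\<in>H. 0 \<le> x \<longrightarrow> 0 \<le> S x)"
  by (simp add: B_T_pos_def order_positive_def)

lemma Bpos_in_B: "S \<in> Bpos \<Longrightarrow> S \<in> B" and Bpos_nonneg: "S \<in> Bpos \<Longrightarrow> x \<in> H \<Longrightarrow> 0 \<le> x \<Longrightarrow> 0 \<le> S x"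
  by (auto simp: Bpos_iff)

lemma Bpos_plus: "S \<in> Bpos \<Longrightarrow> R \<in> Bpos \<Longrightarrow> (\<lambda>x. S x + R x) \<in> Bpos"
  by (auto simp: Bpos_iff B_plus)

lemma Bpos_scaleR: "S \<in> Bpos \<Longrightarrow> 0 \<le> c \<Longrightarrow> (\<lambda>x. c *\<^sub>R S x) \<in> Bpos"
  by (auto simp: Bpos_iff B_scaleR scaleR_nonneg_nonneg)

lemma BregI: "P \<in> Bpos \<Longrightarrow> Q \<in> Bpos \<Longrightarrow> (\<lambda>x. P x - Q x) \<in> Breg"
  by (auto simp: B_T_reg_def)

lemma BregE: assumes "S \<in> Breg" obtains P Q where "P \<in> Bpos" "Q \<in> Bpos" "S = (\<lambda>x. P x - Q x)"
  using assms by (auto simp: B_T_reg_def)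

lemma Bzero: "(\<lambda>x. 0) \<in> Bpos"
  unfolding Bpos_iff by (auto intro!: BI[of _ 0] simp: H_zero A_zero L_zero)

lemma Bpos_in_Breg: "S \<in> Bpos \<Longrightarrow> S \<in> Breg"
  using BregI[OF _ Bzero] by simp

lemma Breg_in_B: "S \<in> Breg \<Longrightarrow> S \<in> B"
  by (auto elim!: BregE intro: B_minus_closed Bpos_in_B)

lemma Breg_plus: assumes "S \<in> Breg" "R \<in> Breg" shows "(\<lambda>x. S x + R x) \<in> Breg"
proof -
  obtain P Q P' Q' where *: "P \<in> Bpos" "Q \<in> Bpos" "S = (\<lambda>x. P x - Q x)"
      "P' \<in> Bpos" "Q' \<in> Bpos" "R = (\<lambda>x. P' x - Q' x)"
    using assms by (auto elim!: BregE)
  then have "(\<lambda>x. S x + R x) = (\<lambda>x. (P x + P' x) - (Q x + Q' x))" by (auto simp: algebra_simps)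
  then show ?thesis using BregI[OF Bpos_plus[OF *(1,4)] Bpos_plus[OF *(2,5)]] by simp
qed

lemma Breg_scaleR: assumes "S \<in> Breg" shows "(\<lambda>x. c *\<^sub>R S x) \<in> Breg"
proof -
  obtain P Q where *: "P \<in> Bpos" "Q \<in> Bpos" "S = (\<lambda>x. P x - Q x)" using assms by (rule BregE)
  show ?thesis
  proof (cases "0 \<le> c")
    case True
    then show ?thesis
      using BregI[OF Bpos_scaleR[OF *(1)] Bpos_scaleR[OF *(2)], of c c] by (simp add: *(3) scaleR_right_diff_distrib)
  next
    case False
    then show ?thesis
      using BregI[OF Bpos_scaleR[OF *(2)] Bpos_scaleR[OF *(1)], of "- c" "- c"]
      by (simp add: *(3) scaleR_right_diff_distrib)
  qed
qed

lemma Breg_uminus: "S \<in> Breg \<Longrightarrow> (\<lambda>x. - S x) \<in> Breg"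
  using Breg_scaleR[of S "-1"] by simp

lemma Breg_minus: "S \<in> Breg \<Longrightarrow> R \<in> Breg \<Longrightarrow> (\<lambda>x. S x - R x) \<in> Breg"
  using Breg_plus[of S "\<lambda>x. - R x"] Breg_uminus[of R] by simp

lemma ople_iff: "R \<sqsubseteq> S \<longleftrightarrow> (\<forall>x\<in>H. 0 \<le> x \<longrightarrow> R x \<le> S x)"
  by (simp add: op_le_def order_positive_def)

lemma ople_antisym: "S \<in> B \<Longrightarrow> R \<in> B \<Longrightarrow> S \<sqsubseteq> R \<Longrightarrow> R \<sqsubseteq> S \<Longrightarrow> S = R"
  by (rule B_eqI) (auto simp: ople_iff intro: order.antisym)

text \<open>A relational form of \<open>adjoint_T\<close>, usable before existence is known;
  \<open>adjointI\<close> connects it to the definite description.\<close>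

definition is_adjoint :: "('u \<Rightarrow> 'u) \<Rightarrow> ('u \<Rightarrow> 'u) \<Rightarrow> bool" where
  "is_adjoint S R \<longleftrightarrow> R \<in> B \<and> (\<forall>x\<in>H. \<forall>y\<in>H. \<tau> (S x * y) = \<tau> (x * R y))"

lemma separating:
  assumes "z \<in> H" "z' \<in> H" "\<And>x. x \<in> H \<Longrightarrow> \<tau> (x * z) = \<tau> (x * z')" shows "z = z'"
proof -
  have z: "z - z' \<in> H" using assms by (intro H_diff)
  have "\<tau> ((z - z') * (z - z')) = \<tau> ((z - z') * z) - \<tau> ((z - z') * z')"
    using z assms(1,2) by (simp add: right_diff_distrib[of "z - z'"] L_diff H_mult_in_L)
  then have "\<tau> ((z - z') * (z - z')) = 0" using assms(3)[OF z] by simp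
  then have "(z - z') * (z - z') = 0" using exp_strict[OF H_square[OF z] square_nonneg] by simp
  then have "z - z' = 0" by (rule square_eq_0)
  then show ?thesis by simp
qed

lemma adjointI: assumes "is_adjoint S R" shows "adj S = R"
  unfolding adjoint_T_def T_inner_def
proof (rule the_equality)
  show "R \<in> B \<and> (\<forall>x\<in>H. \<forall>y\<in>H. \<tau> (S x * y) = \<tau> (x * R y))"
    using assms by (simp add: is_adjoint_def)
  fix R' assume R': "R' \<in> B \<and> (\<forall>x\<in>H. \<forall>y\<in>H. \<tau> (S x * y) = \<tau> (x * R' y))"
  have R: "R \<in> B" "\<And>x y. x \<in> H \<Longrightarrow> y \<in> H \<Longrightarrow> \<tau> (S x * y) = \<tau> (x * R y)"
    using assms by (auto simp: is_adjoint_def)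
  show "R' = R"
  proof (rule B_eqI)
    fix y assume y: "y \<in> H"
    have "R' y \<in> H" "R y \<in> H" using R R' y by (simp_all add: B_in_H)
    moreover have "\<tau> (x * R' y) = \<tau> (x * R y)" if "x \<in> H" for x using R R' y that by metis
    ultimately show "R' y = R y" by (rule separating)
  qed (use R R' in auto)
qed

lemma is_adjoint_pos:
  assumes "S \<in> Bpos" "is_adjoint S R" shows "R \<in> Bpos"
proof -
  have "0 \<le> R y" if y: "y \<in> H" "0 \<le> y" for y
  proof -
    have R: "R y \<in> H" using assms(2) y by (auto simp: is_adjoint_def B_in_H)
    let ?x = "pprt (- R y)"
    have x: "?x \<in> H" using R by (intro H_pprt H_minus)
    have "0 \<le> \<tau> (S ?x * y)"
      using x y B_in_H[OF Bpos_in_B[OF assms(1)] x] Bpos_nonneg[OF assms(1) x zero_le_pprt]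
      by (intro exp_nonneg H_mult_in_L mult_nonneg_nonneg)
    also have "\<dots> = \<tau> (?x * R y)" using assms(2) x y by (auto simp: is_adjoint_def)
    also have "?x * R y = - (?x * ?x)" using mult_pprt[of "- R y"] by (metis minus_mult_left minus_minus mult.commute)
    also have "\<tau> (- (?x * ?x)) = - \<tau> (?x * ?x)" using x by (intro L_minus H_square)
    finally have "\<tau> (?x * ?x) = 0" using sq_nonneg[OF x] by simp
    then have "?x * ?x = 0" using exp_strict[OF H_square[OF x] square_nonneg] by simp
    then have "?x = 0" by (rule square_eq_0)
    then have "- R y \<le> 0" unfolding le_zero_iff_zero_pprt .
    then show ?thesis by simp
  qed
  then show ?thesis using assms(2) by (simp add: Bpos_iff is_adjoint_def)
qed

text \<open>For \<open>y \<ge> 0\<close> Cauchy--Schwarz shows that \<open>\<tau> (P x * y)\<close>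
  is a positive functional of \<open>x\<close> with \<open>K = (k * k) * \<tau> (y * y)\<close>.
  General \<open>x\<close> and \<open>y\<close> are split into positive and negative parts.\<close>

lemma representation_pos_operator:
  assumes P: "P \<in> Bpos" and y: "y \<in> H"
  shows "\<exists>g\<in>H. \<forall>x\<in>H. \<tau> (P x * y) = \<tau> (x * g)"
proof -
  have PB: "P \<in> B" using P by (rule Bpos_in_B)
  obtain k where k: "k \<in> A" "0 \<le> k" "\<And>x. x \<in> H \<Longrightarrow> \<tau> (P x * P x) \<le> (k * k) * \<tau> (x * x)"
    using PB by (rule B_bound) blast
  note PH = B_in_H[OF PB]
  have *: "\<exists>g\<in>H. \<forall>x\<in>H. 0 \<le> x \<longrightarrow> \<tau> (P x * y) = \<tau> (g * x)" if y: "y \<in> H" "0 \<le> y" for y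
  proof -
    interpret positive_functional E e T "\<lambda>x. \<tau> (P x * y)" "(k * k) * \<tau> (y * y)"
    proof unfold_locales
      fix x assume x: "x \<in> H" "0 \<le> x"
      show "\<tau> (P x * y) \<in> A" "0 \<le> \<tau> (P x * y)"
        using x y PH by (auto intro!: exp_in_A exp_nonneg H_mult_in_L mult_nonneg_nonneg Bpos_nonneg[OF P])
      have "\<tau> (P x * y) * \<tau> (P x * y) \<le> \<tau> (P x * P x) * \<tau> (y * y)"
        using x y PH by (intro cauchy_schwarz)
      also have "\<dots> \<le> ((k * k) * \<tau> (x * x)) * \<tau> (y * y)"
        using k x y by (intro mult_right_mono sq_nonneg)
      finally show "\<tau> (P x * y) * \<tau> (P x * y) \<le> (k * k) * \<tau> (y * y) * \<tau> (x * x)"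
        by (simp add: mult_ac)
    next
      fix x z assume xz: "x \<in> H" "z \<in> H"
      then show "\<tau> (P (x + z) * y) = \<tau> (P x * y) + \<tau> (P z * y)"
        using y PH by (simp add: B_add[OF PB] distrib_right L_add H_mult_in_L)
    next
      fix a x assume "a \<in> A" "x \<in> H"
      then show "\<tau> (P (a * x) * y) = a * \<tau> (P x * y)"
        using y PH by (simp add: B_A[OF PB] averaging H_mult_in_L mult.assoc)
    next
      show "0 \<le> (k * k) * \<tau> (y * y)" using k y by (intro mult_nonneg_nonneg sq_nonneg)
    qed
    show ?thesis using representation by blast
  qed
  have **: "\<exists>g\<in>H. \<forall>x\<in>H. \<tau> (P x * y) = \<tau> (x * g)" if y: "y \<in> H" "0 \<le> y" for y
  proof -
    obtain g where g: "g \<in> H" "\<And>x. x \<in> H \<Longrightarrow> 0 \<le> x \<Longrightarrow> \<tau> (P x * y) = \<tau> (g * x)"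
      using *[OF y] by blast
    have "\<tau> (P x * y) = \<tau> (x * g)" if x: "x \<in> H" for x
    proof -
      have p: "pprt x \<in> H" "pprt (- x) \<in> H" using x by (auto intro: H_pprt H_minus)
      have "\<tau> (P x * y) = \<tau> (P (pprt x) * y) - \<tau> (P (pprt (- x)) * y)"
        using p y PH by (simp add: B_pprt[OF PB x] left_diff_distrib L_diff H_mult_in_L)
      also have "\<dots> = \<tau> (g * (pprt x - pprt (- x)))"
        using p g by (simp add: right_diff_distrib L_diff H_mult_in_L)
      finally show ?thesis by (simp add: pprt_minus mult.commute)
    qed
    with g show ?thesis by blast
  qed
  obtain g where g: "g \<in> H" "\<And>x. x \<in> H \<Longrightarrow> \<tau> (P x * pprt y) = \<tau> (x * g)"
    using **[OF H_pprt[OF y]] by auto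
  obtain h where h: "h \<in> H" "\<And>x. x \<in> H \<Longrightarrow> \<tau> (P x * pprt (- y)) = \<tau> (x * h)"
    using **[OF H_pprt[OF H_minus[OF y]]] by auto
  have "\<tau> (P x * y) = \<tau> (x * (g - h))" if x: "x \<in> H" for x
  proof -
    have "\<tau> (P x * (pprt y - pprt (- y))) = \<tau> (P x * pprt y) - \<tau> (P x * pprt (- y))"
      using x y PH by (simp add: right_diff_distrib L_diff H_mult_in_L H_pprt H_minus)
    also have "\<dots> = \<tau> (x * (g - h))"
      using x g h by (simp add: right_diff_distrib L_diff H_mult_in_L)
    finally show ?thesis by (simp add: pprt_minus)
  qed
  then show ?thesis using g h by (intro bexI[of _ "g - h"]) (auto intro: H_diff)
qed

lemma adjoint_pos_exists:
  assumes P: "P \<in> Bpos" shows "\<exists>R. is_adjoint P R"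
proof -
  have PB: "P \<in> B" using P by (rule Bpos_in_B)
  obtain k where k: "k \<in> A" "0 \<le> k" "\<And>x. x \<in> H \<Longrightarrow> \<tau> (P x * P x) \<le> (k * k) * \<tau> (x * x)"
    using PB by (rule B_bound) blast
  obtain g where g: "\<And>y. y \<in> H \<Longrightarrow> g y \<in> H \<and> (\<forall>x\<in>H. \<tau> (P x * y) = \<tau> (x * g y))"
    using representation_pos_operator[OF P] by metis
  define R where "R y = (if y \<in> H then g y else 0)" for y
  have R: "R y \<in> H" "\<And>x. x \<in> H \<Longrightarrow> \<tau> (x * R y) = \<tau> (P x * y)" if "y \<in> H" for y
    using g[OF that] that by (auto simp: R_def)
  note PH = B_in_H[OF PB]
  have "R \<in> B"
  proof (rule BI[OF _ _ _ _ k(1,2)])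
    show "R x = 0" if "x \<notin> H" for x using that by (simp add: R_def)
    show "R x \<in> H" if "x \<in> H" for x using R that by simp
    show "R (y + z) = R y + R z" if yz: "y \<in> H" "z \<in> H" for y z
    proof (rule separating)
      show "\<tau> (x * R (y + z)) = \<tau> (x * (R y + R z))" if "x \<in> H" for x
        using that yz R PH by (simp add: H_add distrib_left L_add H_mult_in_L)
    qed (use yz R in \<open>auto intro: H_add\<close>)
    show "R (a * y) = a * R y" if ay: "a \<in> A" "y \<in> H" for a y
    proof (rule separating)
      show "\<tau> (x * R (a * y)) = \<tau> (x * (a * R y))" if "x \<in> H" for x
      proof -
        have "\<tau> (x * (a * R y)) = a * \<tau> (x * R y)"
          using averaging(2)[OF ay(1) H_mult_in_L[OF that R(1)[OF ay(2)]]] by (simp add: mult_ac)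
        also have "\<dots> = a * \<tau> (P x * y)" using that ay R by simp
        also have "\<dots> = \<tau> (P x * (a * y))"
          using averaging(2)[OF ay(1) H_mult_in_L[OF PH[OF that] ay(2)]] by (simp add: mult_ac)
        also have "\<dots> = \<tau> (x * R (a * y))" using that ay R by (simp add: H_A_mult)
        finally show ?thesis by simp
      qed
    qed (use ay R in \<open>auto intro: H_A_mult\<close>)
    \<comment> \<open>Testing the adjoint relation at \<open>x = R y\<close> and applying
      Cauchy--Schwarz gives an inequality with \<open>\<tau> (R y * R y)\<close> on both sides;
      cancelling one factor shows that \<open>P\<close> and its adjoint share the bound
      \<open>k\<close>.\<close>
    show "\<tau> (R y * R y) \<le> (k * k) * \<tau> (y * y)" if y: "y \<in> H" for y
    proof (rule le_if_square_le_mult)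
      have Ry: "R y \<in> H" using R y by simp
      have "\<tau> (R y * R y) * \<tau> (R y * R y) = \<tau> (P (R y) * y) * \<tau> (P (R y) * y)"
        using R y by simp
      also have "\<dots> \<le> \<tau> (P (R y) * P (R y)) * \<tau> (y * y)"
        using Ry y PH by (intro cauchy_schwarz)
      also have "\<dots> \<le> ((k * k) * \<tau> (R y * R y)) * \<tau> (y * y)"
        using k Ry y by (intro mult_right_mono sq_nonneg)
      finally show "\<tau> (R y * R y) * \<tau> (R y * R y) \<le> (k * k) * \<tau> (y * y) * \<tau> (R y * R y)"
        by (simp add: mult_ac)
      show "0 \<le> \<tau> (R y * R y)" using Ry by (rule sq_nonneg)
      show "0 \<le> (k * k) * \<tau> (y * y)" using k y by (intro mult_nonneg_nonneg sq_nonneg)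
    qed
  qed
  then show ?thesis using R by (auto simp: is_adjoint_def)
qed

section \<open>The adjoint as an order isomorphism of the regular operators\<close>

lemma is_adjoint_minus:
  assumes "is_adjoint S S'" "is_adjoint R R'" "S \<in> B" "R \<in> B"
  shows "is_adjoint (\<lambda>x. S x - R x) (\<lambda>x. S' x - R' x)"
  using assms by (simp add: is_adjoint_def B_minus_closed left_diff_distrib right_diff_distrib L_diff
      H_mult_in_L B_in_H)

lemma is_adjoint_scaleR:
  assumes "is_adjoint S S'" "S \<in> B" shows "is_adjoint (\<lambda>x. c *\<^sub>R S x) (\<lambda>x. c *\<^sub>R S' x)"
  using assms by (simp add: is_adjoint_def B_scaleR L_scale H_mult_in_L B_in_H)

lemma is_adjoint_plus:
  assumes "is_adjoint S S'" "is_adjoint R R'" "S \<in> B" "R \<in> B"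
  shows "is_adjoint (\<lambda>x. S x + R x) (\<lambda>x. S' x + R' x)"
  using assms by (simp add: is_adjoint_def B_plus distrib_left distrib_right L_add
      H_mult_in_L B_in_H)

lemma adjoint_reg: assumes "S \<in> Breg" shows "adj S \<in> Breg" "is_adjoint S (adj S)"
proof -
  obtain P Q where *: "P \<in> Bpos" "Q \<in> Bpos" "S = (\<lambda>x. P x - Q x)" using assms by (rule BregE)
  obtain P' Q' where P': "is_adjoint P P'" and Q': "is_adjoint Q Q'"
    using adjoint_pos_exists * by blast
  have adj: "is_adjoint S (\<lambda>x. P' x - Q' x)"
    unfolding *(3) using P' Q' * by (intro is_adjoint_minus Bpos_in_B)
  then show "is_adjoint S (adj S)" using adjointI by simp
  show "adj S \<in> Breg"
    unfolding adjointI[OF adj] using is_adjoint_pos * P' Q' by (intro BregI)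
qed

lemma adjoint_adjoint: assumes "S \<in> Breg" shows "adj (adj S) = S"
proof (rule adjointI)
  have "S \<in> B" using assms by (rule Breg_in_B)
  moreover have "\<tau> (adj S x * y) = \<tau> (x * S y)" if "x \<in> H" "y \<in> H" for x y
    using adjoint_reg(2)[OF assms] that by (simp add: is_adjoint_def mult.commute)
  ultimately show "is_adjoint (adj S) S" by (simp add: is_adjoint_def)
qed

lemma adjoint_plus:
  "S \<in> Breg \<Longrightarrow> R \<in> Breg \<Longrightarrow> adj (\<lambda>x. S x + R x) = (\<lambda>x. adj S x + adj R x)"
  by (intro adjointI is_adjoint_plus adjoint_reg Breg_in_B)

lemma adjoint_minus:
  "S \<in> Breg \<Longrightarrow> R \<in> Breg \<Longrightarrow> adj (\<lambda>x. S x - R x) = (\<lambda>x. adj S x - adj R x)"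
  by (intro adjointI is_adjoint_minus adjoint_reg Breg_in_B)

lemma adjoint_scaleR: "S \<in> Breg \<Longrightarrow> adj (\<lambda>x. c *\<^sub>R S x) = (\<lambda>x. c *\<^sub>R adj S x)"
  by (intro adjointI is_adjoint_scaleR adjoint_reg Breg_in_B)

lemma adjoint_bij: "bij_betw adj Breg Breg"
  by (rule bij_betw_byWitness[of _ adj]) (auto simp: adjoint_adjoint adjoint_reg)

lemma adjoint_pos: "S \<in> Bpos \<Longrightarrow> adj S \<in> Bpos"
  using is_adjoint_pos adjoint_reg(2)[OF Bpos_in_Breg] by blast

lemma ople_pos_iff: "S \<in> Breg \<Longrightarrow> R \<in> Breg \<Longrightarrow> S \<sqsubseteq> R \<longleftrightarrow> (\<lambda>x. R x - S x) \<in> Bpos"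
  by (auto simp: ople_iff Bpos_iff intro: B_minus_closed Breg_in_B)

lemma adjoint_mono: "S \<in> Breg \<Longrightarrow> R \<in> Breg \<Longrightarrow> S \<sqsubseteq> R \<Longrightarrow> adj S \<sqsubseteq> adj R"
  using adjoint_pos[of "\<lambda>x. R x - S x"] by (simp add: ople_pos_iff adjoint_minus adjoint_reg)

lemma adjoint_le_iff: "S \<in> Breg \<Longrightarrow> R \<in> Breg \<Longrightarrow> S \<sqsubseteq> R \<longleftrightarrow> adj S \<sqsubseteq> adj R"
  using adjoint_mono[of S R] adjoint_mono[of "adj S" "adj R"] by (auto simp: adjoint_adjoint adjoint_reg)

lemma adjoint_lub:
  assumes "X \<subseteq> Breg" "is_lub_on ople Breg X S"
  shows "is_lub_on ople Breg (adj ` X) (adj S)"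
  unfolding is_lub_on_def
proof (intro conjI ballI impI)
  have S: "S \<in> Breg" "\<And>R. R \<in> X \<Longrightarrow> R \<sqsubseteq> S" "\<And>U. U \<in> Breg \<Longrightarrow> \<forall>R\<in>X. R \<sqsubseteq> U \<Longrightarrow> S \<sqsubseteq> U"
    using assms(2) by (auto simp: is_lub_on_def)
  show "adj S \<in> Breg" using S by (intro adjoint_reg)
  show "R \<sqsubseteq> adj S" if "R \<in> adj ` X" for R using that S assms(1) by (auto intro: adjoint_mono)
  fix U assume U: "U \<in> Breg" "\<forall>R\<in>adj ` X. R \<sqsubseteq> U"
  have "R \<sqsubseteq> adj U" if "R \<in> X" for R
    using U that assms(1) adjoint_mono[of "adj R" U] by (auto simp: adjoint_adjoint adjoint_reg subset_eq)
  then have "S \<sqsubseteq> adj U" using U by (intro S) (auto intro: adjoint_reg)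
  then show "adj S \<sqsubseteq> U" using adjoint_mono[of S "adj U"] U S by (simp add: adjoint_adjoint adjoint_reg)
qed

lemma adjoint_glb:
  assumes "X \<subseteq> Breg" "is_glb_on ople Breg X S"
  shows "is_glb_on ople Breg (adj ` X) (adj S)"
  unfolding is_glb_on_def
proof (intro conjI ballI impI)
  have S: "S \<in> Breg" "\<And>R. R \<in> X \<Longrightarrow> S \<sqsubseteq> R" "\<And>U. U \<in> Breg \<Longrightarrow> \<forall>R\<in>X. U \<sqsubseteq> R \<Longrightarrow> U \<sqsubseteq> S"
    using assms(2) by (auto simp: is_glb_on_def)
  show "adj S \<in> Breg" using S by (intro adjoint_reg)
  show "adj S \<sqsubseteq> R" if "R \<in> adj ` X" for R using that S assms(1) by (auto intro: adjoint_mono)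
  fix U assume U: "U \<in> Breg" "\<forall>R\<in>adj ` X. U \<sqsubseteq> R"
  have "adj U \<sqsubseteq> R" if "R \<in> X" for R
    using U that assms(1) adjoint_mono[of U "adj R"] by (auto simp: adjoint_adjoint adjoint_reg subset_eq)
  then have "adj U \<sqsubseteq> S" using U by (intro S) (auto intro: adjoint_reg)
  then show "U \<sqsubseteq> adj S" using adjoint_mono[of "adj U" S] U S by (simp add: adjoint_adjoint adjoint_reg)
qed

end

section \<open>Suprema of regular operators\<close>

context riesz_conditional_expectation
begin

text \<open>A map on \<open>H\<^sub>+\<close> that is additive and only \<open>A\<close>-superhomogeneous is automatically
  \<open>A\<close>-homogeneous: for \<open>0 \<le> a \<le> c e\<close> compare \<open>a\<close> with \<open>c e - a\<close>.\<close>

lemma homogeneous_if_superhomogeneous: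
  assumes s_add: "\<And>x y. x \<in> H \<Longrightarrow> y \<in> H \<Longrightarrow> 0 \<le> x \<Longrightarrow> 0 \<le> y \<Longrightarrow> s (x + y) = s x + s y"
    and s_A: "\<And>a x. a \<in> A \<Longrightarrow> 0 \<le> a \<Longrightarrow> x \<in> H \<Longrightarrow> 0 \<le> x \<Longrightarrow> a * s x \<le> s (a * x)"
    and a: "a \<in> A" "0 \<le> a" and x: "x \<in> H" "0 \<le> x"
  shows "s (a * x) = a * s x"
proof -
  have s_real: "s (c *\<^sub>R x) = c *\<^sub>R s x" if "0 < c" for c
  proof (rule order.antisym)
    have *: "d *\<^sub>R s y \<le> s (d *\<^sub>R y)" if "0 < d" "y \<in> H" "0 \<le> y" for d y
      using s_A[of "d *\<^sub>R e" y] that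
      by (simp add: A_scale unit_in_A mult_unit scaleR_nonneg_nonneg unit_nonneg)
    show "c *\<^sub>R s x \<le> s (c *\<^sub>R x)" using * that x by blast
    have "(1 / c) *\<^sub>R s (c *\<^sub>R x) \<le> s x"
      using *[of "1 / c" "c *\<^sub>R x"] that x by (simp add: H_scale scaleR_nonneg_nonneg)
    then have "c *\<^sub>R (1 / c) *\<^sub>R s (c *\<^sub>R x) \<le> c *\<^sub>R s x" using that by (intro scaleR_left_mono) auto
    then show "s (c *\<^sub>R x) \<le> c *\<^sub>R s x" using that by simp
  qed
  have bounded: "s (a * x) = a * s x" if a: "a \<in> A" "0 \<le> a" and c: "0 < c" "a \<le> c *\<^sub>R e" for a c
  proof (rule order.antisym)
    let ?b = "c *\<^sub>R e - a"
    have b: "?b \<in> A" "0 \<le> ?b" using a c by (auto intro: A_diff A_scale unit_in_A)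
    have "s (a * x) + s (?b * x) = s (a * x + ?b * x)"
      using a b x by (intro s_add[symmetric] H_A_mult mult_nonneg_nonneg)
    also have "a * x + ?b * x = c *\<^sub>R x" by (simp add: algebra_simps mult_unit)
    also have "s (c *\<^sub>R x) = c *\<^sub>R s x" using c by (intro s_real)
    also have "c *\<^sub>R s x = a * s x + ?b * s x" by (simp add: algebra_simps mult_unit)
    finally have "s (a * x) - a * s x = ?b * s x - s (?b * x)" by (simp add: algebra_simps)
    also have "\<dots> \<le> 0" using s_A[OF b x] by simp
    finally show "s (a * x) \<le> a * s x" by simp
  qed (rule s_A[OF a x])
  have "pprt (real (Suc n) *\<^sub>R e - a) * (s (a * x) - a * s x) = 0" for n
  proof -
    let ?m = "real (Suc n)"
    \<comment> \<open>For unbounded \<open>a\<close>, the cutoff makes \<open>c * a\<close> bounded,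
      so the bounded case applies to it; \<open>unit_approx\<close> then removes
      \<open>c\<close>.\<close>
    define c where "c = pprt (?m *\<^sub>R e - a)"
    have cA: "c \<in> A" "0 \<le> c"
      unfolding c_def using a by (auto intro: A_pprt A_diff A_scale unit_in_A)
    have c_le: "c \<le> ?m *\<^sub>R e"
      unfolding c_def pprt_def using a by (intro sup_least) (auto simp: scaleR_nonneg_nonneg unit_nonneg)
    have "c * a \<le> ?m *\<^sub>R c" unfolding c_def by (rule pprt_unit_mult_le)
    also have "\<dots> \<le> ?m *\<^sub>R ?m *\<^sub>R e" using c_le by (intro scaleR_left_mono) auto
    finally have ca: "c * a \<le> (?m * ?m) *\<^sub>R e" by simp
    have "c * s (a * x) \<le> s (c * (a * x))"
      using cA a x by (intro s_A H_A_mult mult_nonneg_nonneg)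
    also have "c * (a * x) = (c * a) * x" by (simp add: mult.assoc)
    also have "s ((c * a) * x) = (c * a) * s x"
      using cA a ca by (intro bounded[of _ "?m * ?m"] A_mult mult_nonneg_nonneg) auto
    finally have "c * (s (a * x) - a * s x) \<le> 0" by (simp add: right_diff_distrib mult.assoc)
    moreover have "0 \<le> c * (s (a * x) - a * s x)"
      using cA s_A[OF a x] by (intro mult_nonneg_nonneg) auto
    ultimately show ?thesis unfolding c_def by (rule order.antisym)
  qed
  then have "s (a * x) - a * s x = 0"
    using s_A[OF a x] by (intro unit_approx[of "s (a * x) - a * s x" a]) auto
  then show ?thesis by simp
qed

text \<open>Superhomogeneity is what a supremum inherits directly; equality follows from
  \<open>homogeneous_if_superhomogeneous\<close>. The majorant \<open>W\<close> keeps the values in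
  the ideal L2 and passes its bound \<open>k\<close> on to the extension.\<close>

lemma positive_extension:
  assumes s_add: "\<And>x y. x \<in> H \<Longrightarrow> y \<in> H \<Longrightarrow> 0 \<le> x \<Longrightarrow> 0 \<le> y \<Longrightarrow> s (x + y) = s x + s y"
    and s_A: "\<And>a x. a \<in> A \<Longrightarrow> 0 \<le> a \<Longrightarrow> x \<in> H \<Longrightarrow> 0 \<le> x \<Longrightarrow> a * s x \<le> s (a * x)"
    and s_nonneg: "\<And>x. x \<in> H \<Longrightarrow> 0 \<le> x \<Longrightarrow> 0 \<le> s x"
    and W: "W \<in> Bpos" and s_le: "\<And>x. x \<in> H \<Longrightarrow> 0 \<le> x \<Longrightarrow> s x \<le> W x"
  shows "\<exists>S\<in>Bpos. \<forall>x\<in>H. 0 \<le> x \<longrightarrow> S x = s x"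
proof -
  define S where "S x = (if x \<in> H then s (pprt x) - s (pprt (- x)) else 0)" for x
  have WB: "W \<in> B" using W by (rule Bpos_in_B)
  have sH: "s x \<in> H" if "x \<in> H" "0 \<le> x" for x
    by (rule H_solid_nonneg[OF B_in_H[OF WB that(1)] s_nonneg[OF that] s_le[OF that]])
  \<comment> \<open>Additivity of \<open>s\<close> makes the value independent of how a vector is
    written as a difference of positive ones, so sums and multiples can be evaluated in whichever
    decomposition is convenient.\<close>
  have S_diff: "S (u - v) = s u - s v" if "u \<in> H" "v \<in> H" "0 \<le> u" "0 \<le> v" for u v
  proof -
    have H: "u - v \<in> H" "pprt (u - v) \<in> H" "pprt (- (u - v)) \<in> H"
      using that by (auto simp only: intro: H_diff H_pprt H_minus)
    have "pprt (u - v) + v = pprt (- (u - v)) + u"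
      using pprt_minus[of "u - v"] by (simp add: algebra_simps)
    then have "s (pprt (u - v)) + s v = s (pprt (- (u - v))) + s u"
      using s_add[of "pprt (u - v)" v] s_add[of "pprt (- (u - v))" u] H that by simp
    then show ?thesis using H by (simp add: S_def algebra_simps)
  qed
  have S_pos: "S x = s x" if "x \<in> H" "0 \<le> x" for x
    using S_diff[of x 0] s_add[of 0 0] that by (simp add: H_zero)
  have homog: "s (a * x) = a * s x" if "a \<in> A" "0 \<le> a" "x \<in> H" "0 \<le> x" for a x
    using homogeneous_if_superhomogeneous[of s a x] s_add s_A that by blast
  have parts: "pprt x \<in> H" "pprt (- x) \<in> H" if "x \<in> H" for x
    using that by (auto intro: H_pprt H_minus)
  obtain k where k: "k \<in> A" "0 \<le> k" "\<And>x. x \<in> H \<Longrightarrow> \<tau> (W x * W x) \<le> (k * k) * \<tau> (x * x)"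
    using WB by (rule B_bound) blast
  have "S \<in> B"
  proof (rule BI[OF _ _ _ _ k(1,2)])
    show "S x = 0" if "x \<notin> H" for x using that by (simp add: S_def)
    show SH: "S x \<in> H" if "x \<in> H" for x
      using that H_diff[OF sH[OF parts(1)[OF that]] sH[OF parts(2)[OF that]]] by (simp add: S_def)
    show "S (x + y) = S x + S y" if xy: "x \<in> H" "y \<in> H" for x y
    proof -
      note p = parts[OF xy(1)] parts[OF xy(2)]
      have "(pprt x + pprt y) - (pprt (- x) + pprt (- y)) = (pprt x - pprt (- x)) + (pprt y - pprt (- y))"
        by (simp add: algebra_simps)
      also have "\<dots> = x + y" by (simp only: pprt_minus)
      finally have "x + y = (pprt x + pprt y) - (pprt (- x) + pprt (- y))" by simp
      then have "S (x + y) = s (pprt x + pprt y) - s (pprt (- x) + pprt (- y))"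
        using p by (simp add: S_diff H_add)
      then show ?thesis using p xy by (simp add: S_def s_add)
    qed
    show "S (a * x) = a * S x" if ax: "a \<in> A" "x \<in> H" for a x
    proof -
      note p = parts[OF ax(2)]
      have q: "pprt a \<in> A" "pprt (- a) \<in> A" using ax A_scale[of a "-1"] by (auto intro: A_pprt)
      let ?u = "pprt a * pprt x + pprt (- a) * pprt (- x)"
      let ?v = "pprt a * pprt (- x) + pprt (- a) * pprt x"
      have "?u - ?v = (pprt a - pprt (- a)) * (pprt x - pprt (- x))" by (simp add: algebra_simps)
      also have "\<dots> = a * x" by (simp only: pprt_minus)
      finally have eq: "a * x = ?u - ?v" by simp
      have "S (a * x) = s ?u - s ?v"
        unfolding eq using p q by (intro S_diff H_add H_A_mult add_nonneg_nonneg mult_nonneg_nonneg zero_le_pprt)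
      also have "\<dots> = (pprt a - pprt (- a)) * (s (pprt x) - s (pprt (- x)))"
      proof -
        have "s ?u = pprt a * s (pprt x) + pprt (- a) * s (pprt (- x))"
          and "s ?v = pprt a * s (pprt (- x)) + pprt (- a) * s (pprt x)"
          using p q by (simp_all add: s_add homog H_A_mult)
        then show ?thesis by (simp add: algebra_simps)
      qed
      finally show ?thesis using ax by (simp add: pprt_minus S_def)
    qed
    show "\<tau> (S x * S x) \<le> (k * k) * \<tau> (x * x)" if x: "x \<in> H" for x
    proof -
      note p = parts[OF x]
      have "\<bar>S x\<bar> \<le> s (pprt x) + s (pprt (- x))"
        using x p s_nonneg[OF p(1)] s_nonneg[OF p(2)] by (intro abs_leI) (auto simp: S_def add_increasing add_increasing2 diff_le_eq)
      also have "\<dots> = s \<bar>x\<bar>" using p by (simp add: abs_pprt s_add)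
      also have "\<dots> \<le> W \<bar>x\<bar>" using x by (intro s_le H_abs) auto
      finally have le: "\<bar>S x\<bar> \<le> W \<bar>x\<bar>" .
      have "S x * S x = \<bar>S x\<bar> * \<bar>S x\<bar>" by (simp only: abs_mult_abs)
      also have "\<dots> \<le> W \<bar>x\<bar> * W \<bar>x\<bar>" 
        using le order_trans[OF abs_ge_zero le] by (intro mult_mono) auto
      finally have "\<tau> (S x * S x) \<le> \<tau> (W \<bar>x\<bar> * W \<bar>x\<bar>)"
        using SH[OF x] B_in_H[OF WB H_abs[OF x]] by (intro exp_mono H_square)
      also have "\<dots> \<le> (k * k) * \<tau> (\<bar>x\<bar> * \<bar>x\<bar>)" using k(3)[OF H_abs[OF x]] .
      also have "\<bar>x\<bar> * \<bar>x\<bar> = x * x" by (rule abs_mult_abs)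
      finally show ?thesis .
    qed
  qed
  then have "S \<in> Bpos" using S_pos s_nonneg by (simp add: Bpos_iff)
  then show ?thesis using S_pos by blast
qed

text \<open>\<open>rk X x v\<close>: \<open>v = S\<^sub>1 x\<^sub>1 + \<dots> + S\<^sub>n x\<^sub>n\<close> for some decomposition \<open>x = x\<^sub>1 + \<dots> + x\<^sub>n\<close> in \<open>H\<^sub>+\<close> and
  operators \<open>S\<^sub>i\<close> in \<open>X\<close>.\<close>

inductive rk :: "('u \<Rightarrow> 'u) set \<Rightarrow> 'u \<Rightarrow> 'u \<Rightarrow> bool" for X where
  rk_zero: "rk X 0 0"
| rk_step: "S \<in> X \<Longrightarrow> x \<in> H \<Longrightarrow> 0 \<le> x \<Longrightarrow> rk X y v \<Longrightarrow> rk X (x + y) (S x + v)"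

section \<open>Riesz--Kantorovich sums and their suprema\<close>

lemma rk_domain: "rk X x v \<Longrightarrow> x \<in> H \<and> 0 \<le> x"
  by (induction rule: rk.induct) (auto simp: H_zero intro: H_add)

lemma rk_single: "S \<in> X \<Longrightarrow> x \<in> H \<Longrightarrow> 0 \<le> x \<Longrightarrow> rk X x (S x)"
  using rk_step[OF _ _ _ rk_zero] by fastforce

lemma rk_add: "rk X x v \<Longrightarrow> rk X y w \<Longrightarrow> rk X (x + y) (v + w)"
  by (induction rule: rk.induct) (auto simp: add.assoc intro: rk_step)

lemma rk_mult:
  assumes "X \<subseteq> B" "rk X x v" "a \<in> A" "0 \<le> a" shows "rk X (a * x) (a * v)"
  using assms(2)
proof (induction rule: rk.induct)
  case rk_zero
  then show ?case by (simp add: rk.rk_zero)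
next
  case (rk_step S x y v)
  then have "rk X (a * x + a * y) (S (a * x) + a * v)"
    using assms by (intro rk.rk_step) (auto intro: H_A_mult)
  moreover have "S (a * x) = a * S x" using assms(1,3) rk_step B_A by blast
  ultimately show ?case by (simp add: distrib_left)
qed

text \<open>Each summand \<open>z1 \<le> x + y\<close> is split by Riesz decomposition and the
  induction continues with what is left of \<open>x\<close> and \<open>y\<close>. This makes the
  supremum of the sums subadditive; \<open>rk_add\<close> gives the other direction.\<close>

lemma rk_split:
  assumes "X \<subseteq> B" "rk X z v" "z = x + y" "x \<in> H" "y \<in> H" "0 \<le> x" "0 \<le> y"
  shows "\<exists>v1 v2. rk X x v1 \<and> rk X y v2 \<and> v = v1 + v2"
  using assms(2-)
proof (induction arbitrary: x y rule: rk.induct)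
  case rk_zero
  then have "x = 0" "y = 0" using add_nonneg_eq_0_iff[of x y] by auto
  then show ?case using rk.rk_zero by fastforce
next
  case (rk_step S z1 z2 v)
  have z2: "z2 \<in> H" "0 \<le> z2" using rk_domain[OF rk_step.hyps(4)] by auto
  have "z1 \<le> x + y" using z2 by (simp flip: rk_step.prems(1))
  note split = riesz_split[OF rk_step.prems(4,5) rk_step.hyps(3) this]
  let ?x1 = "inf x z1" and ?y1 = "z1 - inf x z1"
  have H: "?x1 \<in> H" "?y1 \<in> H"
  proof -
    show "?x1 \<in> H" by (rule H_solid_nonneg[OF rk_step.prems(2) split(1,2)])
    then show "?y1 \<in> H" using rk_step.hyps(2) by (rule H_diff[rotated])
  qed
  have "z2 = (x - ?x1) + (y - ?y1)" using rk_step.prems(1) by (simp add: algebra_simps)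
  then obtain v1 v2 where v: "rk X (x - ?x1) v1" "rk X (y - ?y1) v2" "v = v1 + v2"
    using rk_step.IH[of "x - ?x1" "y - ?y1"] split H rk_step.prems by (auto intro: H_diff)
  have "S z1 = S ?x1 + S ?y1"
    using B_add[of S ?x1 ?y1] assms(1) rk_step.hyps(1) H by auto
  moreover have "rk X (?x1 + (x - ?x1)) (S ?x1 + v1)" "rk X (?y1 + (y - ?y1)) (S ?y1 + v2)"
    using v rk_step.hyps(1) H split by (blast intro: rk.rk_step)+
  ultimately show ?case using v(3)
    by (intro exI[of _ "S ?x1 + v1"] exI[of _ "S ?y1 + v2"]) (simp add: add_ac)
qed

lemma rk_le:
  assumes "W \<in> B" "\<And>S. S \<in> X \<Longrightarrow> S \<sqsubseteq> W" "rk X x v" shows "v \<le> W x"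
  using assms(3)
proof (induction rule: rk.induct)
  case rk_zero
  then show ?case by (simp add: B_zero[OF assms(1)])
next
  case (rk_step S x y v)
  then have "S x \<le> W x" using assms(2) by (auto simp: ople_iff)
  moreover have "W (x + y) = W x + W y"
    using rk_step rk_domain[OF rk_step.hyps(4)] by (intro B_add[OF assms(1)]) auto
  ultimately show ?case using rk_step.IH by (simp add: add_mono)
qed

text \<open>Pointwise suprema over an undirected family need not be additive; admitting different
  operators on the pieces of \<open>x\<close> repairs this. The condition \<open>pos\<close> makes
  the supremum order positive: it holds for a family containing 0 and for a family
  \<open>{S, \<lambda>x. - S x}\<close>, the two applications below.\<close>

lemma rk_lub:
  assumes X: "X \<subseteq> B" "X \<noteq> {}" and W: "W \<in> Bpos" "\<And>S. S \<in> X \<Longrightarrow> S \<sqsubseteq> W"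
    and pos: "\<And>x u. x \<in> H \<Longrightarrow> 0 \<le> x \<Longrightarrow> (\<And>S. S \<in> X \<Longrightarrow> S x \<le> u) \<Longrightarrow> 0 \<le> u"
  shows "\<exists>S\<in>Bpos. is_lub_on ople Breg X S \<and> (\<forall>x\<in>H. 0 \<le> x \<longrightarrow> lub {v. rk X x v} (S x))"
proof -
  define s where "s x = Sup {v. rk X x v}" for x
  have lub: "lub {v. rk X x v} (s x)" if "x \<in> H" "0 \<le> x" for x
    unfolding s_def
  proof (rule lub_Sup)
    show "{v. rk X x v} \<noteq> {}" using X(2) rk_single[of _ X x] that by blast
    show "bdd_above {v. rk X x v}"
      using rk_le[OF Bpos_in_B[OF W(1)] W(2)] by (intro bdd_aboveI[of _ "W x"]) auto
  qed
  have s_ge: "v \<le> s x" if "rk X x v" for x v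
    using lub_upper[OF lub] rk_domain[OF that] that by blast
  have s_least: "s x \<le> u" if "x \<in> H" "0 \<le> x" "\<And>v. rk X x v \<Longrightarrow> v \<le> u" for x u
    using lub_least[OF lub] that by blast
  have "\<exists>S\<in>Bpos. \<forall>x\<in>H. 0 \<le> x \<longrightarrow> S x = s x"
  proof (rule positive_extension[OF _ _ _ W(1)])
    fix x y assume xy: "x \<in> H" "y \<in> H" "0 \<le> x" "0 \<le> y"
    show "s (x + y) = s x + s y"
    proof (rule order.antisym)
      show "s (x + y) \<le> s x + s y"
      proof (rule s_least)
        fix v assume "rk X (x + y) v"
        then obtain v1 v2 where "rk X x v1" "rk X y v2" "v = v1 + v2"
          using rk_split[OF X(1) _ refl xy] by blast
        then show "v \<le> s x + s y" using s_ge by (simp add: add_mono)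
      qed (use xy in \<open>auto intro: H_add\<close>)
      have "s x \<le> s (x + y) - w" if "rk X y w" for w
      proof (rule s_least[OF xy(1,3)])
        fix v assume "rk X x v"
        then have "v + w \<le> s (x + y)" using that by (intro s_ge rk_add)
        then show "v \<le> s (x + y) - w" by (simp add: algebra_simps)
      qed
      then have "s y \<le> s (x + y) - s x"
        by (intro s_least[OF xy(2,4)]) (simp add: algebra_simps)
      then show "s x + s y \<le> s (x + y)" by (simp add: algebra_simps)
    qed
  next
    fix a x assume a: "a \<in> A" "0 \<le> a" "x \<in> H" "0 \<le> x"
    show "a * s x \<le> s (a * x)"
    proof (rule lub_least[OF lub_mult[OF lub[OF a(3,4)] a(2)]])
      fix d assume "d \<in> (*) a ` {v. rk X x v}"
      then show "d \<le> s (a * x)" using a by (auto intro: s_ge rk_mult[OF X(1)])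
    qed
  next
    fix x assume x: "x \<in> H" "0 \<le> x"
    show "0 \<le> s x" using x by (rule pos) (use x in \<open>auto intro: s_ge rk_single\<close>)
    show "s x \<le> W x" using x by (intro s_least rk_le[OF Bpos_in_B[OF W(1)] W(2)])
  qed
  then obtain S where S: "S \<in> Bpos" "\<And>x. x \<in> H \<Longrightarrow> 0 \<le> x \<Longrightarrow> S x = s x" by blast
  have "is_lub_on ople Breg X S"
    unfolding is_lub_on_def
  proof (intro conjI ballI impI)
    show "S \<in> Breg" using S(1) by (rule Bpos_in_Breg)
    show "R \<sqsubseteq> S" if "R \<in> X" for R using that S(2) by (auto simp: ople_iff intro: s_ge rk_single)
    show "S \<sqsubseteq> U" if "U \<in> Breg" "\<forall>R\<in>X. R \<sqsubseteq> U" for U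
      unfolding ople_iff
    proof (intro ballI impI)
      fix x assume x: "x \<in> H" "0 \<le> x"
      have "s x \<le> U x" using that by (intro s_least[OF x] rk_le[OF Breg_in_B]) auto
      then show "S x \<le> U x" using S(2) x by simp
    qed
  qed
  then show ?thesis using S lub by fastforce
qed

text \<open>Subtracting one member \<open>S0\<close> of the family puts 0 into it and makes the
  translated upper bound order positive, as \<open>rk_lub\<close> requires.\<close>

lemma reg_lub_exists:
  assumes X: "X \<subseteq> Breg" "X \<noteq> {}" and U: "U \<in> Breg" "\<And>S. S \<in> X \<Longrightarrow> S \<sqsubseteq> U"
  shows "\<exists>S. is_lub_on ople Breg X S"
proof -
  obtain S0 where S0: "S0 \<in> X" using X by blast
  then have S0r: "S0 \<in> Breg" using X by blast
  define Y where "Y = (\<lambda>S x. S x - S0 x) ` X"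
  have "Y \<subseteq> Breg" unfolding Y_def using X S0r by (auto intro: Breg_minus)
  have "\<exists>S\<in>Bpos. is_lub_on ople Breg Y S \<and> (\<forall>x\<in>H. 0 \<le> x \<longrightarrow> lub {v. rk Y x v} (S x))"
  proof (rule rk_lub)
    show "Y \<subseteq> B" using \<open>Y \<subseteq> Breg\<close> Breg_in_B by blast
    show "Y \<noteq> {}" using X by (simp add: Y_def)
    show "(\<lambda>x. U x - S0 x) \<in> Bpos" using U S0 S0r by (simp flip: ople_pos_iff)
    show "S \<sqsubseteq> (\<lambda>x. U x - S0 x)" if "S \<in> Y" for S
      using that U by (auto simp: Y_def ople_iff)
    show "0 \<le> u" if "\<And>S. S \<in> Y \<Longrightarrow> S x \<le> u" for x u
    proof -
      have "(\<lambda>x. S0 x - S0 x) \<in> Y" unfolding Y_def using S0 by blast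
      from that[OF this] show ?thesis by simp
    qed
  qed
  then obtain S where S: "S \<in> Breg" "\<And>R. R \<in> Y \<Longrightarrow> R \<sqsubseteq> S"
      "\<And>V. V \<in> Breg \<Longrightarrow> (\<forall>R\<in>Y. R \<sqsubseteq> V) \<Longrightarrow> S \<sqsubseteq> V"
    by (auto simp: is_lub_on_def)
  have "is_lub_on ople Breg X (\<lambda>x. S x + S0 x)"
    unfolding is_lub_on_def
  proof (intro conjI ballI impI)
    show "(\<lambda>x. S x + S0 x) \<in> Breg" using S S0r by (intro Breg_plus)
    show "R \<sqsubseteq> (\<lambda>x. S x + S0 x)" if "R \<in> X" for R
      using S(2)[of "\<lambda>x. R x - S0 x"] that by (auto simp: Y_def ople_iff diff_le_eq)
    show "(\<lambda>x. S x + S0 x) \<sqsubseteq> V" if "V \<in> Breg" "\<forall>R\<in>X. R \<sqsubseteq> V" for V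
      using S(3)[OF Breg_minus[OF that(1) S0r]] that(2) by (auto simp: Y_def ople_iff le_diff_eq)
  qed
  then show ?thesis by blast
qed

lemma reg_glb_exists:
  assumes X: "X \<subseteq> Breg" "X \<noteq> {}" and U: "U \<in> Breg" "\<And>S. S \<in> X \<Longrightarrow> U \<sqsubseteq> S"
  shows "\<exists>S. is_glb_on ople Breg X S"
proof -
  let ?Y = "(\<lambda>S x. - S x) ` X"
  have neg: "(\<lambda>x. - S x) \<sqsubseteq> (\<lambda>x. - R x) \<longleftrightarrow> R \<sqsubseteq> S" for S R by (simp add: ople_iff)
  have "\<exists>S. is_lub_on ople Breg ?Y S"
    using X U by (intro reg_lub_exists[of _ "\<lambda>x. - U x"]) (auto simp: neg intro: Breg_uminus)
  then obtain S where S: "S \<in> Breg" "\<And>R. R \<in> X \<Longrightarrow> (\<lambda>x. - R x) \<sqsubseteq> S"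
      "\<And>V. V \<in> Breg \<Longrightarrow> (\<forall>R\<in>X. (\<lambda>x. - R x) \<sqsubseteq> V) \<Longrightarrow> S \<sqsubseteq> V"
    by (auto simp: is_lub_on_def)
  have "is_glb_on ople Breg X (\<lambda>x. - S x)"
    unfolding is_glb_on_def
  proof (intro conjI ballI impI)
    show "(\<lambda>x. - S x) \<in> Breg" using S by (intro Breg_uminus)
    show "(\<lambda>x. - S x) \<sqsubseteq> R" if "R \<in> X" for R
      using S(2)[OF that] neg[of S "\<lambda>x. - R x"] by simp
    show "V \<sqsubseteq> (\<lambda>x. - S x)" if "V \<in> Breg" "\<forall>R\<in>X. V \<sqsubseteq> R" for V
      using S(3)[OF Breg_uminus[OF that(1)]] that(2) neg neg[of "\<lambda>x. - V x" S] by simp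
  qed
  then show ?thesis by blast
qed

text \<open>A Riesz--Kantorovich sum for \<open>S\<close> and its negative attaches signs to the
  pieces of \<open>x\<close>. Moving the signs into the arguments gives \<open>S w\<close> with
  \<open>\<bar>w\<bar> \<le> x\<close>, hence a value at most \<open>\<bar>S w\<bar>\<close>.
  Conversely \<open>\<bar>S u\<bar> \<le> L \<bar>u\<bar>\<close>, which is at most
  \<open>L x\<close>. So the modulus formula and the lattice supremum agree.\<close>

lemma op_abs_lub:
  assumes "S \<in> Breg"
  shows "is_lub_on ople Breg {S, \<lambda>x. - S x} (op_abs E T S)"
proof -
  let ?X = "{S, \<lambda>x. - S x}"
  obtain P Q where PQ: "P \<in> Bpos" "Q \<in> Bpos" "S = (\<lambda>x. P x - Q x)" using assms by (rule BregE)
  have SB: "S \<in> B" using assms by (rule Breg_in_B)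
  have "\<exists>L\<in>Bpos. is_lub_on ople Breg ?X L \<and> (\<forall>x\<in>H. 0 \<le> x \<longrightarrow> lub {v. rk ?X x v} (L x))"
  proof (rule rk_lub)
    show "?X \<subseteq> B" using SB B_uminus by blast
    show "(\<lambda>x. P x + Q x) \<in> Bpos" using PQ by (intro Bpos_plus)
    show "R \<sqsubseteq> (\<lambda>x. P x + Q x)" if "R \<in> ?X" for R
      using that Bpos_nonneg[OF PQ(1)] Bpos_nonneg[OF PQ(2)]
      by (auto simp: ople_iff PQ(3) diff_le_eq intro: add_increasing add_increasing2 order_trans[of _ 0])
    show "0 \<le> u" if "\<And>R. R \<in> ?X \<Longrightarrow> R x \<le> u" for x u
    proof -
      have "\<bar>S x\<bar> \<le> u" using that by (intro abs_leI) auto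
      then show ?thesis by (rule order_trans[OF abs_ge_zero])
    qed
  qed simp
  then obtain L where L: "L \<in> Bpos" "is_lub_on ople Breg ?X L"
      and rk: "\<And>x. x \<in> H \<Longrightarrow> 0 \<le> x \<Longrightarrow> lub {v. rk ?X x v} (L x)" by blast
  have LB: "L \<in> B" using L(1) by (rule Bpos_in_B)
  have SL: "S x \<le> L x" "- S x \<le> L x" if "x \<in> H" "0 \<le> x" for x
    using L(2) that by (auto simp: is_lub_on_def ople_iff)
  have abs_le: "\<bar>S u\<bar> \<le> L \<bar>u\<bar>" if "u \<in> H" for u
  proof -
    have p: "pprt u \<in> H" "pprt (- u) \<in> H" using that by (auto intro: H_pprt H_minus)
    have "\<bar>S u\<bar> \<le> \<bar>S (pprt u)\<bar> + \<bar>S (pprt (- u))\<bar>"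
      by (subst B_pprt[OF SB that]) (rule abs_triangle_ineq4)
    also have "\<dots> \<le> L (pprt u) + L (pprt (- u))"
      using SL[OF p(1)] SL[OF p(2)] by (intro add_mono abs_leI) auto
    also have "\<dots> = L \<bar>u\<bar>" unfolding abs_pprt using p by (intro B_add[OF LB, symmetric])
    finally show ?thesis .
  qed
  have L_mono: "L x \<le> L y" if "x \<in> H" "y \<in> H" "x \<le> y" for x y
    using Bpos_nonneg[OF L(1), of "y - x"] B_diff[OF LB that(2,1)] that by (simp add: H_diff)
  have rk_value: "\<exists>w\<in>H. \<bar>w\<bar> \<le> x \<and> v = S w" if "rk ?X x v" for x v
    using that
  proof (induction rule: rk.induct)
    case rk_zero
    then show ?case by (intro bexI[of _ 0]) (auto simp: H_zero B_zero[OF SB])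
  next
    case (rk_step R x y v)
    then obtain w where w: "w \<in> H" "\<bar>w\<bar> \<le> y" "v = S w" by blast
    obtain x' where x': "x' \<in> H" "\<bar>x'\<bar> = x" "R x = S x'"
      using rk_step.hyps(1-3) B_minus[OF SB, of x] H_minus[of x] by (auto intro: that[of x] that[of "- x"])
    have "\<bar>x' + w\<bar> \<le> x + y"
      using abs_triangle_ineq[of x' w] w(2) x'(2) by (meson add_mono order_refl order_trans eq_refl)
    then show ?case
      using x' w B_add[OF SB x'(1) w(1)] by (intro bexI[of _ "x' + w"]) (auto intro: H_add)
  qed
  have RK: "riesz_kantorovich E T S x = L x" if x: "x \<in> H" "0 \<le> x" for x
    unfolding riesz_kantorovich_def
  proof (rule the_equality)
    let ?Y = "{\<bar>S u\<bar> |u. u \<in> H \<and> \<bar>u\<bar> \<le> x}"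
    show lub: "is_lub_on (\<le>) H ?Y (L x)"
      unfolding is_lub_on_def
    proof (intro conjI ballI impI)
      show "L x \<in> H" using LB x(1) by (rule B_in_H)
      show "y \<le> L x" if "y \<in> ?Y" for y
        using that x abs_le L_mono[OF H_abs x(1)] by (auto intro: order_trans)
      fix u assume u: "u \<in> H" "\<forall>y\<in>?Y. y \<le> u"
      show "L x \<le> u"
      proof (rule lub_least[OF rk[OF x]])
        fix v assume "v \<in> {v. rk ?X x v}"
        then obtain w where w: "w \<in> H" "\<bar>w\<bar> \<le> x" "v = S w" using rk_value by blast
        have "v \<le> \<bar>S w\<bar>" unfolding w(3) by (rule abs_ge_self)
        also have "\<dots> \<le> u" using u(2) w by blast
        finally show "v \<le> u" .
      qed
    qed
    fix t assume "is_lub_on (\<le>) H ?Y t"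
    with lub show "t = L x" unfolding is_lub_on_def by (meson order.antisym)
  qed
  have "op_abs E T S = L"
  proof
    fix x show "op_abs E T S x = L x"
    proof (cases "x \<in> H")
      case True
      then have "pprt x \<in> H" "pprt (- x) \<in> H" by (auto intro: H_pprt H_minus)
      then show ?thesis
        using True by (simp add: op_abs_def RK B_pprt[OF LB True] flip: pprt_def)
    next
      case False
      then show ?thesis by (simp add: op_abs_def B_outside[OF LB])
    qed
  qed
  with L(2) show ?thesis by simp
qed

text \<open>The adjoint maps the pair of \<open>S\<close> and its negative to the pair of
  \<open>adj S\<close> and its negative, so both sides are the least upper bound of the same
  pair.\<close>

lemma adjoint_op_abs:
  assumes "S \<in> Breg" shows "op_abs E T S \<in> Breg" "adj (op_abs E T S) = op_abs E T (adj S)"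
proof -
  note lub = op_abs_lub[OF assms]
  show reg: "op_abs E T S \<in> Breg" using lub by (simp add: is_lub_on_def)
  have "adj (\<lambda>x. - S x) = (\<lambda>x. - adj S x)"
    using adjoint_scaleR[OF assms, of "-1"] by simp
  then have "adj ` {S, \<lambda>x. - S x} = {adj S, \<lambda>x. - adj S x}" by simp
  then have l1: "is_lub_on ople Breg {adj S, \<lambda>x. - adj S x} (adj (op_abs E T S))"
    using adjoint_lub[OF _ lub] assms Breg_uminus[OF assms] by simp
  have l2: "is_lub_on ople Breg {adj S, \<lambda>x. - adj S x} (op_abs E T (adj S))"
    using assms by (intro op_abs_lub adjoint_reg)
  have "adj (op_abs E T S) \<sqsubseteq> op_abs E T (adj S)" "op_abs E T (adj S) \<sqsubseteq> adj (op_abs E T S)"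
      "adj (op_abs E T S) \<in> B" "op_abs E T (adj S) \<in> B"
    using l1 l2 Breg_in_B unfolding is_lub_on_def by blast+
  then show "adj (op_abs E T S) = op_abs E T (adj S)" using ople_antisym by blast
qed

lemma adjoint_op_parts:
  assumes "S \<in> Breg"
  shows "adj (op_pos_part E T S) = op_pos_part E T (adj S)"
    and "adj (op_neg_part E T S) = op_neg_part E T (adj S)"
proof -
  note abs = adjoint_op_abs[OF assms]
  have "op_pos_part E T S = (\<lambda>x. (1/2) *\<^sub>R (op_abs E T S x + S x))" for S
    by (simp add: op_pos_part_def fun_eq_iff)
  then show "adj (op_pos_part E T S) = op_pos_part E T (adj S)"
    using assms abs by (simp add: adjoint_scaleR adjoint_plus Breg_plus)
  have "op_neg_part E T S = (\<lambda>x. (1/2) *\<^sub>R (op_abs E T S x - S x))" for S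
    by (simp add: op_neg_part_def fun_eq_iff)
  then show "adj (op_neg_part E T S) = op_neg_part E T (adj S)"
    using assms abs by (simp add: adjoint_scaleR adjoint_minus Breg_minus)
qed

section \<open>Bounded families and increasing nets of operators\<close>

lemma adjoint_family_lub:
  assumes "I \<noteq> {}" "F ` I \<subseteq> Breg" "\<exists>U\<in>Breg. \<forall>i\<in>I. F i \<sqsubseteq> U"
  shows "\<exists>S. is_lub_on ople Breg (F ` I) S \<and>
    is_lub_on ople Breg ((\<lambda>i. adj (F i)) ` I) (adj S)"
proof -
  obtain U where "U \<in> Breg" "\<forall>i\<in>I. F i \<sqsubseteq> U" using assms(3) by blast
  then obtain S where "is_lub_on ople Breg (F ` I) S"
    using reg_lub_exists[OF assms(2), of U] assms(1) by auto
  then show ?thesis using adjoint_lub[OF assms(2)] by (auto simp: image_image)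
qed

lemma adjoint_family_glb:
  assumes "I \<noteq> {}" "F ` I \<subseteq> Breg" "\<exists>U\<in>Breg. \<forall>i\<in>I. U \<sqsubseteq> F i"
  shows "\<exists>S. is_glb_on ople Breg (F ` I) S \<and>
    is_glb_on ople Breg ((\<lambda>i. adj (F i)) ` I) (adj S)"
proof -
  obtain U where "U \<in> Breg" "\<forall>i\<in>I. U \<sqsubseteq> F i" using assms(3) by blast
  then obtain S where "is_glb_on ople Breg (F ` I) S"
    using reg_glb_exists[OF assms(2), of U] assms(1) by auto
  then show ?thesis using adjoint_glb[OF assms(2)] by (auto simp: image_image)
qed

lemma adjoint_increasing_net:
  assumes "increasing_net_to r I ople Breg F S"
  shows "increasing_net_to r I ople Breg (\<lambda>i. adj (F i)) (adj S)"
proof -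
  have F: "F ` I \<subseteq> Breg" "is_lub_on ople Breg (F ` I) S" "\<And>i j. i \<in> I \<Longrightarrow> j \<in> I \<Longrightarrow> r i j \<Longrightarrow> F i \<sqsubseteq> F j"
    using assms unfolding increasing_net_to_def by blast+
  have "is_lub_on ople Breg ((\<lambda>i. adj (F i)) ` I) (adj S)"
    using adjoint_lub[OF F(1,2)] by (simp add: image_image)
  moreover have "(\<lambda>i. adj (F i)) ` I \<subseteq> Breg" using F(1) by (auto intro: adjoint_reg)
  moreover have "adj (F i) \<sqsubseteq> adj (F j)" if "i \<in> I" "j \<in> I" "r i j" for i j
    using F(1) F(3)[OF that] that by (intro adjoint_mono) auto
  moreover note assms[unfolded increasing_net_to_def, THEN conjunct1]
    assms[unfolded increasing_net_to_def, THEN conjunct2, THEN conjunct1]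
    assms[unfolded increasing_net_to_def, THEN conjunct2, THEN conjunct2, THEN conjunct1]
  ultimately show ?thesis unfolding increasing_net_to_def by (intro conjI) (blast | assumption)+
qed

end

theorem theorem9p15:
  fixes E :: "'u::universally_complete_f_algebra set" and e :: 'u and T :: "'u \<Rightarrow> 'u"
  assumes "riesz_conditional_expectation E e T"
  shows
    "bij_betw (adjoint_T E T) (B_T_reg E T) (B_T_reg E T) \<and>
     (\<forall>S\<in>B_T_reg E T. \<forall>R\<in>B_T_reg E T.
        adjoint_T E T (\<lambda>x. S x + R x) = (\<lambda>x. adjoint_T E T S x + adjoint_T E T R x)) \<and>
     (\<forall>c::real. \<forall>S\<in>B_T_reg E T.
        adjoint_T E T (\<lambda>x. c *\<^sub>R S x) = (\<lambda>x. c *\<^sub>R adjoint_T E T S x)) \<and>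
     (\<forall>S\<in>B_T_reg E T. \<forall>R\<in>B_T_reg E T.
        op_le E T S R \<longleftrightarrow> op_le E T (adjoint_T E T S) (adjoint_T E T R)) \<and>
     (\<forall>S\<in>B_T_reg E T.
        adjoint_T E T (op_abs E T S) = op_abs E T (adjoint_T E T S) \<and>
        adjoint_T E T (op_pos_part E T S) = op_pos_part E T (adjoint_T E T S) \<and>
        adjoint_T E T (op_neg_part E T S) = op_neg_part E T (adjoint_T E T S)) \<and>
     (\<forall>(I::'i set) F. I \<noteq> {} \<longrightarrow> F ` I \<subseteq> B_T_reg E T \<longrightarrow>
        (\<exists>U\<in>B_T_reg E T. \<forall>i\<in>I. op_le E T (F i) U) \<longrightarrow>
        (\<exists>S. is_lub_on (op_le E T) (B_T_reg E T) (F ` I) S \<and>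
             is_lub_on (op_le E T) (B_T_reg E T) ((\<lambda>i. adjoint_T E T (F i)) ` I)
               (adjoint_T E T S))) \<and>
     (\<forall>(I::'i set) F. I \<noteq> {} \<longrightarrow> F ` I \<subseteq> B_T_reg E T \<longrightarrow>
        (\<exists>L\<in>B_T_reg E T. \<forall>i\<in>I. op_le E T L (F i)) \<longrightarrow>
        (\<exists>S. is_glb_on (op_le E T) (B_T_reg E T) (F ` I) S \<and>
             is_glb_on (op_le E T) (B_T_reg E T) ((\<lambda>i. adjoint_T E T (F i)) ` I)
               (adjoint_T E T S))) \<and>
     (\<forall>(r::'i \<Rightarrow> 'i \<Rightarrow> bool) I F S.
        increasing_net_to r I (op_le E T) (B_T_reg E T) F S \<longrightarrow>
        increasing_net_to r I (op_le E T) (B_T_reg E T) (\<lambda>i. adjoint_T E T (F i))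
          (adjoint_T E T S))"
proof -
  interpret riesz_conditional_expectation E e T by (rule assms)
  show ?thesis
    by (intro conjI ballI allI impI;
        rule adjoint_bij adjoint_plus adjoint_scaleR adjoint_le_iff adjoint_op_abs(2) adjoint_op_parts
          adjoint_family_lub adjoint_family_glb adjoint_increasing_net; assumption)
qed

end
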